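(* Let $\{a_n\}$ be positive numbers with $a_n\to\infty$ and let $\{\xi^n\}_{n\in\mathbb{N}}$ be an $\mathcal{M}(\Delta)$-valued process with $\sup_{n\in\mathbb{N}}a_n^{-1}\log\mathbb{E}[\exp(a_n\lambda\xi^n(\Delta))]<\infty$ for every $\lambda>0$. Assume that for every finite family $\mathcal{P}=\{(s_i,t_i)\}_{i=1}^h$ with $0\le s_i<t_i<\infty$, the $\mathbb{R}^h$-valued process $\{(\xi^n([0,s_1]\times(t_1,\infty]),\dots,\xi^n([0,s_h]\times(t_h,\infty]))\}_{n\in\mathbb{N}}$ satisfies an LDP with speed $a_n$ and good rate function $I_\mathcal{P}$. Then $\{\xi^n\}$ satisfies an LDP with speed $a_n$ and a good rate function $I:\mathcal{M}(\Delta)\to[0,\infty]$. Moreover: (1) if there is $K>0$ with $\xi^n(\Delta)\le K$ for all $n$, and each $I_\mathcal{P}$ has a unique zero, then $I$ has a unique zero; (2) if each $I_\mathcal{P}$ is convex, then for every $f\in C_c(\Delta)$ the limit $\varphi(f)=\lim_{n\to\infty}a_n^{-1}\log\mathbb{E}[\exp(a_n\int_\Delta f\,d\xi^n)]$ exists in $\mathbb{R}$ and $I(\xi)=\sup_{f\in C_c(\Delta)}\{\int_\Delta f\,d\xi-\varphi(f)\}$ for all $\xi\in\mathcal{M}(\Delta)$.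
   Context: $\Delta=\{(s,t)\in[0,\infty]^2:0\le s<t\le\infty\}$, topologized as homeomorphic to $\{(x,y):0\le x<y\le1\}$. $C_c(\Delta)$: real continuous functions with compact support on $\Delta$. $\mathcal{M}(\Delta)$: Radon measures on $\Delta$ (finite on compacts) with the vague topology (weakest making $\xi\mapsto\int f\,d\xi$ continuous for each $f\in C_c(\Delta)$). LDP with speed $a_n$ and rate function $I$ (lower semicontinuous, $[0,\infty]$-valued): upper bound $-\inf_F I$ for closed $F$, lower bound $-\inf_G I$ for open $G$; good means compact sublevel sets. *)

theory Defs
  imports "HOL-Probability.Probability"
begin

text \<open>Delta = {(s,t) in [0,infinity]^2 : s < t}, realised inside ereal x ereal with the
  product of the order topologies (so [0,infinity] is homeomorphic to [0,1]).\<close>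

definition Delta :: "(ereal \<times> ereal) set" where
  "Delta = {(s, t). 0 \<le> s \<and> s < t}"

definition Cc_Delta :: "(ereal \<times> ereal \<Rightarrow> real) set" where
  "Cc_Delta = {f. continuous_on Delta f \<and>
       (\<exists>K. compact K \<and> K \<subseteq> Delta \<and> (\<forall>x\<in>Delta - K. f x = 0))}"

definition Radon_Delta :: "(ereal \<times> ereal) measure set" where
  "Radon_Delta = {\<mu>. sets \<mu> = sets (restrict_space borel Delta) \<and>
       (\<forall>K. compact K \<and> K \<subseteq> Delta \<longrightarrow> emeasure \<mu> K < \<infinity>)}"

definition vague_topology :: "(ereal \<times> ereal) measure topology" where
  "vague_topology = topology_generated_by
     {{\<xi> \<in> Radon_Delta. (\<integral>x. f x \<partial>\<xi>) \<in> U} | f U. f \<in> Cc_Delta \<and> open U}"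

definition borel_of :: "'a topology \<Rightarrow> 'a measure" where
  "borel_of X = sigma (topspace X) {U. openin X U}"

definition lnE :: "real \<Rightarrow> ereal" where
  "lnE p = (if p \<le> 0 then -\<infinity> else ereal (ln p))"

definition lnEnn :: "ennreal \<Rightarrow> ereal" where
  "lnEnn x = (if x = 0 then -\<infinity> else if x = \<infinity> then \<infinity> else ereal (ln (enn2real x)))"

definition rate_function :: "'a topology \<Rightarrow> ('a \<Rightarrow> ereal) \<Rightarrow> bool" where
  "rate_function X I \<longleftrightarrow> (\<forall>x\<in>topspace X. 0 \<le> I x) \<and>
     (\<forall>c::real. closedin X {x \<in> topspace X. I x \<le> ereal c})"

definition good_rate_function :: "'a topology \<Rightarrow> ('a \<Rightarrow> ereal) \<Rightarrow> bool" where
  "good_rate_function X I \<longleftrightarrow> rate_function X I \<and>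
     (\<forall>c::real. compactin X {x \<in> topspace X. I x \<le> ereal c})"

definition LDP :: "'a topology \<Rightarrow> (nat \<Rightarrow> 'w measure) \<Rightarrow> (nat \<Rightarrow> 'w \<Rightarrow> 'a) \<Rightarrow>
    (nat \<Rightarrow> real) \<Rightarrow> ('a \<Rightarrow> ereal) \<Rightarrow> bool" where
  "LDP X M Y a I \<longleftrightarrow> rate_function X I \<and>
     (\<forall>F. closedin X F \<longrightarrow>
        limsup (\<lambda>n. ereal (1 / a n) * lnE (measure (M n) {\<omega> \<in> space (M n). Y n \<omega> \<in> F}))
          \<le> - (INF x\<in>F. I x)) \<and>
     (\<forall>G. openin X G \<longrightarrow>
        - (INF x\<in>G. I x) \<le>
        liminf (\<lambda>n. ereal (1 / a n) * lnE (measure (M n) {\<omega> \<in> space (M n). Y n \<omega> \<in> G})))"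

text \<open>R^h realised as extensional functions on {..<h} with the product topology.\<close>
abbreviation Rh_topology :: "nat \<Rightarrow> (nat \<Rightarrow> real) topology" where
  "Rh_topology h \<equiv> product_topology (\<lambda>i. euclideanreal) {..<h}"

definition admissible_family :: "(real \<times> real) list \<Rightarrow> bool" where
  "admissible_family P \<longleftrightarrow> (\<forall>(s, t) \<in> set P. 0 \<le> s \<and> s < t)"

definition box_set :: "real \<Rightarrow> real \<Rightarrow> (ereal \<times> ereal) set" where
  "box_set s t = {(u, v). 0 \<le> u \<and> u \<le> ereal s \<and> ereal t < v}"

definition fd_vector :: "(real \<times> real) list \<Rightarrow> (ereal \<times> ereal) measure \<Rightarrow> (nat \<Rightarrow> real)" where
  "fd_vector P \<xi> = restrict (\<lambda>i. measure \<xi> (box_set (fst (P ! i)) (snd (P ! i)))) {..<length P}"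

definition convex_Rh :: "nat \<Rightarrow> ((nat \<Rightarrow> real) \<Rightarrow> ereal) \<Rightarrow> bool" where
  "convex_Rh h I \<longleftrightarrow> (\<forall>x \<in> topspace (Rh_topology h). \<forall>y \<in> topspace (Rh_topology h).
     \<forall>u::real. 0 \<le> u \<and> u \<le> 1 \<longrightarrow>
       I (restrict (\<lambda>i. u * x i + (1 - u) * y i) {..<h}) \<le> ereal u * I x + ereal (1 - u) * I y)"

definition exp_total_mass :: "'w measure \<Rightarrow> ('w \<Rightarrow> (ereal \<times> ereal) measure) \<Rightarrow> real \<Rightarrow> ennreal" where
  "exp_total_mass M \<xi> c = (\<integral>\<^sup>+\<omega>. (if emeasure (\<xi> \<omega>) Delta = \<infinity> then \<infinity>
        else ennreal (exp (c * measure (\<xi> \<omega>) Delta))) \<partial>M)"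

end

theory Submission
  imports Defs
begin

text \<open>
  The rate function is the local rate \<open>I(\<xi>) = sup (- limsup a\<^sub>n\<^sup>-\<^sup>1 log P(\<xi>\<^sup>n \<in> G))\<close>, the supremum
  ranging over the vague neighbourhoods \<open>G\<close> of \<open>\<xi>\<close>. The sets \<open>{\<xi>(\<Delta>) \<le> K}\<close> are vaguely compact and
  by the exponential moments they carry all but an exponentially negligible part of the mass, so an LDP with
  good rate function \<open>I\<close> follows once each \<open>G\<close> contains, up to negligible events, a smaller
  neighbourhood \<open>G'\<close> whose upper rate is at most the lower rate of \<open>G\<close>. Box masses are not vaguely
  continuous, but \<open>\<xi> \<in> G'\<close> forces the vector of box masses into a closed set \<open>C\<close> and, by compactness,
  membership of that vector in an open set \<open>O \<supseteq> C\<close> forces \<open>\<xi> \<in> G\<close>; the finite-dimensional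
  LDP then compares the two rates. This works because the boxes determine a measure even when the mass of a
  box is only compared with those of strictly larger and strictly smaller boxes.

  Compactness of \<open>{\<xi>(\<Delta>) \<le> K}\<close> is reduced to distribution functions on the line through a
  space-filling curve with a Borel right inverse. Convexity of the finite-dimensional rate functions
  passes to \<open>I\<close>, and separation of convex sets yields the Legendre duality with the limit given
  by Varadhan's lemma.
\<close>

section \<open>Logarithmic rates and the local rate function\<close>

text \<open>The finite-dimensional projections can jump at measures that charge a box edge, so
  neither a projective limit nor a contraction principle applies; defining the rate locally avoids
  both. What links masses to the topology is a function of \<open>Cc_Delta\<close> squeezed between
  two nested boxes. Mass can escape to the diagonal without leaving a vague trace, so the compact
  sets bound the total mass instead of fixing it. Distribution functions are recorded at rational
  points only: in a countable power of [0,1] compactness is immediate and continuity can be tested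
  on sequences, while nothing of the kind is established for the vague topology.
  \<open>Radon_Delta\<close> is not a vector space, which obstructs a direct separation argument for
  the duality. But a vague neighbourhood on which the rate exceeds \<open>c\<close> involves
  finitely many integrals only, so separation takes place in finitely many real coordinates, and the
  multipliers found there are, up to sign, the coefficients of the test function.\<close>

lemma ereal_leI_real:
  fixes x y :: ereal
  assumes "\<And>c. y < ereal c \<Longrightarrow> x \<le> ereal c"
  shows "x \<le> y"
proof (rule dense_ge)
  fix z assume "y < z"
  then show "x \<le> z" using assms by (cases z) auto
qed

definition log_rate :: "real \<Rightarrow> real \<Rightarrow> ereal" where
  "log_rate r p = ereal (1 / r) * lnE p"

text \<open>With \<open>log_rate_ge_iff\<close>, the gateway from rates to exponential bounds on
  real numbers. The value of \<open>lnE\<close> at nonpositive arguments fits because exponentials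
  are positive.\<close>

lemma log_rate_le_iff:
  assumes "r > 0"
  shows "log_rate r p \<le> ereal c \<longleftrightarrow> p \<le> exp (r * c)"
proof (cases "p \<le> 0")
  case True
  then have "p \<le> exp (r * c)" by (meson exp_ge_zero order_trans)
  with True assms show ?thesis by (simp add: log_rate_def lnE_def)
next
  case False
  have "p \<le> exp (r * c) \<longleftrightarrow> ln p \<le> r * c"
    using False by (metis ln_exp ln_le_cancel_iff exp_gt_zero not_le)
  with False assms show ?thesis by (simp add: log_rate_def lnE_def field_simps)
qed

lemma log_rate_ge_iff:
  assumes "r > 0"
  shows "ereal c \<le> log_rate r p \<longleftrightarrow> exp (r * c) \<le> p"
proof (cases "p \<le> 0")
  case True
  then have "\<not> exp (r * c) \<le> p" by (meson exp_gt_zero order_less_le_trans not_le)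
  with True assms show ?thesis by (simp add: log_rate_def lnE_def)
next
  case False
  have "exp (r * c) \<le> p \<longleftrightarrow> r * c \<le> ln p"
    using False by (metis ln_exp ln_le_cancel_iff exp_gt_zero not_le)
  with False assms show ?thesis by (simp add: log_rate_def lnE_def field_simps)
qed

lemma log_rate_less_iff: "r > 0 \<Longrightarrow> log_rate r p < ereal c \<longleftrightarrow> p < exp (r * c)"
  using log_rate_ge_iff[of r c p] by (metis not_le)

lemma log_rate_greater_iff: "r > 0 \<Longrightarrow> ereal c < log_rate r p \<longleftrightarrow> exp (r * c) < p"
  using log_rate_le_iff[of r p c] by (metis not_le)

lemma log_rate_mono: "r > 0 \<Longrightarrow> p \<le> q \<Longrightarrow> log_rate r p \<le> log_rate r q"
  by (rule ereal_leI_real) (metis log_rate_le_iff order_less_imp_le order_trans)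

lemma log_rate_one [simp]: "log_rate r 1 = 0"
  by (simp add: log_rate_def lnE_def)

locale speed =
  fixes a :: "nat \<Rightarrow> real"
  assumes a_pos: "\<And>n. a n > 0" and a_lim: "filterlim a at_top sequentially"
begin

definition upper_rate :: "(nat \<Rightarrow> real) \<Rightarrow> ereal" where
  "upper_rate p = limsup (\<lambda>n. log_rate (a n) (p n))"

definition lower_rate :: "(nat \<Rightarrow> real) \<Rightarrow> ereal" where
  "lower_rate p = liminf (\<lambda>n. log_rate (a n) (p n))"

lemma upper_rate_mono: "(\<And>n. p n \<le> q n) \<Longrightarrow> upper_rate p \<le> upper_rate q"
  unfolding upper_rate_def by (intro Limsup_mono always_eventually allI log_rate_mono a_pos)

lemma lower_rate_mono: "(\<And>n. p n \<le> q n) \<Longrightarrow> lower_rate p \<le> lower_rate q"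
  unfolding lower_rate_def by (intro Liminf_mono always_eventually allI log_rate_mono a_pos)

lemma lower_le_upper_rate: "lower_rate p \<le> upper_rate p"
  unfolding upper_rate_def lower_rate_def by (rule Liminf_le_Limsup) simp

lemma upper_rate_leI:
  "\<forall>\<^sub>F n in sequentially. p n \<le> exp (a n * c) \<Longrightarrow> upper_rate p \<le> ereal c"
  unfolding upper_rate_def by (rule Limsup_bounded) (simp add: log_rate_le_iff a_pos)

lemma upper_rate_lessD:
  "upper_rate p < ereal c \<Longrightarrow> \<forall>\<^sub>F n in sequentially. p n < exp (a n * c)"
  unfolding upper_rate_def by (drule Limsup_lessD) (simp add: log_rate_less_iff a_pos)

lemma lower_rate_geI:
  "\<forall>\<^sub>F n in sequentially. exp (a n * c) \<le> p n \<Longrightarrow> ereal c \<le> lower_rate p"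
  unfolding lower_rate_def by (rule Liminf_bounded) (simp add: log_rate_ge_iff a_pos)

lemma lower_rate_gtD:
  "ereal c < lower_rate p \<Longrightarrow> \<forall>\<^sub>F n in sequentially. exp (a n * c) < p n"
  unfolding lower_rate_def by (drule less_LiminfD) (simp add: log_rate_greater_iff a_pos)

text \<open>Here the divergence of \<open>a\<close> enters: a factor 2 costs ln 2, which is
  eventually below \<open>a n * (d - c)\<close>. Hence a finite sum has the upper rate of its
  largest term.\<close>

lemma eventually_two_exp_le:
  assumes "c < d"
  shows "\<forall>\<^sub>F n in sequentially. exp (a n * c) + exp (a n * c) \<le> exp (a n * d)"
proof -
  have "\<forall>\<^sub>F n in sequentially. ln 2 / (d - c) \<le> a n"
    using a_lim by (simp add: filterlim_at_top)
  then show ?thesis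
  proof eventually_elim
    case (elim n)
    then have "ln 2 + a n * c \<le> a n * d" using assms by (simp add: field_simps)
    then have "exp (ln 2 + a n * c) \<le> exp (a n * d)" by simp
    then show ?case by (simp add: exp_add)
  qed
qed

lemma upper_rate_add:
  "upper_rate (\<lambda>n. p n + q n) \<le> max (upper_rate p) (upper_rate q)"
proof (rule ereal_leI_real)
  fix c assume "max (upper_rate p) (upper_rate q) < ereal c"
  then obtain d where d: "max (upper_rate p) (upper_rate q) < ereal d" "d < c"
    using ereal_dense2 by fastforce
  have "\<forall>\<^sub>F n in sequentially. p n < exp (a n * d)" "\<forall>\<^sub>F n in sequentially. q n < exp (a n * d)"
    using d by (auto intro: upper_rate_lessD)
  then have "\<forall>\<^sub>F n in sequentially. p n + q n \<le> exp (a n * c)"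
    using eventually_two_exp_le[OF d(2)] by eventually_elim linarith
  then show "upper_rate (\<lambda>n. p n + q n) \<le> ereal c" by (rule upper_rate_leI)
qed

text \<open>Asymmetric on purpose: a liminf of \<open>p\<close> suffices if the error
  \<open>q\<close> is controlled by a limsup. This is how a negligible event is dropped from a lower
  bound.\<close>

lemma lower_rate_add:
  "lower_rate (\<lambda>n. p n + q n) \<le> max (lower_rate p) (upper_rate q)"
proof (rule ccontr)
  assume "\<not> ?thesis"
  then have "max (lower_rate p) (upper_rate q) < lower_rate (\<lambda>n. p n + q n)" by (simp only: not_le)
  then obtain c where c: "max (lower_rate p) (upper_rate q) < ereal c"
    "ereal c < lower_rate (\<lambda>n. p n + q n)" using ereal_dense2 by blast
  then obtain d where d: "max (lower_rate p) (upper_rate q) < ereal d" "d < c"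
    using ereal_dense2 by fastforce
  have "\<forall>\<^sub>F n in sequentially. q n < exp (a n * d)"
    using d by (auto intro: upper_rate_lessD)
  \<comment> \<open>The sum exceeds twice \<open>exp (a n * d)\<close>, and \<open>q n\<close>
    accounts for less than one of the two copies.\<close>
  then have "\<forall>\<^sub>F n in sequentially. exp (a n * d) \<le> p n"
    using eventually_two_exp_le[OF d(2)] lower_rate_gtD[OF c(2)] by eventually_elim linarith
  then have "ereal d \<le> lower_rate p" by (rule lower_rate_geI)
  with d show False by auto
qed

lemma upper_rate_zero [simp]: "upper_rate (\<lambda>n. 0) = -\<infinity>"
proof -
  have "log_rate (a n) 0 = -\<infinity>" for n
    using a_pos[of n] by (simp add: log_rate_def lnE_def)
  then show ?thesis by (simp add: upper_rate_def Limsup_const)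
qed

lemma upper_rate_sum_le:
  assumes "finite J" "\<And>j. j \<in> J \<Longrightarrow> upper_rate (p j) \<le> c"
  shows "upper_rate (\<lambda>n. \<Sum>j\<in>J. p j n) \<le> c"
  using assms
proof (induction J rule: finite_induct)
  case (insert j J)
  have "upper_rate (\<lambda>n. p j n + (\<Sum>j\<in>J. p j n)) \<le> max (upper_rate (p j)) (upper_rate (\<lambda>n. \<Sum>j\<in>J. p j n))"
    by (rule upper_rate_add)
  also have "\<dots> \<le> c" using insert by simp
  finally show ?case using insert by simp
qed simp

end

section \<open>Borel sets of a topology, attained infima, and the rates of a random element\<close>

lemma sets_borel_of: "sets (borel_of X) = sigma_sets (topspace X) {U. openin X U}"
  unfolding borel_of_def by (rule sets_measure_of) (auto dest: openin_subset)

lemma space_borel_of [simp]: "space (borel_of X) = topspace X"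
  unfolding borel_of_def by (rule space_measure_of) (auto dest: openin_subset)

lemma openin_borel_of: "openin X U \<Longrightarrow> U \<in> sets (borel_of X)"
  by (simp add: sets_borel_of sigma_sets.Basic)

lemma closedin_borel_of: "closedin X F \<Longrightarrow> F \<in> sets (borel_of X)"
  using sets.compl_sets[OF openin_borel_of[of X "topspace X - F"]]
  by (auto simp: closedin_def double_diff)

lemma borel_measurable_borel_of:
  assumes "continuous_map X euclideanreal L"
  shows "L \<in> borel_measurable (borel_of X)"
proof (rule borel_measurableI)
  fix S :: "real set" assume "open S"
  then have "openin X {x \<in> topspace X. L x \<in> S}"
    using assms by (auto simp: continuous_map_def)
  then show "L -` S \<inter> space (borel_of X) \<in> sets (borel_of X)"
    by (auto dest!: openin_borel_of simp: vimage_def Int_def conj_commute)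
qed

text \<open>The parts of \<open>C\<close> on which \<open>J\<close> is at most 1/(n+1) are closed,
  nonempty, decreasing and contained in a compact sublevel set, so they have a common point.\<close>

lemma good_rate_function_attains_zero:
  assumes J: "good_rate_function X J" and C: "closedin X C" and inf: "(INF x\<in>C. J x) \<le> 0"
  shows "\<exists>x\<in>C. J x = 0"
proof -
  have nonneg: "\<And>x. x \<in> topspace X \<Longrightarrow> 0 \<le> J x" and cl: "\<And>c. closedin X {x \<in> topspace X. J x \<le> ereal c}"
    using J by (auto simp: good_rate_function_def rate_function_def)
  have cpt: "compactin X {x \<in> topspace X. J x \<le> ereal 1}"
    using J by (auto simp: good_rate_function_def)
  define S where "S n = C \<inter> {x \<in> topspace X. J x \<le> ereal (1 / real (Suc n))}" for n
  have S0: "S 0 \<subseteq> {x \<in> topspace X. J x \<le> ereal 1}" by (auto simp: S_def)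
  have ne: "S n \<noteq> {}" for n
  proof -
    have "(INF x\<in>C. J x) < ereal (1 / real (Suc n))"
      by (rule order_le_less_trans[OF inf]) simp
    then show ?thesis unfolding S_def INF_less_iff
      using closedin_subset[OF C] by (auto intro: less_imp_le)
  qed
  have dec: "S n \<subseteq> S m" if "m \<le> n" for m n
  proof -
    have "1 / real (Suc n) \<le> 1 / real (Suc m)" using that by (simp add: field_simps)
    then have le: "ereal (1 / real (Suc n)) \<le> ereal (1 / real (Suc m))" by simp
    show ?thesis unfolding S_def using order_trans[OF _ le] by blast
  qed
  have "{x \<in> topspace X. J x \<le> ereal 1} \<inter> \<Inter>(range S) \<noteq> {}"
    using cpt unfolding compactin_fip
  proof (elim conjE allE[where x="range S"] impE)
    show "(\<forall>C\<in>range S. closedin X C) \<and>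
      (\<forall>\<F>. finite \<F> \<and> \<F> \<subseteq> range S \<longrightarrow> {x \<in> topspace X. J x \<le> ereal 1} \<inter> \<Inter>\<F> \<noteq> {})"
    proof (intro conjI allI impI)
      show "\<forall>C\<in>range S. closedin X C" using cl C by (auto simp: S_def)
      fix \<F> assume "finite \<F> \<and> \<F> \<subseteq> range S"
      then obtain N where N: "finite N" "\<F> = S ` N" by (metis finite_subset_image)
      \<comment> \<open>Inserting 0 keeps \<open>Max\<close> meaningful for an empty subfamily and
        places the set inside the compact sublevel set at height 1.\<close>
      have "S (Max (insert 0 N)) \<subseteq> S j" if "j \<in> insert 0 N" for j
        using that N by (intro dec Max_ge) auto
      then have "S (Max (insert 0 N)) \<subseteq> S 0 \<inter> \<Inter>\<F>"
        unfolding N by blast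
      then show "{x \<in> topspace X. J x \<le> ereal 1} \<inter> \<Inter>\<F> \<noteq> {}"
        using ne[of "Max (insert 0 N)"] S0 by blast
    qed
  qed simp
  then obtain x where x: "\<And>n. x \<in> S n" by auto
  then have xC: "x \<in> C" "x \<in> topspace X" by (auto simp: S_def)
  have "J x \<le> 0"
  proof (rule ereal_leI_real)
    fix c assume "(0::ereal) < ereal c"
    then obtain n where "1 / real (Suc n) < c" by (metis nat_approx_posE ereal_less(2))
    then show "J x \<le> ereal c" using x[of n] by (auto simp: S_def intro: order_trans)
  qed
  with xC nonneg show ?thesis by (auto intro!: bexI[of _ x] antisym)
qed

locale random_process = speed a for a :: "nat \<Rightarrow> real" +
  fixes X :: "'a topology" and M :: "nat \<Rightarrow> 'w measure" and Y :: "nat \<Rightarrow> 'w \<Rightarrow> 'a"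
  assumes prob: "\<And>n. prob_space (M n)"
    and meas: "\<And>n. Y n \<in> M n \<rightarrow>\<^sub>M borel_of X"
begin

definition pr :: "'a set \<Rightarrow> nat \<Rightarrow> real" where
  "pr A n = measure (M n) {\<omega> \<in> space (M n). Y n \<omega> \<in> A}"

lemma finite_M: "finite_measure (M n)"
  by (rule prob_space.finite_measure[OF prob])

lemma Y_in: "\<omega> \<in> space (M n) \<Longrightarrow> Y n \<omega> \<in> topspace X"
  using measurable_space[OF meas] by simp

lemma event_sets: "A \<in> sets (borel_of X) \<Longrightarrow> {\<omega> \<in> space (M n). Y n \<omega> \<in> A} \<in> sets (M n)"
  using measurable_sets[OF meas, of A n] by (simp add: vimage_def Int_def conj_commute)

lemma pr_mono: "B \<in> sets (borel_of X) \<Longrightarrow> A \<inter> topspace X \<subseteq> B \<Longrightarrow> pr A n \<le> pr B n"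
  unfolding pr_def using Y_in
  by (intro finite_measure.finite_measure_mono[OF finite_M] event_sets) auto

lemma pr_Un: "A \<in> sets (borel_of X) \<Longrightarrow> B \<in> sets (borel_of X) \<Longrightarrow> pr (A \<union> B) n \<le> pr A n + pr B n"
proof -
  assume AB: "A \<in> sets (borel_of X)" "B \<in> sets (borel_of X)"
  have "{\<omega> \<in> space (M n). Y n \<omega> \<in> A \<union> B} = {\<omega> \<in> space (M n). Y n \<omega> \<in> A} \<union> {\<omega> \<in> space (M n). Y n \<omega> \<in> B}"
    by auto
  then show ?thesis unfolding pr_def
    using measure_Un_le[OF event_sets[OF AB(1)] event_sets[OF AB(2)]] by simp
qed

lemma pr_UN:
  assumes "finite J" "\<And>j. j \<in> J \<Longrightarrow> A j \<in> sets (borel_of X)"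
  shows "pr (\<Union>j\<in>J. A j) n \<le> (\<Sum>j\<in>J. pr (A j) n)"
  using assms
proof (induction J rule: finite_induct)
  case (insert j J)
  have "pr (A j \<union> (\<Union>j\<in>J. A j)) n \<le> pr (A j) n + pr (\<Union>j\<in>J. A j) n"
    using insert by (intro pr_Un sets.finite_UN) auto
  then show ?case using insert by fastforce
qed (simp add: pr_def)

lemma pr_topspace [simp]: "pr (topspace X) n = 1"
proof -
  have "{\<omega> \<in> space (M n). Y n \<omega> \<in> topspace X} = space (M n)" using Y_in by auto
  then show ?thesis by (simp add: pr_def prob_space.prob_space[OF prob])
qed

lemma LDP_iff: "LDP X M Y a J \<longleftrightarrow> rate_function X J \<and>
   (\<forall>F. closedin X F \<longrightarrow> upper_rate (pr F) \<le> - (INF x\<in>F. J x)) \<and>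
   (\<forall>G. openin X G \<longrightarrow> - (INF x\<in>G. J x) \<le> lower_rate (pr G))"
  by (simp add: LDP_def upper_rate_def lower_rate_def log_rate_def pr_def)

definition local_rate :: "'a \<Rightarrow> ereal" where
  "local_rate x = (SUP G\<in>{G. openin X G \<and> x \<in> G}. - upper_rate (pr G))"

lemma less_local_rateD:
  assumes "c < local_rate x"
  obtains G where "openin X G" "x \<in> G" "upper_rate (pr G) < - c"
  using assms unfolding local_rate_def less_SUP_iff by (auto simp: ereal_less_uminus_reorder)

lemma upper_rate_ge_local_rate:
  "openin X G \<Longrightarrow> x \<in> G \<Longrightarrow> - local_rate x \<le> upper_rate (pr G)"
  unfolding local_rate_def by (subst ereal_uminus_le_reorder, rule SUP_upper) simp

text \<open>Lower semicontinuity is built in: a neighbourhood witnessing that the rate at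
  \<open>x\<close> exceeds \<open>c\<close> witnesses it at each of its points.\<close>

lemma rate_function_local_rate: "rate_function X local_rate"
  unfolding rate_function_def
proof (intro conjI ballI allI)
  fix x assume "x \<in> topspace X"
  then have "- upper_rate (pr (topspace X)) \<le> local_rate x"
    using upper_rate_ge_local_rate[of "topspace X" x] ereal_uminus_le_reorder by blast
  moreover have "upper_rate (pr (topspace X)) = 0"
    by (simp add: upper_rate_def Limsup_const)
  ultimately show "0 \<le> local_rate x" by simp
next
  fix c :: real
  have "openin X (topspace X - {x \<in> topspace X. local_rate x \<le> ereal c})"
  proof (subst openin_subopen, intro ballI)
    fix x assume x: "x \<in> topspace X - {x \<in> topspace X. local_rate x \<le> ereal c}"
    then have "ereal c < local_rate x" by auto
    then obtain G where G: "openin X G" "x \<in> G" "upper_rate (pr G) < - ereal c"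
      by (rule less_local_rateD)
    have "ereal c < local_rate y" if "y \<in> G" for y
      using upper_rate_ge_local_rate[OF G(1) that] G(3)
      by (metis ereal_minus_less_minus order_le_less_trans)
    then have "G \<subseteq> topspace X - {x \<in> topspace X. local_rate x \<le> ereal c}"
      using openin_subset[OF G(1)] by (fastforce simp: not_le)
    then show "\<exists>T. openin X T \<and> x \<in> T \<and> T \<subseteq> topspace X - {x \<in> topspace X. local_rate x \<le> ereal c}"
      using G by blast
  qed
  then show "closedin X {x \<in> topspace X. local_rate x \<le> ereal c}"
    by (auto simp: closedin_def)
qed

text \<open>\<open>tight\<close> yields goodness and reduces closed sets to compact ones, which
  finitely many neighbourhoods of small upper rate cover; \<open>compare\<close> yields the lower
  bound. The term with \<open>m\<close> in \<open>compare\<close> leaves room for a negligible event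
  and is harmless because \<open>m\<close> may be chosen after \<open>x\<close> and
  \<open>G\<close>.\<close>

theorem LDP_local_rate:
  assumes tight: "\<And>m. \<exists>K. compactin X K \<and> closedin X K \<and> upper_rate (pr (topspace X - K)) \<le> ereal (- m)"
    and compare: "\<And>x G m. openin X G \<Longrightarrow> x \<in> G \<Longrightarrow>
      \<exists>G'. openin X G' \<and> x \<in> G' \<and> upper_rate (pr G') \<le> max (lower_rate (pr G)) (ereal (- m))"
  shows "good_rate_function X local_rate" "LDP X M Y a local_rate"
proof -
  show "good_rate_function X local_rate"
    unfolding good_rate_function_def
  proof (intro conjI allI rate_function_local_rate)
    fix c :: real
    obtain K where K: "compactin X K" "closedin X K" "upper_rate (pr (topspace X - K)) \<le> ereal (- (c + 1))"
      using tight by blast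
    have "{x \<in> topspace X. local_rate x \<le> ereal c} \<subseteq> K"
    proof (rule ccontr)
      assume "\<not> ?thesis"
      then obtain x where x: "x \<in> topspace X - K" "local_rate x \<le> ereal c" by auto
      \<comment> \<open>The complement of \<open>K\<close> is itself one of the neighbourhoods of
        \<open>x\<close>.\<close>
      have "- local_rate x \<le> upper_rate (pr (topspace X - K))"
        using x K by (intro upper_rate_ge_local_rate) auto
      also have "\<dots> \<le> ereal (- (c + 1))" by (rule K)
      finally have "ereal (c + 1) \<le> local_rate x"
        by (metis ereal_minus_le_minus uminus_ereal.simps(1))
      also note x(2)
      finally show False by simp
    qed
    then show "compactin X {x \<in> topspace X. local_rate x \<le> ereal c}"
      using rate_function_local_rate K(1) closed_compactin
      unfolding rate_function_def by blast
  qed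
  have upper: "upper_rate (pr F) \<le> - (INF x\<in>F. local_rate x)" if F: "closedin X F" for F
  proof (rule ereal_leI_real)
    fix c assume c: "- (INF x\<in>F. local_rate x) < ereal c"
    obtain K where K: "compactin X K" "closedin X K" "upper_rate (pr (topspace X - K)) \<le> ereal (- (- c))"
      using tight by blast
    have FK: "compactin X (F \<inter> K)" using F K by (simp add: closed_Int_compactin)
    have "\<exists>G. openin X G \<and> x \<in> G \<and> upper_rate (pr G) \<le> ereal c" if "x \<in> F" for x
    proof -
      have "ereal (- c) < (INF x\<in>F. local_rate x)"
        using c by (metis ereal_uminus_less_reorder uminus_ereal.simps(1))
      also have "\<dots> \<le> local_rate x" using that by (rule INF_lower)
      finally obtain G where "openin X G" "x \<in> G" "upper_rate (pr G) < - ereal (- c)"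
        by (rule less_local_rateD)
      then show ?thesis by (auto intro!: exI[of _ G])
    qed
    then obtain G where G: "\<And>x. x \<in> F \<Longrightarrow> openin X (G x) \<and> x \<in> G x \<and> upper_rate (pr (G x)) \<le> ereal c"
      by metis
    have "\<forall>U\<in>G ` (F \<inter> K). openin X U" "F \<inter> K \<subseteq> \<Union>(G ` (F \<inter> K))" using G by auto
    then obtain \<F> where \<F>: "finite \<F>" "\<F> \<subseteq> G ` (F \<inter> K)" "F \<inter> K \<subseteq> \<Union>\<F>"
      using FK unfolding compactin_def by meson
    obtain J where J: "finite J" "J \<subseteq> F \<inter> K" "\<F> = G ` J"
      using \<F> finite_subset_image by metis
    let ?H = "\<Union>x\<in>J. G x"
    have H: "\<And>x. x \<in> J \<Longrightarrow> G x \<in> sets (borel_of X)"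
      using J G openin_borel_of by blast
    have KK: "topspace X - K \<in> sets (borel_of X)" using K by (intro openin_borel_of) auto
    have "pr F n \<le> (\<Sum>x\<in>J. pr (G x) n) + pr (topspace X - K) n" for n
    proof -
      have "pr F n \<le> pr (?H \<union> (topspace X - K)) n"
        using H KK \<F> J by (intro pr_mono sets.Un sets.finite_UN) auto
      also have "\<dots> \<le> pr ?H n + pr (topspace X - K) n" using H KK J by (intro pr_Un sets.finite_UN) auto
      also have "pr ?H n \<le> (\<Sum>x\<in>J. pr (G x) n)" using J H by (intro pr_UN)
      finally show ?thesis by simp
    qed
    then have "upper_rate (pr F) \<le> upper_rate (\<lambda>n. (\<Sum>x\<in>J. pr (G x) n) + pr (topspace X - K) n)"
      by (rule upper_rate_mono)
    also have "\<dots> \<le> max (upper_rate (\<lambda>n. \<Sum>x\<in>J. pr (G x) n)) (upper_rate (pr (topspace X - K)))"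
      by (rule upper_rate_add)
    also have "\<dots> \<le> ereal c"
      using K(3) G J by (intro max.boundedI upper_rate_sum_le) auto
    finally show "upper_rate (pr F) \<le> ereal c" .
  qed
  have lower: "- (INF x\<in>G. local_rate x) \<le> lower_rate (pr G)" if G: "openin X G" for G
  proof -
    have "- local_rate x \<le> lower_rate (pr G)" if x: "x \<in> G" for x
    proof (rule ccontr)
      assume "\<not> - local_rate x \<le> lower_rate (pr G)"
      then obtain c where c: "lower_rate (pr G) < ereal c" "ereal c < - local_rate x"
        using ereal_dense2 by (metis not_le)
      \<comment> \<open>With \<open>m = - c\<close> the spare term becomes \<open>c\<close>, which
        lies strictly below \<open>- local_rate x\<close>.\<close>
      obtain G' where G': "openin X G'" "x \<in> G'"
        "upper_rate (pr G') \<le> max (lower_rate (pr G)) (ereal (- (- c)))"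
        using compare[OF G x] by blast
      have "- local_rate x \<le> max (lower_rate (pr G)) (ereal c)"
        using upper_rate_ge_local_rate[OF G'(1,2)] G'(3) by simp
      with c show False by (auto simp: max_def split: if_splits)
    qed
    then have "- lower_rate (pr G) \<le> (INF x\<in>G. local_rate x)"
      by (intro INF_greatest) (metis ereal_uminus_le_reorder)
    then show ?thesis by (metis ereal_uminus_le_reorder)
  qed
  show "LDP X M Y a local_rate"
    unfolding LDP_iff using rate_function_local_rate upper lower by blast
qed

lemma LDP_exists_zero:
  assumes "good_rate_function X J" "LDP X M Y a J"
  shows "\<exists>x\<in>topspace X. J x = 0"
proof (rule good_rate_function_attains_zero[OF assms(1)])
  have "upper_rate (pr (topspace X)) \<le> - (INF x\<in>topspace X. J x)"
    using assms(2) LDP_iff by blast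
  moreover have "upper_rate (pr (topspace X)) = 0" by (simp add: upper_rate_def Limsup_const)
  ultimately show "(INF x\<in>topspace X. J x) \<le> 0"
    using ereal_uminus_le_reorder[of 0] by (simp add: ereal_uminus_le_reorder)
qed simp

end

section \<open>Varadhan's lemma and convex duality\<close>

lemma lnEnn_eq_lnE: "x \<noteq> \<infinity> \<Longrightarrow> lnEnn x = lnE (enn2real x)"
  using enn2real_eq_0_iff[of x] by (auto simp: lnEnn_def lnE_def order_antisym_conv)

lemma scaled_lnEnn_leD:
  assumes "r > 0" "ereal (1 / r) * lnEnn x \<le> ereal c"
  shows "x \<le> ennreal (exp (r * c))"
proof -
  have fin: "x \<noteq> \<infinity>" using assms by (auto simp: lnEnn_def)
  then have "enn2real x \<le> exp (r * c)"
    using assms log_rate_le_iff[of r "enn2real x" c] by (simp add: lnEnn_eq_lnE log_rate_def)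
  then show ?thesis using fin by (metis ennreal_enn2real ennreal_leI infinity_ennreal_def less_top)
qed

context random_process
begin

text \<open>Varadhan's lemma; the second exponential moment of \<open>L\<close> replaces boundedness.\<close>

theorem Varadhan:
  fixes L :: "'a \<Rightarrow> real"
  assumes LDP: "LDP X M Y a J"
    and L: "continuous_map X euclideanreal L"
    and mom: "\<And>n. (\<integral>\<^sup>+\<omega>. ennreal (exp (a n * (2 * \<bar>L (Y n \<omega>)\<bar>))) \<partial>M n) \<le> ennreal (exp (a n * C))"
  shows "(\<lambda>n. ereal (1 / a n) * lnEnn (\<integral>\<^sup>+\<omega>. ennreal (exp (a n * L (Y n \<omega>))) \<partial>M n))
           \<longlonglongrightarrow> (SUP x\<in>topspace X. ereal (L x) - J x)"
    and "(SUP x\<in>topspace X. ereal (L x) - J x) \<le> ereal C"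
proof -
  define E where "E n = (\<integral>\<^sup>+\<omega>. ennreal (exp (a n * L (Y n \<omega>))) \<partial>M n)" for n
  define e where "e n = enn2real (E n)" for n
  let ?q = "\<lambda>n \<omega>. exp (a n * (2 * \<bar>L (Y n \<omega>)\<bar>))"
  define \<Lambda> where "\<Lambda> = (SUP x\<in>topspace X. ereal (L x) - J x)"
  have nonneg: "\<And>x. x \<in> topspace X \<Longrightarrow> 0 \<le> J x"
    using LDP by (auto simp: LDP_iff rate_function_def)
  have Lm [measurable]: "(\<lambda>\<omega>. L (Y n \<omega>)) \<in> borel_measurable (M n)" for n
    using measurable_compose[OF meas borel_measurable_borel_of[OF L]] .
  have E_le: "E n \<le> ennreal (exp (a n * C))" for n
  proof -
    have "E n \<le> (\<integral>\<^sup>+\<omega>. ennreal (?q n \<omega>) \<partial>M n)"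
      unfolding E_def using a_pos[of n]
      by (intro nn_integral_mono ennreal_leI) (auto intro!: mult_left_mono)
    with mom[of n] show ?thesis by (rule order_trans[rotated])
  qed
  have E_fin: "E n \<noteq> \<infinity>" for n
    using E_le[of n] by (metis ennreal_less_top infinity_ennreal_def leD)
  have E_e: "E n = ennreal (e n)" for n
    unfolding e_def using E_fin[of n] by (metis ennreal_enn2real infinity_ennreal_def less_top)
  have rate: "ereal (1 / a n) * lnEnn (E n) = log_rate (a n) (e n)" for n
    using E_fin[of n] by (simp add: log_rate_def lnEnn_eq_lnE e_def)
  have lower: "\<Lambda> \<le> lower_rate e"
    unfolding \<Lambda>_def
  proof (rule SUP_least, rule ereal_leI_real)
    fix x c assume x: "x \<in> topspace X" and c: "lower_rate e < ereal c"
    show "ereal (L x) - J x \<le> ereal c"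
    proof (cases "J x")
      case (real j)
      have "L x - \<epsilon> - j < c" if "\<epsilon> > 0" for \<epsilon>
      proof (rule ccontr)
        assume "\<not> L x - \<epsilon> - j < c"
        then have ge: "c \<le> L x - \<epsilon> - j" by simp
        \<comment> \<open>Half of the loss \<open>\<epsilon>\<close> is spent on the integrand, at
          least \<open>exp (a n * (L x - \<epsilon>/2))\<close> on \<open>G\<close>, the other half
          on the probability of \<open>G\<close>.\<close>
        define G where "G = {y \<in> topspace X. L y \<in> {L x - \<epsilon>/2<..}}"
        have G: "openin X G" using openin_continuous_map_preimage[OF L, of "{L x - \<epsilon>/2<..}"] unfolding G_def by simp
        have "- (INF y\<in>G. J y) \<le> lower_rate (pr G)" using LDP G LDP_iff by blast
        moreover have "(INF y\<in>G. J y) \<le> ereal j"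
          using x that by (intro INF_lower2[of x]) (auto simp: G_def real)
        ultimately have "ereal (- j) \<le> lower_rate (pr G)"
          by (metis (no_types) ereal_minus_le_minus order_trans uminus_ereal.simps(1))
        then have "ereal (- j - \<epsilon>/2) < lower_rate (pr G)"
          using that by (metis ereal_less_eq(3) less_ereal.simps(1) order_less_le_trans half_gt_zero diff_less_eq less_add_same_cancel1)
        then have "\<forall>\<^sub>F n in sequentially. exp (a n * (- j - \<epsilon>/2)) < pr G n" by (rule lower_rate_gtD)
        then have "\<forall>\<^sub>F n in sequentially. exp (a n * (L x - \<epsilon> - j)) \<le> e n"
        proof eventually_elim
          case (elim n)
          have "ennreal (exp (a n * (L x - \<epsilon>/2))) * emeasure (M n) {\<omega> \<in> space (M n). Y n \<omega> \<in> G} =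
            (\<integral>\<^sup>+\<omega>. ennreal (exp (a n * (L x - \<epsilon>/2))) * indicator {\<omega> \<in> space (M n). Y n \<omega> \<in> G} \<omega> \<partial>M n)"
            by (rule nn_integral_cmult_indicator[symmetric]) (intro event_sets openin_borel_of G)
          also have "\<dots> \<le> E n"
            unfolding E_def using a_pos[of n]
            by (intro nn_integral_mono) (auto simp: G_def indicator_def intro!: ennreal_leI mult_left_mono)
          finally have "exp (a n * (L x - \<epsilon>/2)) * pr G n \<le> e n"
            unfolding E_e pr_def finite_measure.emeasure_eq_measure[OF finite_M]
            by (subst (asm) ennreal_mult[symmetric]) (auto simp: e_def)
          moreover have "exp (a n * (L x - \<epsilon>/2)) * exp (a n * (- j - \<epsilon>/2)) \<le> exp (a n * (L x - \<epsilon>/2)) * pr G n"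
            using elim by (intro mult_left_mono) auto
          moreover have "exp (a n * (L x - \<epsilon>/2)) * exp (a n * (- j - \<epsilon>/2)) = exp (a n * (L x - \<epsilon> - j))"
            by (simp add: exp_add[symmetric] algebra_simps)
          ultimately show ?case by linarith
        qed
        then have "ereal (L x - \<epsilon> - j) \<le> lower_rate e" by (rule lower_rate_geI)
        with c ge show False by (metis ereal_less_eq(3) leD order_trans)
      qed
      \<comment> \<open>If this value of \<open>\<epsilon>\<close> is positive, the bound reads
        \<open>c < c\<close>; otherwise the goal already holds.\<close>
      from this[of "L x - j - c"] show ?thesis by (cases "c < L x - j") (auto simp: real)
    next
      case PInf then show ?thesis by simp
    next
      case MInf then show ?thesis using nonneg[OF x] by simp
    qed
  qed
  have upper: "upper_rate e \<le> \<Lambda>"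
  proof (rule ereal_leI_real)
    fix c assume c: "\<Lambda> < ereal c"
    then obtain d where d: "\<Lambda> < ereal d" "d < c" using ereal_dense2 by fastforce
    \<comment> \<open>\<open>L\<close> will be cut into slices of this width: rounding it up to the
      end of its slice uses exactly the gap between \<open>d\<close> and \<open>c\<close>.\<close>
    define \<epsilon> where "\<epsilon> = c - d"
    have \<epsilon>: "\<epsilon> > 0" using d by (simp add: \<epsilon>_def)
    \<comment> \<open>Where |L| exceeds \<open>R\<close>, L is at most 2|L| - R, so by the moment
      bound that region contributes at most \<open>exp (a n * (C - R))\<close>, which is at most
      \<open>exp (a n * c)\<close>.\<close>
    define R where "R = \<bar>C\<bar> + \<bar>c\<bar>"
    define F where "F j = {x \<in> topspace X. L x \<in> {of_int j * \<epsilon> .. (of_int j + 1) * \<epsilon>}}" for j :: int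
    let ?B = "\<lambda>n j. {\<omega> \<in> space (M n). Y n \<omega> \<in> F j}" and ?c = "\<lambda>n j. exp (a n * ((of_int j + 1) * \<epsilon>))"
    define J0 where "J0 = {\<lfloor>- R / \<epsilon>\<rfloor> .. \<lfloor>R / \<epsilon>\<rfloor>}"
    have F: "closedin X (F j)" for j
      unfolding F_def using closedin_continuous_map_preimage[OF L, of "{of_int j * \<epsilon> .. (of_int j + 1) * \<epsilon>}"] by simp
    let ?T = "\<lambda>n. \<Sum>j\<in>J0. ?c n j * pr (F j) n"
    have bound: "e n \<le> ?T n + exp (a n * c)" for n
    proof -
      have pt: "exp (a n * L (Y n \<omega>)) \<le> (\<Sum>j\<in>J0. ?c n j * indicator (?B n j) \<omega>)
           + exp (- (a n * R)) * ?q n \<omega>" if \<omega>: "\<omega> \<in> space (M n)" for \<omega>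
      proof (cases "\<bar>L (Y n \<omega>)\<bar> \<le> R")
        case True
        define j where "j = \<lfloor>L (Y n \<omega>) / \<epsilon>\<rfloor>"
        have "- R / \<epsilon> \<le> L (Y n \<omega>) / \<epsilon>" "L (Y n \<omega>) / \<epsilon> \<le> R / \<epsilon>"
          using True \<epsilon> by (auto intro!: divide_right_mono simp: abs_le_iff simp del: divide_minus_left)
        then have j: "j \<in> J0" by (auto simp: j_def J0_def intro!: floor_mono)
        have Lj: "of_int j * \<epsilon> \<le> L (Y n \<omega>)" "L (Y n \<omega>) \<le> (of_int j + 1) * \<epsilon>"
          using of_int_floor_le[of "L (Y n \<omega>) / \<epsilon>"] real_of_int_floor_add_one_ge[of "L (Y n \<omega>) / \<epsilon>"]
          unfolding j_def pos_le_divide_eq[OF \<epsilon>] pos_divide_le_eq[OF \<epsilon>] by auto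
        have "exp (a n * L (Y n \<omega>)) \<le> ?c n j * indicator (?B n j) \<omega>"
          using Lj \<omega> Y_in[OF \<omega>] a_pos[of n] by (auto simp: F_def indicator_def)
        also have "\<dots> \<le> (\<Sum>j\<in>J0. ?c n j * indicator (?B n j) \<omega>)"
          using j by (intro member_le_sum) (auto simp: J0_def)
        finally show ?thesis by (simp add: add_increasing2)
      next
        case False
        have "a n * L (Y n \<omega>) \<le> a n * (2 * \<bar>L (Y n \<omega>)\<bar> - R)"
          using False a_pos[of n] by (intro mult_left_mono) auto
        then have "exp (a n * L (Y n \<omega>)) \<le> exp (- (a n * R)) * ?q n \<omega>"
          by (simp add: exp_add[symmetric] algebra_simps)
        then show ?thesis by (intro add_increasing sum_nonneg) auto
      qed
      have "E n \<le> (\<integral>\<^sup>+\<omega>. (\<Sum>j\<in>J0. ennreal (?c n j) * indicator (?B n j) \<omega>)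
           + ennreal (exp (- (a n * R))) * ennreal (?q n \<omega>) \<partial>M n)"
        unfolding E_def
      proof (rule nn_integral_mono)
        fix \<omega> assume \<omega>: "\<omega> \<in> space (M n)"
        show "ennreal (exp (a n * L (Y n \<omega>))) \<le> (\<Sum>j\<in>J0. ennreal (?c n j) * indicator (?B n j) \<omega>)
           + ennreal (exp (- (a n * R))) * ennreal (?q n \<omega>)"
          using ennreal_leI[OF pt[OF \<omega>]]
          by (simp add: ennreal_plus sum_nonneg ennreal_mult sum_ennreal[symmetric] ennreal_indicator)
      qed
      also have "\<dots> = (\<Sum>j\<in>J0. ennreal (?c n j) * emeasure (M n) (?B n j))
           + ennreal (exp (- (a n * R))) * (\<integral>\<^sup>+\<omega>. ennreal (?q n \<omega>) \<partial>M n)"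
        using event_sets[OF closedin_borel_of[OF F]]
        by (subst nn_integral_add) (auto simp: nn_integral_sum nn_integral_cmult nn_integral_cmult_indicator)
      also have "\<dots> \<le> (\<Sum>j\<in>J0. ennreal (?c n j) * emeasure (M n) (?B n j))
           + ennreal (exp (- (a n * R))) * ennreal (exp (a n * C))"
        by (intro add_left_mono mult_left_mono mom) simp
      also have "\<dots> = ennreal (?T n + exp (- (a n * R)) * exp (a n * C))"
        unfolding pr_def finite_measure.emeasure_eq_measure[OF finite_M]
        by (simp add: ennreal_plus sum_nonneg ennreal_mult sum_ennreal[symmetric])
      finally have "e n \<le> ?T n + exp (- (a n * R)) * exp (a n * C)"
        unfolding E_e by (subst (asm) ennreal_le_iff) (auto intro!: add_nonneg_nonneg sum_nonneg simp: pr_def)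
      moreover have "a n * (C - R) \<le> a n * c" using a_pos[of n] by (intro mult_left_mono) (auto simp: R_def)
      then have "exp (- (a n * R)) * exp (a n * C) \<le> exp (a n * c)"
        by (simp add: exp_add[symmetric] algebra_simps)
      ultimately show ?thesis by linarith
    qed
    \<comment> \<open>On slice \<open>j\<close> the rate function is at least
      \<open>j * \<epsilon> - d\<close>, so the weighted term has rate at most
      \<open>(j + 1) * \<epsilon> + d - j * \<epsilon> = c\<close>.\<close>
    have slice: "upper_rate (\<lambda>n. ?c n j * pr (F j) n) \<le> ereal c" for j
    proof -
      have "\<And>x. x \<in> F j \<Longrightarrow> ereal (of_int j * \<epsilon> - d) \<le> J x"
      proof -
        fix x assume x: "x \<in> F j"
        then have xX: "x \<in> topspace X" and Lx: "of_int j * \<epsilon> \<le> L x" by (auto simp: F_def)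
        have "ereal (L x) - J x \<le> \<Lambda>" unfolding \<Lambda>_def using xX by (rule SUP_upper)
        with d have "ereal (L x) - J x < ereal d" by simp
        then show "ereal (of_int j * \<epsilon> - d) \<le> J x"
          using Lx nonneg[OF xX] by (cases "J x") auto
      qed
      then have "ereal (of_int j * \<epsilon> - d) \<le> (INF x\<in>F j. J x)" by (rule INF_greatest)
      then have "- (INF x\<in>F j. J x) \<le> ereal (d - of_int j * \<epsilon>)"
        by (subst ereal_uminus_le_reorder) simp
      moreover have "upper_rate (pr (F j)) \<le> - (INF x\<in>F j. J x)" using LDP F LDP_iff by blast
      ultimately have up: "upper_rate (pr (F j)) \<le> ereal (d - of_int j * \<epsilon>)" by (rule order_trans[rotated])
      show ?thesis
      proof (rule ereal_leI_real)
        fix b assume "ereal c < ereal b"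
        then have "upper_rate (pr (F j)) < ereal (d - of_int j * \<epsilon> + (b - c))"
          by (intro order_le_less_trans[OF up]) simp
        then have "\<forall>\<^sub>F n in sequentially. pr (F j) n < exp (a n * (d - of_int j * \<epsilon> + (b - c)))"
          by (rule upper_rate_lessD)
        then have "\<forall>\<^sub>F n in sequentially. ?c n j * pr (F j) n \<le> exp (a n * b)"
        proof eventually_elim
          case (elim n)
          then have "?c n j * pr (F j) n \<le> ?c n j * exp (a n * (d - of_int j * \<epsilon> + (b - c)))"
            by (intro mult_left_mono) auto
          also have "\<dots> = exp (a n * b)"
            unfolding exp_add[symmetric] by (rule arg_cong[where f=exp]) (simp add: \<epsilon>_def algebra_simps)
          finally show ?case .
        qed
        then show "upper_rate (\<lambda>n. ?c n j * pr (F j) n) \<le> ereal b"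
          by (rule upper_rate_leI)
      qed
    qed
    have "upper_rate e \<le> upper_rate (\<lambda>n. ?T n + exp (a n * c))" by (rule upper_rate_mono[OF bound])
    also have "\<dots> \<le> max (upper_rate ?T) (upper_rate (\<lambda>n. exp (a n * c)))" by (rule upper_rate_add)
    also have "\<dots> \<le> ereal c"
      using upper_rate_leI[of "\<lambda>n. exp (a n * c)" c]
      by (intro max.boundedI upper_rate_sum_le slice) (auto simp: J0_def)
    finally show "upper_rate e \<le> ereal c" .
  qed
  have "lower_rate e = \<Lambda>" "upper_rate e = \<Lambda>"
    using lower upper lower_le_upper_rate[of e] by auto
  then have lim: "(\<lambda>n. log_rate (a n) (e n)) \<longlonglongrightarrow> \<Lambda>"
    unfolding lower_rate_def upper_rate_def by (intro Liminf_eq_Limsup) auto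
  show "(\<lambda>n. ereal (1 / a n) * lnEnn (\<integral>\<^sup>+\<omega>. ennreal (exp (a n * L (Y n \<omega>))) \<partial>M n)) \<longlonglongrightarrow> \<Lambda>"
    using lim by (simp add: rate[unfolded E_def])
  have "e n \<le> exp (a n * C)" for n using E_le[of n] unfolding E_e by simp
  then have "upper_rate e \<le> ereal C" by (intro upper_rate_leI) simp
  with lower lower_le_upper_rate[of e] show "\<Lambda> \<le> ereal C" by (meson order_trans)
qed

end

text \<open>Lagrange multipliers are introduced one constraint at a time, so that only separation of
  convex sets in the plane is needed.\<close>

lemma convex_multiplier_one:
  fixes J L :: "'v \<Rightarrow> real"
  assumes conv: "\<And>x y u. x \<in> S \<Longrightarrow> y \<in> S \<Longrightarrow> 0 \<le> u \<Longrightarrow> u \<le> 1 \<Longrightarrow>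
      \<exists>z\<in>S. L z = u * L x + (1 - u) * L y \<and> J z \<le> u * J x + (1 - u) * J y"
    and d: "d > 0" and near: "\<And>x. x \<in> S \<Longrightarrow> \<bar>L x\<bar> < d \<Longrightarrow> c \<le> J x"
    and bdd: "\<exists>b. \<forall>x\<in>S. b \<le> J x"
  shows "\<exists>\<theta>. \<forall>x\<in>S. c \<le> J x + \<theta> * L x"
proof -
  \<comment> \<open>\<open>A\<close> is the image of the epigraph of \<open>J\<close> under
    \<open>L\<close>; \<open>near\<close> keeps it disjoint from the box \<open>B\<close> below
    height \<open>c\<close>.\<close>
  define A where "A = {(l, r). \<exists>x\<in>S. L x = l \<and> J x \<le> r}"
  define B where "B = {- d<..<d} \<times> {..<c}"
  show ?thesis
  proof (cases "S = {}")
    case False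
    have "convex A"
      unfolding convex_alt
    proof (intro ballI allI impI)
      fix p q :: "real \<times> real" and u :: real assume pq: "p \<in> A" "q \<in> A" and u: "0 \<le> u \<and> u \<le> 1"
      obtain x where x: "x \<in> S" "L x = fst p" "J x \<le> snd p" using pq by (auto simp: A_def)
      obtain y where y: "y \<in> S" "L y = fst q" "J y \<le> snd q" using pq by (auto simp: A_def)
      obtain z where z: "z \<in> S" "L z = (1 - u) * L x + (1 - (1 - u)) * L y" "J z \<le> (1 - u) * J x + (1 - (1 - u)) * J y"
        using conv[OF x(1) y(1), of "1 - u"] u by auto
      have "J z \<le> (1 - u) * snd p + u * snd q"
        using z(3) mult_left_mono[OF x(3), of "1 - u"] mult_left_mono[OF y(3), of u] u by simp
      then show "(1 - u) *\<^sub>R p + u *\<^sub>R q \<in> A"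
        unfolding A_def using z x y by (auto simp: split_beta intro!: bexI[of _ z])
    qed
    moreover have "convex B" unfolding B_def by (intro convex_Times) auto
    moreover have "A \<inter> B = {}" unfolding A_def B_def using near by fastforce
    moreover have "A \<noteq> {}" using False by (auto simp: A_def)
    moreover have "(0, c - 1) \<in> B" using d by (simp add: B_def)
    then have "B \<noteq> {}" by blast
    ultimately obtain w \<beta> where w: "w \<noteq> 0" "\<forall>x\<in>A. inner w x \<le> \<beta>" "\<forall>x\<in>B. \<beta> \<le> inner w x"
      using separating_hyperplane_sets[of A B] by blast
    obtain p \<tau> where w_eq: "w = (p, \<tau>)" by (cases w)
    have Aub: "p * L x + \<tau> * J x \<le> \<beta>" if "x \<in> S" for x
      using w(2) that by (auto simp: A_def w_eq)
    have Blb: "\<beta> \<le> p * l + \<tau> * r" if "\<bar>l\<bar> < d" "r < c" for l r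
      using w(3) that by (force simp: B_def w_eq abs_less_iff)
    \<comment> \<open>Limit of \<open>Blb\<close> as \<open>r\<close> increases to \<open>c\<close>;
      the shift \<open>e\<close> changes the linear form by at most half of the supposed defect
      \<open>D\<close>.\<close>
    have Bcl: "\<beta> \<le> p * l + \<tau> * c" if "\<bar>l\<bar> < d" for l
    proof (rule ccontr)
      assume n: "\<not> ?thesis"
      define D where "D = \<beta> - (p * l + \<tau> * c)"
      define e where "e = D / (2 * (\<bar>\<tau>\<bar> + 1))"
      have D: "D > 0" using n by (simp add: D_def)
      have e: "e > 0" unfolding e_def using D by (intro divide_pos_pos) auto
      have "(\<bar>\<tau>\<bar> + 1) * e = D / 2" unfolding e_def by (simp add: field_simps)
      moreover have "- \<tau> * e \<le> (\<bar>\<tau>\<bar> + 1) * e" using e by (intro mult_right_mono) auto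
      moreover have "\<beta> \<le> p * l + \<tau> * (c - e)" using that e by (intro Blb) auto
      moreover have "\<tau> * (c - e) = \<tau> * c - \<tau> * e" by (simp add: algebra_simps)
      ultimately have "D \<le> D / 2" unfolding D_def by (simp add: algebra_simps)
      then show False using D by simp
    qed
    have \<tau>: "\<tau> \<le> 0"
    proof (rule ccontr)
      assume t: "\<not> \<tau> \<le> 0"
      define r where "r = min (c - 1) ((\<beta> - 1) / \<tau>)"
      have "\<tau> * r \<le> \<beta> - 1" using t by (auto simp: r_def min_def field_simps)
      moreover have "\<beta> \<le> p * 0 + \<tau> * r" using d by (intro Blb) (auto simp: r_def)
      ultimately show False by simp
    qed
    show ?thesis
    proof (cases "\<tau> = 0")
      case False
      then have t: "\<tau> < 0" using \<tau> by simp
      show ?thesis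
      proof (intro exI ballI)
        fix x assume x: "x \<in> S"
        have "p * L x + \<tau> * J x \<le> \<tau> * c" using Aub[OF x] Bcl[of 0] d by simp
        then show "c \<le> J x + (p / \<tau>) * L x" using t by (simp add: field_simps)
      qed
    next
      \<comment> \<open>The separating line is vertical. Then \<open>p * L x\<close> stays below a
        fixed negative number on \<open>S\<close>, and a large multiple of its negative lifts the
        lower bound \<open>b\<close> of \<open>J\<close> to at least \<open>c\<close>.\<close>
      case True
      then have p: "p \<noteq> 0" using w(1) w_eq by (simp add: prod_eq_iff)
      have "\<beta> \<le> p * (- sgn p * (d / 2)) + \<tau> * c" using d p by (intro Bcl) (auto simp: abs_mult sgn_real_def)
      then have \<beta>: "\<beta> \<le> - (\<bar>p\<bar> * (d / 2))" using True by (simp add: abs_sgn mult_ac)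
      obtain b where b: "\<forall>x\<in>S. b \<le> J x" using bdd by blast
      define N where "N = \<bar>c - b\<bar> / (\<bar>p\<bar> * (d / 2))"
      have pd: "\<bar>p\<bar> * (d / 2) > 0" using p d by simp
      have N: "N * (\<bar>p\<bar> * (d / 2)) = \<bar>c - b\<bar>" "0 \<le> N" using pd p d by (auto simp: N_def)
      show ?thesis
      proof (intro exI ballI)
        fix x assume x: "x \<in> S"
        have "p * L x \<le> - (\<bar>p\<bar> * (d / 2))" using Aub[OF x] True \<beta> by simp
        then have "N * (\<bar>p\<bar> * (d / 2)) \<le> N * (- (p * L x))" using N by (intro mult_left_mono) auto
        then show "c \<le> J x + (- N * p) * L x" using N b x by (auto simp: mult_ac)
      qed
    qed
  qed simp
qed

text \<open>The last constraint is treated on the slab where the others nearly hold, and its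
  multiplier is absorbed into \<open>J\<close>. \<open>bdd\<close> is required for every
  \<open>\<theta>\<close> because it has to survive this change of \<open>J\<close> in the
  induction.\<close>

lemma convex_multipliers:
  fixes J :: "'v \<Rightarrow> real" and L :: "nat \<Rightarrow> 'v \<Rightarrow> real"
  assumes conv: "\<And>x y u. x \<in> S \<Longrightarrow> y \<in> S \<Longrightarrow> 0 \<le> u \<Longrightarrow> u \<le> 1 \<Longrightarrow>
      \<exists>z\<in>S. (\<forall>i<k. L i z = u * L i x + (1 - u) * L i y) \<and> J z \<le> u * J x + (1 - u) * J y"
    and d: "d > 0" and near: "\<And>x. x \<in> S \<Longrightarrow> (\<forall>i<k. \<bar>L i x\<bar> < d) \<Longrightarrow> c \<le> J x"
    and bdd: "\<And>\<theta>. \<exists>b. \<forall>x\<in>S. b \<le> J x + (\<Sum>i<k. \<theta> i * L i x)"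
  shows "\<exists>\<theta>. \<forall>x\<in>S. c \<le> J x + (\<Sum>i<k. \<theta> i * L i x)"
  using conv near bdd
proof (induction k arbitrary: J)
  case 0
  then show ?case by simp
next
  case (Suc k)
  define S' where "S' = {x \<in> S. \<forall>i<k. \<bar>L i x\<bar> < d}"
  have "\<exists>\<theta>. \<forall>x\<in>S'. c \<le> J x + \<theta> * L k x"
  proof (rule convex_multiplier_one[OF _ d])
    fix x y and u :: real assume xy: "x \<in> S'" "y \<in> S'" and u: "0 \<le> u" "u \<le> 1"
    then obtain z where z: "z \<in> S" "\<forall>i<Suc k. L i z = u * L i x + (1 - u) * L i y" "J z \<le> u * J x + (1 - u) * J y"
      using Suc.prems(1)[of x y u] by (auto simp: S'_def)
    have "\<bar>L i z\<bar> < d" if "i < k" for i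
    proof -
      have "L i x \<in> {- d<..<d}" "L i y \<in> {- d<..<d}" using xy that by (auto simp: S'_def abs_less_iff)
      then have "u *\<^sub>R L i x + (1 - u) *\<^sub>R L i y \<in> {- d<..<d}"
        using u by (intro convexD) auto
      then show ?thesis using z(2) that by (auto simp: abs_less_iff)
    qed
    with z show "\<exists>z\<in>S'. L k z = u * L k x + (1 - u) * L k y \<and> J z \<le> u * J x + (1 - u) * J y"
      by (intro bexI[of _ z]) (auto simp: S'_def)
  next
    fix x assume "x \<in> S'" "\<bar>L k x\<bar> < d"
    then show "c \<le> J x" by (intro Suc.prems(2)) (auto simp: S'_def less_Suc_eq)
  next
    show "\<exists>b. \<forall>x\<in>S'. b \<le> J x" using Suc.prems(3)[of "\<lambda>_. 0"] by (auto simp: S'_def)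
  qed
  then obtain \<theta>k where \<theta>k: "\<And>x. x \<in> S' \<Longrightarrow> c \<le> J x + \<theta>k * L k x" by blast
  have "\<exists>\<theta>. \<forall>x\<in>S. c \<le> (J x + \<theta>k * L k x) + (\<Sum>i<k. \<theta> i * L i x)"
  proof (rule Suc.IH)
    fix x y and u :: real assume xy: "x \<in> S" "y \<in> S" and u: "0 \<le> u" "u \<le> 1"
    then obtain z where z: "z \<in> S" "\<forall>i<Suc k. L i z = u * L i x + (1 - u) * L i y" "J z \<le> u * J x + (1 - u) * J y"
      using Suc.prems(1)[of x y u] by auto
    have "\<theta>k * L k z = \<theta>k * (u * L k x + (1 - u) * L k y)" using z(2) by simp
    then have "J z + \<theta>k * L k z \<le> u * (J x + \<theta>k * L k x) + (1 - u) * (J y + \<theta>k * L k y)"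
      using z(3) by (simp add: algebra_simps)
    with z show "\<exists>z\<in>S. (\<forall>i<k. L i z = u * L i x + (1 - u) * L i y) \<and>
       J z + \<theta>k * L k z \<le> u * (J x + \<theta>k * L k x) + (1 - u) * (J y + \<theta>k * L k y)"
      by (intro bexI[of _ z]) auto
  next
    fix x assume "x \<in> S" "\<forall>i<k. \<bar>L i x\<bar> < d"
    then show "c \<le> J x + \<theta>k * L k x" by (intro \<theta>k) (simp add: S'_def)
  next
    fix \<theta> :: "nat \<Rightarrow> real"
    obtain b where b: "\<forall>x\<in>S. b \<le> J x + (\<Sum>i<Suc k. (\<theta>(k := \<theta>k)) i * L i x)" using Suc.prems(3) by blast
    have "(\<Sum>i<Suc k. (\<theta>(k := \<theta>k)) i * L i x) = (\<Sum>i<k. \<theta> i * L i x) + \<theta>k * L k x" for x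
      by (simp add: sum.lessThan_Suc)
    then show "\<exists>b. \<forall>x\<in>S. b \<le> (J x + \<theta>k * L k x) + (\<Sum>i<k. \<theta> i * L i x)"
      using b by (intro exI[of _ b]) (auto simp: algebra_simps)
  qed
  then obtain \<theta> where \<theta>: "\<forall>x\<in>S. c \<le> (J x + \<theta>k * L k x) + (\<Sum>i<k. \<theta> i * L i x)" by blast
  have "(\<Sum>i<Suc k. (\<theta>(k := \<theta>k)) i * L i x) = (\<Sum>i<k. \<theta> i * L i x) + \<theta>k * L k x" for x
    by (simp add: sum.lessThan_Suc)
  then show ?case using \<theta> by (intro exI[of _ "\<theta>(k := \<theta>k)"]) (auto simp: algebra_simps)
qed

section \<open>Radon measures and boxes\<close>

text \<open>An increasing homeomorphism of [-1,1] onto the extended reals with inverse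
  \<open>to_unit\<close>, extended by constants. It supplies real coordinates in which affine
  cutoffs also make sense at infinite endpoints.\<close>

definition of_unit :: "real \<Rightarrow> ereal" where
  "of_unit x = (if x \<le> -1 then -\<infinity> else if 1 \<le> x then \<infinity> else ereal (x / (1 - \<bar>x\<bar>)))"

definition to_unit :: "ereal \<Rightarrow> real" where
  "to_unit u = (case u of ereal r \<Rightarrow> r / (1 + \<bar>r\<bar>) | PInfty \<Rightarrow> 1 | MInfty \<Rightarrow> -1)"

lemma abs_real_ratio_less_one: "\<bar>r / (1 + \<bar>r\<bar>)\<bar> < 1" for r :: real
  by (simp add: abs_divide field_simps)

lemma to_unit_bounds: "-1 \<le> to_unit u" "to_unit u \<le> 1"
proof -
  have "\<bar>to_unit u\<bar> \<le> 1"
    using abs_real_ratio_less_one by (cases u) (auto simp: to_unit_def less_imp_le simp del: abs_divide)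
  then show "-1 \<le> to_unit u" "to_unit u \<le> 1" by (auto simp: abs_le_iff)
qed

lemma of_unit_inverse: "of_unit (to_unit u) = u"
proof (cases u)
  case (real r)
  have *: "\<bar>r / (1 + \<bar>r\<bar>)\<bar> < 1" by (rule abs_real_ratio_less_one)
  have "\<bar>r / (1 + \<bar>r\<bar>)\<bar> = \<bar>r\<bar> / (1 + \<bar>r\<bar>)" by (simp add: abs_divide)
  then have "1 - \<bar>r / (1 + \<bar>r\<bar>)\<bar> = 1 / (1 + \<bar>r\<bar>)" by (simp add: field_simps)
  then have "r / (1 + \<bar>r\<bar>) / (1 - \<bar>r / (1 + \<bar>r\<bar>)\<bar>) = r" by simp
  then show ?thesis using * unfolding abs_less_iff by (simp add: real to_unit_def of_unit_def)
qed (simp_all add: to_unit_def of_unit_def)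

lemma to_unit_inverse:
  assumes "-1 \<le> x" "x \<le> 1"
  shows "to_unit (of_unit x) = x"
proof (cases "\<bar>x\<bar> < 1")
  case True
  have "\<bar>x / (1 - \<bar>x\<bar>)\<bar> = \<bar>x\<bar> / (1 - \<bar>x\<bar>)" using True by (simp add: abs_divide)
  then have "1 + \<bar>x / (1 - \<bar>x\<bar>)\<bar> = 1 / (1 - \<bar>x\<bar>)" using True by (simp add: field_simps)
  then have "x / (1 - \<bar>x\<bar>) / (1 + \<bar>x / (1 - \<bar>x\<bar>)\<bar>) = x" using True by simp
  then show ?thesis using True by (auto simp: to_unit_def of_unit_def)
next
  case False
  then show ?thesis using assms by (auto simp: to_unit_def of_unit_def)
qed

lemma to_unit_less: "u < v \<Longrightarrow> to_unit u < to_unit v"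
proof -
  have frac: "r / (1 + \<bar>r\<bar>) < s / (1 + \<bar>s\<bar>)" if "r < s" for r s :: real
  proof -
    have "r * (1 + \<bar>s\<bar>) < s * (1 + \<bar>r\<bar>)"
    proof (cases "0 \<le> r \<or> s \<le> 0")
      case True with that show ?thesis by (auto simp: algebra_simps abs_if)
    next
      case False
      then have "r * (1 + \<bar>s\<bar>) < 0" "0 < s * (1 + \<bar>r\<bar>)" by (auto intro!: mult_neg_pos mult_pos_pos)
      then show ?thesis by linarith
    qed
    then show ?thesis by (simp add: divide_less_eq less_divide_eq mult_ac add_pos_nonneg)
  qed
  have bd: "-1 < r / (1 + \<bar>r\<bar>)" "r / (1 + \<bar>r\<bar>) < 1" for r :: real
    using abs_real_ratio_less_one[of r] by (auto simp: abs_less_iff simp del: abs_divide)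
  show "u < v \<Longrightarrow> to_unit u < to_unit v"
    using frac bd by (cases u; cases v) (auto simp: to_unit_def)
qed

lemma to_unit_less_iff [simp]: "to_unit u < to_unit v \<longleftrightarrow> u < v"
  using to_unit_less by (metis less_asym' linorder_less_linear)

lemma to_unit_le_iff [simp]: "to_unit u \<le> to_unit v \<longleftrightarrow> u \<le> v"
  using to_unit_less_iff by (metis not_le)

lemma to_unit_0 [simp]: "to_unit 0 = 0"
  by (simp add: to_unit_def zero_ereal_def)

lemma of_unit_0 [simp]: "of_unit 0 = 0"
  by (simp add: of_unit_def zero_ereal_def)

lemma of_unit_le_iff:
  assumes "-1 \<le> x" "x \<le> 1" "-1 \<le> y" "y \<le> 1"
  shows "of_unit x \<le> of_unit y \<longleftrightarrow> x \<le> y"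
  using to_unit_le_iff[of "of_unit x" "of_unit y"] assms by (simp add: to_unit_inverse)

lemma of_unit_image: "of_unit ` {-1..1} = UNIV"
proof -
  have "u \<in> of_unit ` {-1..1}" for u
    using to_unit_bounds by (intro image_eqI[of _ _ "to_unit u"]) (auto simp: of_unit_inverse)
  then show ?thesis by auto
qed

lemma continuous_on_of_unit: "continuous_on {-1..1} of_unit"
  by (rule continuous_onI_mono) (auto simp: of_unit_image of_unit_le_iff)

text \<open>\<open>to_unit\<close> inverts a continuous bijection defined on a compact
  interval.\<close>

lemma continuous_on_to_unit: "continuous_on S to_unit"
proof -
  have "continuous_on (of_unit ` {-1..1}) to_unit"
    by (rule continuous_on_inv[OF continuous_on_of_unit]) (auto simp: to_unit_inverse)
  then show ?thesis unfolding of_unit_image by (rule continuous_on_subset) simp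
qed

lemma continuous_on_to_unit' [continuous_intros]:
  "continuous_on S f \<Longrightarrow> continuous_on S (\<lambda>x. to_unit (f x))"
  by (rule continuous_on_compose2[OF continuous_on_to_unit[of UNIV]]) auto

lemma borel_measurable_to_unit [measurable]: "to_unit \<in> borel_measurable borel"
  by (intro borel_measurable_continuous_onI continuous_on_to_unit)

lemma compact_if_closed_ereal_prod:
  fixes S :: "(ereal \<times> ereal) set"
  assumes "closed S" shows "compact S"
proof -
  have "compact (UNIV \<times> UNIV :: (ereal \<times> ereal) set)"
    by (intro compact_Times compact_UNIV)
  from closed_Int_compact[OF assms this] show ?thesis by simp
qed

lemma Delta_sets [measurable]: "Delta \<in> sets borel"
proof -
  have "Delta = {x. 0 \<le> fst x} \<inter> {x. fst x < snd x}" by (auto simp: Delta_def)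
  also have "\<dots> \<in> sets borel"
    by (intro sets.Int borel_closed borel_open closed_Collect_le open_Collect_less continuous_intros)
  finally show ?thesis .
qed

section \<open>Integration of compactly supported functions against Radon measures\<close>

lemma Radon_sets: "\<xi> \<in> Radon_Delta \<Longrightarrow> sets \<xi> = sets (restrict_space borel Delta)"
  by (simp add: Radon_Delta_def)

lemma Radon_space: "\<xi> \<in> Radon_Delta \<Longrightarrow> space \<xi> = Delta"
  using sets_eq_imp_space_eq[OF Radon_sets] by (simp add: space_restrict_space)

lemma Radon_sets_iff: "\<xi> \<in> Radon_Delta \<Longrightarrow> A \<in> sets \<xi> \<longleftrightarrow> A \<subseteq> Delta \<and> A \<in> sets borel"
  by (simp add: Radon_sets sets_restrict_space_iff)

lemma Radon_measurable:
  assumes "\<xi> \<in> Radon_Delta" "f \<in> borel_measurable (restrict_space borel Delta)"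
  shows "f \<in> borel_measurable \<xi>"
  using assms(2) measurable_cong_sets[OF Radon_sets[OF assms(1)] refl] by blast

lemma Radon_emeasure_compact:
  assumes "\<xi> \<in> Radon_Delta" "compact K" "K \<subseteq> Delta"
  shows "emeasure \<xi> K < \<infinity>" "K \<in> sets \<xi>"
  using assms borel_compact[OF assms(2)] by (auto simp: Radon_Delta_def sets_restrict_space_iff)

lemma Cc_borel_measurable: "f \<in> Cc_Delta \<Longrightarrow> f \<in> borel_measurable (restrict_space borel Delta)"
  by (auto simp: Cc_Delta_def intro: borel_measurable_continuous_on_restrict)

lemma Cc_bounded:
  assumes "f \<in> Cc_Delta"
  obtains b K where "0 \<le> b" "compact K" "K \<subseteq> Delta" "\<And>x. x \<in> Delta \<Longrightarrow> \<bar>f x\<bar> \<le> b * indicator K x"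
proof -
  obtain K where K: "compact K" "K \<subseteq> Delta" "\<And>x. x \<in> Delta - K \<Longrightarrow> f x = 0" "continuous_on Delta f"
    using assms by (auto simp: Cc_Delta_def)
  have "compact (f ` K)" using K by (intro compact_continuous_image continuous_on_subset[OF K(4)])
  then have "bounded (f ` K)" by (rule compact_imp_bounded)
  then obtain b where b: "b > 0" "\<And>x. x \<in> K \<Longrightarrow> \<bar>f x\<bar> \<le> b" by (auto simp: bounded_pos)
  have "\<bar>f x\<bar> \<le> b * indicator K x" if "x \<in> Delta" for x
    using b K(3)[of x] that by (cases "x \<in> K") auto
  with b K that[of b K] show ?thesis by simp
qed

lemma Radon_integrable_bounded:
  fixes f :: "ereal \<times> ereal \<Rightarrow> real"
  assumes xi: "\<xi> \<in> Radon_Delta" and f: "f \<in> borel_measurable (restrict_space borel Delta)"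
    and K: "compact K" "K \<subseteq> Delta" "\<And>x. x \<in> Delta \<Longrightarrow> \<bar>f x\<bar> \<le> b * indicator K x"
  shows "integrable \<xi> f"
proof (rule Bochner_Integration.integrable_bound)
  show "integrable \<xi> (\<lambda>x. b * indicator K x :: real)"
    using Radon_emeasure_compact[OF xi K(1,2)] by (intro integrable_mult_right) (simp add: integrable_indicator_iff)
  show "AE x in \<xi>. norm (f x) \<le> norm (b * indicator K x)"
    using order_trans[OF K(3) abs_ge_self] Radon_space[OF xi] by (intro AE_I2) simp
qed (rule Radon_measurable[OF xi f])

lemma Cc_integrable: "\<xi> \<in> Radon_Delta \<Longrightarrow> f \<in> Cc_Delta \<Longrightarrow> integrable \<xi> f"
  by (metis Cc_bounded Cc_borel_measurable Radon_integrable_bounded)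

definition clamp01 :: "real \<Rightarrow> real" where "clamp01 x = max 0 (min 1 x)"

lemma clamp01_bounds [simp]: "0 \<le> clamp01 x" "clamp01 x \<le> 1"
  by (auto simp: clamp01_def)

lemma clamp01_eqs: "x \<le> 0 \<Longrightarrow> clamp01 x = 0" "1 \<le> x \<Longrightarrow> clamp01 x = 1"
  by (auto simp: clamp01_def)

lemma continuous_on_clamp01 [continuous_intros]:
  "continuous_on S f \<Longrightarrow> continuous_on S (\<lambda>x. clamp01 (f x))"
  unfolding clamp01_def by (intro continuous_intros)

text \<open>Including the edge at height \<open>t\<close> makes the box compact, so Radon measures
  are finite on it, and makes it a decreasing limit of larger sets \<open>box_set\<close>.\<close>

definition closed_box :: "real \<Rightarrow> real \<Rightarrow> (ereal \<times> ereal) set" where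
  "closed_box s t = {0..ereal s} \<times> {ereal t..}"

lemma closed_box_subset: "s < t \<Longrightarrow> closed_box s t \<subseteq> Delta"
proof -
  assume st: "s < t"
  have "0 \<le> u \<and> u < v" if "u \<in> {0..ereal s}" "v \<in> {ereal t..}" for u v
  proof -
    have "u \<le> ereal s" "ereal s < ereal t" "ereal t \<le> v" "0 \<le> u" using that st by auto
    then have "0 \<le> u" "u < v" by (blast intro: order_le_less_trans order_less_le_trans)+
    then show ?thesis by simp
  qed
  then show ?thesis by (auto simp: closed_box_def Delta_def)
qed

lemma compact_closed_box: "compact (closed_box s t)"
  by (intro compact_if_closed_ereal_prod) (auto simp: closed_box_def closed_Times)

lemma box_set_eq: "box_set s t = {0..ereal s} \<times> {ereal t<..}"
  by (auto simp: box_set_def)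

lemma box_set_subset: "box_set s t \<subseteq> closed_box s t"
  by (auto simp: box_set_def closed_box_def less_imp_le)

lemma closed_box_sets [measurable]: "closed_box s t \<in> sets borel"
  using compact_closed_box by (rule borel_compact)

lemma box_set_sets [measurable]: "box_set s t \<in> sets borel"
  unfolding box_set_eq borel_prod[symmetric] by auto

lemma closed_box_subset_box: "s < s' \<Longrightarrow> t' < t \<Longrightarrow> closed_box s t \<subseteq> box_set s' t'"
proof -
  assume "s < s'" "t' < t"
  then have "ereal s \<le> ereal s'" "ereal t' < ereal t" by auto
  then show ?thesis unfolding closed_box_def box_set_eq
    by (intro Sigma_mono subsetI) (auto simp del: ereal_less_eq less_ereal.simps intro: order_trans order_less_le_trans)
qed

lemma Radon_box:
  assumes "\<xi> \<in> Radon_Delta" "s < t"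
  shows "box_set s t \<in> sets \<xi>" "closed_box s t \<in> sets \<xi>"
    "emeasure \<xi> (closed_box s t) < \<infinity>" "emeasure \<xi> (box_set s t) < \<infinity>"
proof -
  show 1: "box_set s t \<in> sets \<xi>" "closed_box s t \<in> sets \<xi>"
    using closed_box_subset[OF assms(2)] box_set_subset[of s t] by (auto simp: Radon_sets_iff[OF assms(1)])
  show 2: "emeasure \<xi> (closed_box s t) < \<infinity>"
    by (intro Radon_emeasure_compact assms compact_closed_box closed_box_subset)
  show "emeasure \<xi> (box_set s t) < \<infinity>"
    using emeasure_mono[OF box_set_subset 1(2)] 2 by (rule order_le_less_trans)
qed

lemma Cc_Delta_I:
  assumes "continuous_on Delta f" "closed S" "S \<subseteq> Delta" "\<And>x. x \<in> Delta \<Longrightarrow> x \<notin> S \<Longrightarrow> f x = 0"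
  shows "f \<in> Cc_Delta"
  using assms compact_if_closed_ereal_prod[OF assms(2)] by (auto simp: Cc_Delta_def)

text \<open>The function is a product of two cutoffs, each affine in a \<open>to_unit\<close>
  coordinate between the edges of the two boxes.\<close>

lemma Cc_between_boxes:
  assumes "s < s'" "s' < t'" "t' < t"
  obtains f where "f \<in> Cc_Delta"
    "\<And>x. x \<in> Delta \<Longrightarrow> indicator (closed_box s t) x \<le> f x"
    "\<And>x. x \<in> Delta \<Longrightarrow> f x \<le> indicator (box_set s' t') x"
    "\<And>x. 0 \<le> f x"
proof
  let ?g = to_unit
  define f where "f x = clamp01 ((?g (ereal s') - ?g (fst x)) / (?g (ereal s') - ?g (ereal s))) *
      clamp01 ((?g (snd x) - ?g (ereal t')) / (?g (ereal t) - ?g (ereal t')))" for x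
  have pos: "?g (ereal s') - ?g (ereal s) > 0" "?g (ereal t) - ?g (ereal t') > 0" using assms by auto
  have zero: "f x = 0" if "x \<in> Delta" "x \<notin> box_set s' t'" for x
  proof -
    have "ereal s' \<le> fst x \<or> snd x \<le> ereal t'" using that by (cases x) (auto simp: box_set_def Delta_def)
    then show ?thesis
    proof
      assume "ereal s' \<le> fst x"
      then have "?g (ereal s') - ?g (fst x) \<le> 0" by simp
      then show ?thesis using pos by (simp add: f_def clamp01_eqs divide_nonpos_pos)
    next
      assume "snd x \<le> ereal t'"
      then have "?g (snd x) - ?g (ereal t') \<le> 0" by simp
      then show ?thesis using pos by (simp add: f_def clamp01_eqs divide_nonpos_pos)
    qed
  qed
  show "f \<in> Cc_Delta"
  proof (rule Cc_Delta_I[of _ "closed_box s' t'"])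
    show "continuous_on Delta f" unfolding f_def using less_imp_neq[OF pos(1)] less_imp_neq[OF pos(2)] by (intro continuous_intros) auto
    show "f x = 0" if "x \<in> Delta" "x \<notin> closed_box s' t'" for x
      using zero that box_set_subset by blast
  qed (use assms in \<open>auto intro!: closed_box_subset compact_imp_closed compact_closed_box\<close>)
  show nn: "0 \<le> f x" for x by (simp add: f_def)
  show "f x \<le> indicator (box_set s' t') x" if "x \<in> Delta" for x
    using zero[OF that] by (auto simp: f_def indicator_def mult_le_one)
  show "indicator (closed_box s t) x \<le> f x" if "x \<in> Delta" for x
  proof (cases "x \<in> closed_box s t")
    case True
    then have le: "fst x \<le> ereal s" "ereal t \<le> snd x" by (auto simp: closed_box_def)
    then have "?g (fst x) \<le> ?g (ereal s)" "?g (ereal t) \<le> ?g (snd x)" by simp_all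
    then have "1 \<le> (?g (ereal s') - ?g (fst x)) / (?g (ereal s') - ?g (ereal s))"
      "1 \<le> (?g (snd x) - ?g (ereal t')) / (?g (ereal t) - ?g (ereal t'))"
      using pos by (simp_all add: le_divide_eq)
    then show ?thesis using True by (simp add: f_def clamp01_eqs)
  qed (simp add: nn)
qed

lemma Radon_integral_between:
  assumes xi: "\<xi> \<in> Radon_Delta" and f: "f \<in> Cc_Delta"
    and A: "A \<in> sets \<xi>" "emeasure \<xi> A < \<infinity>" and B: "B \<in> sets \<xi>" "emeasure \<xi> B < \<infinity>"
    and le: "\<And>x. x \<in> Delta \<Longrightarrow> indicator A x \<le> f x" "\<And>x. x \<in> Delta \<Longrightarrow> f x \<le> indicator B x"
  shows "measure \<xi> A \<le> (\<integral>x. f x \<partial>\<xi>)" "(\<integral>x. f x \<partial>\<xi>) \<le> measure \<xi> B"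
proof -
  have AB: "A \<inter> Delta = A" "B \<inter> Delta = B"
    using A B sets.sets_into_space Radon_space[OF xi] by blast+
  have "measure \<xi> A = (\<integral>x. indicator A x \<partial>\<xi>)" using A by simp
  also have "\<dots> \<le> (\<integral>x. f x \<partial>\<xi>)"
    using A le(1) Radon_space[OF xi] by (intro integral_mono[OF _ Cc_integrable[OF xi f]]) (auto simp: integrable_indicator_iff AB)
  finally show "measure \<xi> A \<le> (\<integral>x. f x \<partial>\<xi>)" .
  have "(\<integral>x. f x \<partial>\<xi>) \<le> (\<integral>x. indicator B x \<partial>\<xi>)"
    using B le(2) Radon_space[OF xi] by (intro integral_mono[OF Cc_integrable[OF xi f]]) (auto simp: integrable_indicator_iff AB)
  also have "\<dots> = measure \<xi> B" using B by simp
  finally show "(\<integral>x. f x \<partial>\<xi>) \<le> measure \<xi> B" .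
qed

abbreviation box_mass :: "(ereal \<times> ereal) measure \<Rightarrow> real \<times> real \<Rightarrow> real" where
  "box_mass \<xi> p \<equiv> measure \<xi> (box_set (fst p) (snd p))"

text \<open>\<open>nested p q\<close>: the closed box at \<open>p\<close> lies in the relative interior of the box at \<open>q\<close>.\<close>

definition nested :: "real \<times> real \<Rightarrow> real \<times> real \<Rightarrow> bool" where
  "nested p q \<longleftrightarrow> 0 \<le> fst p \<and> fst p < fst q \<and> fst q < snd q \<and> snd q < snd p"

lemma nested_between:
  assumes "nested p q"
  obtains r where "nested p r" "nested r q"
proof
  let ?r = "((fst p + fst q) / 2, (snd p + snd q) / 2)"
  show "nested p ?r" "nested ?r q" using assms by (auto simp: nested_def)
qed

lemma Cc_between_nested:
  assumes "nested p q"
  obtains f where "f \<in> Cc_Delta"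
    "\<And>\<xi>. \<xi> \<in> Radon_Delta \<Longrightarrow> box_mass \<xi> p \<le> (\<integral>x. f x \<partial>\<xi>)"
    "\<And>\<xi>. \<xi> \<in> Radon_Delta \<Longrightarrow> (\<integral>x. f x \<partial>\<xi>) \<le> box_mass \<xi> q"
proof -
  obtain f where f: "f \<in> Cc_Delta"
    "\<And>x. x \<in> Delta \<Longrightarrow> indicator (closed_box (fst p) (snd p)) x \<le> f x"
    "\<And>x. x \<in> Delta \<Longrightarrow> f x \<le> indicator (box_set (fst q) (snd q)) x" "\<And>x. 0 \<le> f x"
    using assms Cc_between_boxes[of "fst p" "fst q" "snd q" "snd p"] unfolding nested_def by metis
  have lt: "fst p < snd p" "fst q < snd q" using assms by (auto simp: nested_def)
  have ind: "indicator (box_set (fst p) (snd p)) x \<le> f x" if "x \<in> Delta" for x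
    using f(2)[OF that] f(4)[of x] box_set_subset[of "fst p" "snd p"] by (auto simp: indicator_def split: if_splits)
  show ?thesis
    using Radon_integral_between[OF _ f(1) Radon_box(1,4)[OF _ lt(1)] Radon_box(1,4)[OF _ lt(2)] ind f(3)]
    by (intro that[OF f(1)]) auto
qed

text \<open>The closed box is the decreasing limit of the boxes with corner
  \<open>(s + e n, t - e n)\<close>. Each of these leaves room for an intermediate box to which
  \<open>le\<close> applies, and continuity from above of \<open>\<nu>\<close> finishes.\<close>

lemma closed_box_mass_le:
  assumes mu: "\<mu> \<in> Radon_Delta" and nu: "\<nu> \<in> Radon_Delta"
    and le: "\<And>p q. nested p q \<Longrightarrow> box_mass \<mu> p \<le> box_mass \<nu> q" and st: "0 \<le> s" "s < t"
  shows "emeasure \<mu> (closed_box s t) \<le> emeasure \<nu> (closed_box s t)"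
proof -
  \<comment> \<open>The divisor \<open>n + 2\<close> bounds \<open>e n\<close> by a quarter of
    \<open>t - s\<close>, which keeps the enlarged corner off the diagonal.\<close>
  define e where "e n = (t - s) / 2 / real (n + 2)" for n
  have e: "0 < e n" "s + e n < t - e n" for n
  proof -
    show pos: "0 < e n" using st by (simp add: e_def)
    have "e n \<le> (t - s) / 2 / 2" unfolding e_def using st by (intro divide_left_mono) auto
    then show "s + e n < t - e n" using st by (simp add: field_simps)
  qed
  have dec: "e (Suc n) \<le> e n" for n
    unfolding e_def using st by (intro divide_left_mono) auto
  let ?B = "\<lambda>n. box_set (s + e n) (t - e n)"
  have bound: "emeasure \<mu> (closed_box s t) \<le> emeasure \<nu> (?B n)" for n
  proof -
    \<comment> \<open>The halfway box contains the closed one and is nested in the box at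
      \<open>(s + e n, t - e n)\<close>.\<close>
    let ?p = "(s + e n / 2, t - e n / 2)"
    have ins: "nested ?p (s + e n, t - e n)" using e[of n] st by (auto simp: nested_def)
    have p: "fst ?p < snd ?p" using e[of n] by simp
    have "emeasure \<mu> (closed_box s t) \<le> emeasure \<mu> (box_set (fst ?p) (snd ?p))"
      using e[of n] by (intro emeasure_mono closed_box_subset_box Radon_box mu p) auto
    also have "\<dots> = ennreal (box_mass \<mu> ?p)"
      using Radon_box(4)[OF mu p] by (intro emeasure_eq_ennreal_measure) auto
    also have "\<dots> \<le> ennreal (box_mass \<nu> (s + e n, t - e n))" by (intro ennreal_leI le ins)
    also have "\<dots> = emeasure \<nu> (?B n)"
      using Radon_box(4)[OF nu e(2)[of n]] by (simp add: emeasure_eq_ennreal_measure)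
    finally show ?thesis .
  qed
  have "(\<lambda>n. emeasure \<nu> (?B n)) \<longlonglongrightarrow> emeasure \<nu> (\<Inter>n. ?B n)"
  proof (rule Lim_emeasure_decseq)
    show "range ?B \<subseteq> sets \<nu>" using Radon_box[OF nu e(2)] by auto
    show "decseq ?B"
    proof (rule decseq_SucI)
      fix n show "?B (Suc n) \<subseteq> ?B n"
        using dec[of n] unfolding box_set_eq
        by (intro Sigma_mono) (auto elim!: order_trans order_le_less_trans[rotated])
    qed
    show "emeasure \<nu> (?B n) \<noteq> \<infinity>" for n using Radon_box(4)[OF nu e(2)[of n]] by simp
  qed
  moreover have "(\<Inter>n. ?B n) = closed_box s t"
  proof
    show "closed_box s t \<subseteq> (\<Inter>n. ?B n)" using e by (intro INT_greatest closed_box_subset_box) auto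
    show "(\<Inter>n. ?B n) \<subseteq> closed_box s t"
    proof
      fix x assume x: "x \<in> (\<Inter>n. ?B n)"
      then have *: "0 \<le> fst x" "\<And>n. fst x \<le> ereal (s + e n)" "\<And>n. ereal (t - e n) \<le> snd x"
        by (auto simp: box_set_eq mem_Times_iff less_imp_le)
      have e0: "e \<longlonglongrightarrow> 0" unfolding e_def by (rule LIMSEQ_ignore_initial_segment[OF lim_const_over_n])
      have "(\<lambda>n. ereal (s + e n)) \<longlonglongrightarrow> ereal (s + 0)" "(\<lambda>n. ereal (t - e n)) \<longlonglongrightarrow> ereal (t - 0)"
        using e0 by (intro tendsto_intros; simp)+
      then have "fst x \<le> ereal (s + 0)" "ereal (t - 0) \<le> snd x"
        using * by (auto intro: LIMSEQ_le_const LIMSEQ_le_const2)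
      with * show "x \<in> closed_box s t" by (simp add: closed_box_def mem_Times_iff)
    qed
  qed
  ultimately show ?thesis using bound by (auto intro: LIMSEQ_le_const)
qed

lemma rationals_between_ereal:
  assumes uv: "u < v"
  obtains s t where "(s, t) \<in> \<rat> \<times> \<rat>" "s < t" "u \<le> ereal s" "ereal t \<le> v"
proof -
  obtain z where z: "u < ereal z" "ereal z < v" using ereal_dense2[OF uv] by blast
  obtain y where y: "u < ereal y" "ereal y < ereal z" using ereal_dense2[OF z(1)] by blast
  obtain w where w: "ereal z < ereal w" "ereal w < v" using ereal_dense2[OF z(2)] by blast
  obtain s where s: "s \<in> \<rat>" "y < s" "s < z" using Rats_dense_in_real y(2) by auto
  obtain t where t: "t \<in> \<rat>" "z < t" "t < w" using Rats_dense_in_real w(1) by auto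
  have "ereal y \<le> ereal s" "ereal t \<le> ereal w" using s t by auto
  then have "u \<le> ereal s" "ereal t \<le> v"
    using order_trans[OF less_imp_le[OF y(1)]] order_trans[OF _ less_imp_le[OF w(2)]] by blast+
  with s t show ?thesis by (intro that[of s t]) auto
qed

text \<open>The substance is that both coordinates are measurable for the generated sigma-algebra:
  the part of \<open>Delta\<close> left of, or above, a level is a countable union of closed boxes
  with rational corners.\<close>

lemma sets_Delta_eq_sigma_closed_boxes:
  "sets (restrict_space borel Delta) = sigma_sets Delta {closed_box s t | s t. 0 \<le> s \<and> s < t}"
  (is "_ = sigma_sets Delta ?E")
proof
  have E: "?E \<subseteq> Pow Delta" using closed_box_subset by auto
  show "sigma_sets Delta ?E \<subseteq> sets (restrict_space borel Delta)"
    using closed_box_subset by (intro sigma_sets_le_sets_iff[THEN iffD2] sets.sigma_sets_subset') (auto simp: sets_restrict_space_iff)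
  let ?S = "sigma Delta ?E"
  have sS: "sets ?S = sigma_sets Delta ?E" "space ?S = Delta" using E by (auto simp: sets_measure_of space_measure_of)
  have basic: "closed_box s t \<in> sets ?S" if "0 \<le> s" "s < t" for s t
    unfolding sS using that by (intro sigma_sets.Basic) auto
  have union: "(\<Union>(s, t)\<in>{(s, t) \<in> \<rat> \<times> \<rat>. 0 \<le> s \<and> s < t \<and> Q s t}. closed_box s t) \<in> sets ?S" for Q
  proof (intro sets.countable_UN'')
    have "countable (\<rat> \<times> \<rat> :: (real \<times> real) set)" by (intro countable_SIGMA countable_rat)
    then show "countable {(s, t) \<in> \<rat> \<times> \<rat>. 0 \<le> s \<and> s < t \<and> Q s t}" by (rule countable_subset[rotated]) auto
  qed (auto intro: basic)
  have fst_meas: "fst \<in> borel_measurable ?S"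
    unfolding borel_measurable_ereal_iff_Iio
  proof
    fix c :: ereal
    have "fst -` {..<c} \<inter> Delta =
      (\<Union>(s, t)\<in>{(s, t) \<in> \<rat> \<times> \<rat>. 0 \<le> s \<and> s < t \<and> ereal t \<le> c}. closed_box s t)" (is "?L = ?R")
    proof
      have "closed_box s t \<subseteq> ?L" if "s < t" "ereal t \<le> c" for s t
      proof -
        have "ereal s < c" using that by (meson less_ereal.simps(1) order_less_le_trans)
        then have "u < c" if "u \<le> ereal s" for u using that by (rule order_le_less_trans[rotated])
        with closed_box_subset[OF that(1)] show ?thesis by (auto simp: closed_box_def)
      qed
      then show "?R \<subseteq> ?L" by blast
      show "?L \<subseteq> ?R"
      proof
        fix x assume "x \<in> ?L"
        then obtain u v where x: "x = (u, v)" and uv: "0 \<le> u" "u < min c v" by (cases x) (auto simp: Delta_def)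
        obtain s t where st: "(s, t) \<in> \<rat> \<times> \<rat>" "s < t" "u \<le> ereal s" "ereal t \<le> min c v"
          using rationals_between_ereal[OF uv(2)] by blast
        have "0 \<le> s" using uv(1) st(3) by (metis ereal_less_eq(5) order_trans)
        with st uv(1) show "x \<in> ?R" by (intro UN_I[of "(s, t)"]) (auto simp: x closed_box_def)
      qed
    qed
    with union show "fst -` {..<c} \<inter> space ?S \<in> sets ?S" unfolding sS(2) by simp
  qed
  have snd_meas: "snd \<in> borel_measurable ?S"
    unfolding borel_measurable_ereal_iff_Ioi
  proof
    fix c :: ereal
    have "snd -` {c<..} \<inter> Delta =
      (\<Union>(s, t)\<in>{(s, t) \<in> \<rat> \<times> \<rat>. 0 \<le> s \<and> s < t \<and> c \<le> ereal s}. closed_box s t)" (is "?L = ?R")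
    proof
      have "closed_box s t \<subseteq> ?L" if "s < t" "c \<le> ereal s" for s t
      proof -
        have "c < ereal t" using that by (meson less_ereal.simps(1) order_le_less_trans)
        then have "c < v" if "ereal t \<le> v" for v using that by (rule order_less_le_trans)
        with closed_box_subset[OF that(1)] show ?thesis by (auto simp: closed_box_def)
      qed
      then show "?R \<subseteq> ?L" by blast
      show "?L \<subseteq> ?R"
      proof
        fix x assume "x \<in> ?L"
        then obtain u v where x: "x = (u, v)" and uv: "0 \<le> u" "max c u < v" by (cases x) (auto simp: Delta_def)
        obtain s t where st: "(s, t) \<in> \<rat> \<times> \<rat>" "s < t" "max c u \<le> ereal s" "ereal t \<le> v"
          using rationals_between_ereal[OF uv(2)] by blast
        have "u \<le> ereal s" using st(3) by simp
        moreover have "0 \<le> s" using uv(1) calculation by (metis ereal_less_eq(5) order_trans)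
        ultimately show "x \<in> ?R" using st uv(1) by (intro UN_I[of "(s, t)"]) (auto simp: x closed_box_def)
      qed
    qed
    with union show "snd -` {c<..} \<inter> space ?S \<in> sets ?S" unfolding sS(2) by simp
  qed
  have id_meas: "(\<lambda>x. x) \<in> measurable ?S borel"
    using borel_measurable_Pair[OF fst_meas snd_meas] by simp
  show "sets (restrict_space borel Delta) \<subseteq> sigma_sets Delta ?E"
  proof
    fix A assume A: "A \<in> sets (restrict_space borel Delta)"
    then have "A \<subseteq> Delta" "A \<in> sets borel" by (auto simp: sets_restrict_space_iff)
    then have "A = (\<lambda>x. x) -` A \<inter> space ?S" by (auto simp: sS)
    with measurable_sets[OF id_meas \<open>A \<in> sets borel\<close>] show "A \<in> sigma_sets Delta ?E" by (simp add: sS)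
  qed
qed

text \<open>By \<open>closed_box_mass_le\<close> the two comparisons force equality on all closed
  boxes. These are stable under intersection and generate the sigma-algebra, and those with rational
  corners cover \<open>Delta\<close> by countably many sets of finite mass.\<close>

lemma Radon_eqI:
  assumes mu: "\<mu> \<in> Radon_Delta" and nu: "\<nu> \<in> Radon_Delta"
    and le: "\<And>p q. nested p q \<Longrightarrow> box_mass \<mu> p \<le> box_mass \<nu> q"
    and ge: "\<And>p q. nested p q \<Longrightarrow> box_mass \<nu> p \<le> box_mass \<mu> q"
  shows "\<mu> = \<nu>"
proof -
  let ?E = "{closed_box s t | s t. 0 \<le> s \<and> s < t}"
  define A where "A = {closed_box s t | s t. s \<in> \<rat> \<and> t \<in> \<rat> \<and> 0 \<le> s \<and> s < t}"
  show ?thesis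
  proof (rule measure_eqI_generator_eq_countable[of ?E Delta _ _ A])
    show "Int_stable ?E"
    proof (rule Int_stableI)
      fix a b assume "a \<in> ?E" "b \<in> ?E"
      then obtain s t s' t' where st: "a = closed_box s t" "b = closed_box s' t'" "0 \<le> s" "s < t" "0 \<le> s'" "s' < t'" by auto
      have "{0..ereal s} \<inter> {0..ereal s'} = {0..ereal (min s s')}" by simp
      moreover have "{ereal t..} \<inter> {ereal t'..} = {ereal (max t t')..}" by (simp add: set_eq_iff)
      ultimately have "a \<inter> b = closed_box (min s s') (max t t')"
        by (simp only: st closed_box_def Times_Int_Times)
      moreover have "0 \<le> min s s'" "min s s' < max t t'" using st(3-6) by linarith+
      ultimately show "a \<inter> b \<in> ?E" by blast
    qed
    show "?E \<subseteq> Pow Delta" using closed_box_subset by auto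
    show "emeasure \<mu> X = emeasure \<nu> X" if X: "X \<in> ?E" for X
      using X closed_box_mass_le[OF mu nu le] closed_box_mass_le[OF nu mu ge] by (auto intro!: antisym)
    show "sets \<mu> = sigma_sets Delta ?E" "sets \<nu> = sigma_sets Delta ?E"
      using Radon_sets[OF mu] Radon_sets[OF nu] sets_Delta_eq_sigma_closed_boxes by auto
    show "A \<subseteq> ?E" by (auto simp: A_def)
    have "A = (\<lambda>(s, t). closed_box s t) ` {(s, t). s \<in> \<rat> \<and> t \<in> \<rat> \<and> 0 \<le> s \<and> s < t}" by (auto simp: A_def)
    moreover have "countable (\<rat> \<times> \<rat> :: (real \<times> real) set)" by (intro countable_SIGMA countable_rat)
    then have "countable {(s, t). s \<in> \<rat> \<and> t \<in> \<rat> \<and> 0 \<le> s \<and> s < (t::real)}" by (rule countable_subset[rotated]) auto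
    ultimately show "countable A" by auto
    show "\<Union>A = Delta"
    proof
      show "\<Union>A \<subseteq> Delta" using closed_box_subset by (auto simp: A_def)
      show "Delta \<subseteq> \<Union>A"
      proof
        fix x assume "x \<in> Delta"
        then obtain u v where x: "x = (u, v)" "0 \<le> u" "u < v" by (cases x) (auto simp: Delta_def)
        obtain s t where st: "(s, t) \<in> \<rat> \<times> \<rat>" "s < t" "u \<le> ereal s" "ereal t \<le> v"
          using rationals_between_ereal[OF x(3)] by blast
        have "0 \<le> s" using x(2) st(3) by (metis ereal_less_eq(5) order_trans)
        then have "x \<in> closed_box s t" "closed_box s t \<in> A"
          unfolding A_def using x(1,2) st by (simp add: closed_box_def, blast)
        then show "x \<in> \<Union>A" by blast
      qed
    qed
    show "emeasure \<mu> a \<noteq> \<infinity>" if "a \<in> A" for a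
      using that Radon_box(3)[OF mu] by (force simp: A_def)
  qed
qed

section \<open>The vague topology\<close>

lemma Cc_zero: "(\<lambda>x. 0) \<in> Cc_Delta"
  by (rule Cc_Delta_I[of _ "{}"]) auto

lemma topspace_vague [simp]: "topspace vague_topology = Radon_Delta"
  unfolding vague_topology_def topology_generated_by_topspace
  using Cc_zero by (auto intro!: exI[of _ "\<lambda>x. 0"] exI[of _ UNIV])

lemma openin_vague_Radon [simp]: "openin vague_topology Radon_Delta"
  using openin_topspace[of vague_topology] by (simp only: topspace_vague)

lemma continuous_map_vague_integral:
  assumes "f \<in> Cc_Delta"
  shows "continuous_map vague_topology euclideanreal (\<lambda>\<xi>. \<integral>x. f x \<partial>\<xi>)"
  unfolding continuous_map_def
proof (intro conjI allI impI)
  fix U :: "real set" assume "openin euclideanreal U"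
  then show "openin vague_topology {\<xi> \<in> topspace vague_topology. (\<integral>x. f x \<partial>\<xi>) \<in> U}"
    unfolding topspace_vague using assms
    unfolding vague_topology_def by (intro topology_generated_by_Basis) auto
qed simp

lemma openin_vague_greater:
  "f \<in> Cc_Delta \<Longrightarrow> openin vague_topology {\<xi> \<in> Radon_Delta. c < (\<integral>x. f x \<partial>\<xi>)}"
  using openin_continuous_map_preimage[OF continuous_map_vague_integral, of f "{c<..}"] by simp

lemma openin_vague_less:
  "f \<in> Cc_Delta \<Longrightarrow> openin vague_topology {\<xi> \<in> Radon_Delta. (\<integral>x. f x \<partial>\<xi>) < c}"
  using openin_continuous_map_preimage[OF continuous_map_vague_integral, of f "{..<c}"] by simp

lemma closedin_vague_le:
  "f \<in> Cc_Delta \<Longrightarrow> closedin vague_topology {\<xi> \<in> Radon_Delta. (\<integral>x. f x \<partial>\<xi>) \<le> c}"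
  using closedin_continuous_map_preimage[OF continuous_map_vague_integral, of f "{..c}"] by simp

text \<open>Induction over the generation of \<open>G\<close> from subbasic sets. It serves the
  duality, where a neighbourhood has to be described by finitely many integrals.\<close>

lemma vague_neighbourhood_base:
  assumes "openin vague_topology G" "\<mu> \<in> G"
  obtains \<F> \<delta> where "finite \<F>" "\<F> \<subseteq> Cc_Delta" "\<delta> > 0"
    "\<And>\<nu>. \<nu> \<in> Radon_Delta \<Longrightarrow> (\<forall>f\<in>\<F>. \<bar>(\<integral>x. f x \<partial>\<nu>) - (\<integral>x. f x \<partial>\<mu>)\<bar> < \<delta>) \<Longrightarrow> \<nu> \<in> G"
proof -
  let ?near = "\<lambda>\<F> \<delta> \<nu>. \<forall>f\<in>\<F>. \<bar>(\<integral>x. f x \<partial>\<nu>) - (\<integral>x. f x \<partial>\<mu>)\<bar> < \<delta>"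
  let ?base = "\<lambda>G. \<exists>\<F> \<delta>. finite \<F> \<and> \<F> \<subseteq> Cc_Delta \<and> \<delta> > 0 \<and>
    (\<forall>\<nu>\<in>Radon_Delta. ?near \<F> \<delta> \<nu> \<longrightarrow> \<nu> \<in> G)"
  have "generate_topology_on {{\<xi> \<in> Radon_Delta. (\<integral>x. f x \<partial>\<xi>) \<in> U} | f U. f \<in> Cc_Delta \<and> open U} G"
    using assms(1) by (simp add: vague_topology_def openin_topology_generated_by_iff)
  then have "\<mu> \<in> G \<longrightarrow> ?base G"
  proof induction
    case Empty show ?case by simp
  next
    case (Int a b)
    show ?case
    proof
      assume "\<mu> \<in> a \<inter> b"
      then obtain \<F> \<delta> \<F>' \<delta>' where 1: "finite \<F>" "\<F> \<subseteq> Cc_Delta" "\<delta> > 0"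
        "\<forall>\<nu>\<in>Radon_Delta. ?near \<F> \<delta> \<nu> \<longrightarrow> \<nu> \<in> a"
        and 2: "finite \<F>'" "\<F>' \<subseteq> Cc_Delta" "\<delta>' > 0"
        "\<forall>\<nu>\<in>Radon_Delta. ?near \<F>' \<delta>' \<nu> \<longrightarrow> \<nu> \<in> b"
        using Int.IH by (elim impE conjE exE) auto
      have "\<nu> \<in> a \<inter> b" if "\<nu> \<in> Radon_Delta"
        "?near (\<F> \<union> \<F>') (min \<delta> \<delta>') \<nu>" for \<nu>
        using 1(4) 2(4) that by (metis IntI UnCI min_less_iff_conj)
      moreover have "finite (\<F> \<union> \<F>')" "\<F> \<union> \<F>' \<subseteq> Cc_Delta" "min \<delta> \<delta>' > 0" using 1(1-3) 2(1-3) by simp_all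
      ultimately show "?base (a \<inter> b)"
        by (intro exI[of _ "\<F> \<union> \<F>'"] exI[of _ "min \<delta> \<delta>'"] conjI ballI impI)
    qed
  next
    case (UN K)
    show ?case
    proof
      assume "\<mu> \<in> \<Union>K"
      then obtain k where k: "k \<in> K" "\<mu> \<in> k" by blast
      from UN.IH[OF k(1)] k(2) obtain \<F> \<delta> where "finite \<F>" "\<F> \<subseteq> Cc_Delta" "\<delta> > 0"
        "\<forall>\<nu>\<in>Radon_Delta. ?near \<F> \<delta> \<nu> \<longrightarrow> \<nu> \<in> k"
        by (elim impE exE conjE)
      with k(1) show "?base (\<Union>K)"
        by (intro exI[of _ \<F>] exI[of _ \<delta>] conjI ballI impI UnionI[of k]) simp_all
    qed
  next
    case (Basis s)
    then obtain f U where fU: "s = {\<xi> \<in> Radon_Delta. (\<integral>x. f x \<partial>\<xi>) \<in> U}" "f \<in> Cc_Delta" "open U" by blast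
    show ?case
    proof
      assume "\<mu> \<in> s"
      then obtain \<delta> where "\<delta> > 0" "\<And>y. \<bar>y - (\<integral>x. f x \<partial>\<mu>)\<bar> < \<delta> \<Longrightarrow> y \<in> U"
        using fU by (auto simp: open_dist dist_real_def)
      then show "?base (s)"
        using fU by (intro exI[of _ "{f}"] exI[of _ \<delta>]) auto
    qed
  qed
  with assms(2) that show ?thesis by blast
qed

text \<open>A cutoff near the diagonal: zero where the \<open>to_unit\<close> gap is at most
  1/(n+1), one where it is at least 2/(n+1). On \<open>Delta\<close> it increases to 1.\<close>

definition exhaustion :: "nat \<Rightarrow> ereal \<times> ereal \<Rightarrow> real" where
  "exhaustion n x = clamp01 (real (Suc n) * (to_unit (snd x) - to_unit (fst x)) - 1)"

lemma exhaustion_bounds [simp]: "0 \<le> exhaustion n x" "exhaustion n x \<le> 1"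
  by (simp_all add: exhaustion_def)

lemma exhaustion_Cc: "exhaustion n \<in> Cc_Delta"
proof -
  let ?S = "{x. 0 \<le> fst x} \<inter> {x. 1 / real (Suc n) \<le> to_unit (snd x) - to_unit (fst x)}"
  show ?thesis
  proof (rule Cc_Delta_I[of _ ?S])
  show "continuous_on Delta (exhaustion n)"
    unfolding exhaustion_def by (intro continuous_intros)
  show "closed ?S"
    by (intro closed_Int closed_Collect_le continuous_intros)
  have "u < v" if "1 / real (Suc n) \<le> to_unit v - to_unit u" for u v
  proof -
    have "0 < 1 / real (Suc n)" by simp
    with that have "to_unit u < to_unit v" by linarith
    then show ?thesis by simp
  qed
  then show "?S \<subseteq> Delta"
    by (auto simp: Delta_def)
next
  fix x assume "x \<in> Delta" "x \<notin> ?S"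
  then have "to_unit (snd x) - to_unit (fst x) < 1 / real (Suc n)" by (auto simp: Delta_def)
  then have "real (Suc n) * (to_unit (snd x) - to_unit (fst x)) - 1 \<le> 0"
    by (simp add: field_simps)
  then show "exhaustion n x = 0" unfolding exhaustion_def by (rule clamp01_eqs)
qed
qed

text \<open>Monotone convergence along \<open>exhaustion\<close>. As a supremum of vaguely
  continuous functions the total mass has closed sublevel sets.\<close>

lemma emeasure_Delta_eq_SUP:
  assumes xi: "\<xi> \<in> Radon_Delta"
  shows "emeasure \<xi> Delta = (SUP n. ennreal (\<integral>x. exhaustion n x \<partial>\<xi>))"
proof -
  have "emeasure \<xi> Delta = (\<integral>\<^sup>+x. 1 \<partial>\<xi>)" by (simp add: Radon_space[OF xi])
  also have "\<dots> = (\<integral>\<^sup>+x. (SUP n. ennreal (exhaustion n x)) \<partial>\<xi>)"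
  proof (rule nn_integral_cong)
    fix x assume "x \<in> space \<xi>"
    then have lt: "to_unit (fst x) < to_unit (snd x)" by (auto simp: Radon_space[OF xi] Delta_def)
    define w where "w = to_unit (snd x) - to_unit (fst x)"
    have w: "w > 0" using lt by (simp only: w_def diff_gt_0_iff_gt)
    \<comment> \<open>Exceeding 2, not just 1, pays for the \<open>- 1\<close> inside
      \<open>exhaustion\<close>.\<close>
    then obtain n where n: "2 < real n * w" using reals_Archimedean3 by blast
    have "1 \<le> real (Suc n) * (to_unit (snd x) - to_unit (fst x)) - 1"
      unfolding w_def[symmetric] using n w by (simp add: algebra_simps)
    then have "exhaustion n x = 1" unfolding exhaustion_def by (rule clamp01_eqs)
    then have "1 \<le> (SUP n. ennreal (exhaustion n x))" by (intro SUP_upper2[of n]) auto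
    moreover have "(SUP n. ennreal (exhaustion n x)) \<le> 1"
      by (intro SUP_least) (metis exhaustion_bounds(2) ennreal_leI ennreal_1)
    ultimately show "1 = (SUP n. ennreal (exhaustion n x))" by (rule antisym)
  qed
  also have "\<dots> = (SUP n. (\<integral>\<^sup>+x. ennreal (exhaustion n x) \<partial>\<xi>))"
  proof (rule nn_integral_monotone_convergence_SUP_AE)
    show "AE x in \<xi>. ennreal (exhaustion n x) \<le> ennreal (exhaustion (Suc n) x)" for n
    proof (intro AE_I2 ennreal_leI)
      fix x assume "x \<in> space \<xi>"
      then have lt: "to_unit (fst x) < to_unit (snd x)" by (auto simp: Radon_space[OF xi] Delta_def)
      then have "real (Suc n) * (to_unit (snd x) - to_unit (fst x)) \<le> real (Suc (Suc n)) * (to_unit (snd x) - to_unit (fst x))"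
        by (intro mult_right_mono) auto
      then show "exhaustion n x \<le> exhaustion (Suc n) x" by (simp add: exhaustion_def clamp01_def)
    qed
    show "(\<lambda>x. ennreal (exhaustion n x)) \<in> borel_measurable \<xi>" for n
      using Radon_measurable[OF xi Cc_borel_measurable[OF exhaustion_Cc[of n]]] by measurable
  qed
  also have "\<dots> = (SUP n. ennreal (\<integral>x. exhaustion n x \<partial>\<xi>))"
    by (intro SUP_cong refl nn_integral_eq_integral Cc_integrable xi exhaustion_Cc) simp
  finally show ?thesis .
qed

definition mass_le :: "real \<Rightarrow> (ereal \<times> ereal) measure set" where
  "mass_le K = {\<xi> \<in> Radon_Delta. emeasure \<xi> Delta \<le> ennreal K}"

lemma mass_le_eq:
  assumes "0 \<le> K"
  shows "mass_le K = (\<Inter>n. {\<xi> \<in> Radon_Delta. (\<integral>x. exhaustion n x \<partial>\<xi>) \<le> K})"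
proof -
  have "emeasure \<xi> Delta \<le> ennreal K \<longleftrightarrow> (\<forall>n. (\<integral>x. exhaustion n x \<partial>\<xi>) \<le> K)" if "\<xi> \<in> Radon_Delta" for \<xi>
    unfolding emeasure_Delta_eq_SUP[OF that] SUP_le_iff using assms by simp
  then show ?thesis by (auto simp: mass_le_def)
qed

lemma closedin_mass_le: "0 \<le> K \<Longrightarrow> closedin vague_topology (mass_le K)"
  unfolding mass_le_eq by (intro closedin_INT closedin_vague_le exhaustion_Cc) auto

lemma mass_gt_borel: "0 \<le> K \<Longrightarrow> topspace vague_topology - mass_le K \<in> sets (borel_of vague_topology)"
  using closedin_mass_le[of K] by (intro openin_borel_of) (auto simp: closedin_def)

text \<open>The indicator of the box is a pointwise limit of functions in \<open>Cc_Delta\<close>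
  that vanish off one compact set \<open>S\<close>, so dominated convergence exhibits the box mass
  as a limit of vaguely continuous functions. The cutoffs are placed to give 1 on the included edge
  \<open>s\<close> and 0 on the excluded edge \<open>t\<close>.\<close>

lemma borel_measurable_box_mass:
  assumes st: "s < t"
  shows "(\<lambda>\<xi>. measure \<xi> (box_set s t)) \<in> borel_measurable (borel_of vague_topology)"
proof -
  let ?g = to_unit
  define d where "d = ?g (ereal t) - ?g (ereal s)"
  have d: "d > 0" using st by (simp add: d_def)
  \<comment> \<open>Slopes of at least 2/d make the first factor vanish a distance
    \<open>d / 2\<close> past \<open>s\<close>, hence half the gap before \<open>t\<close>; this
    gives the common support \<open>S\<close> inside \<open>Delta\<close>.\<close>
  define k where "k n = real (Suc n) * (2 / d)" for n
  have k: "2 / d \<le> k n" "k n > 0" for n using d by (auto simp: k_def field_simps)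
  define f where "f n x = clamp01 (1 - k n * (?g (fst x) - ?g (ereal s))) * clamp01 (k n * (?g (snd x) - ?g (ereal t)))" for n x
  define S where "S = {x. 0 \<le> fst x} \<inter> {x. ?g (fst x) \<le> ?g (ereal s) + d / 2} \<inter> {x. ?g (ereal t) \<le> ?g (snd x)}"
  have S: "closed S" unfolding S_def by (intro closed_Int closed_Collect_le continuous_intros)
  have "u < v" if "?g u \<le> ?g (ereal s) + d / 2" "?g (ereal t) \<le> ?g v" for u v
  proof -
    have "?g u < ?g v" using that d unfolding d_def by argo
    then show ?thesis by simp
  qed
  then have SD: "S \<subseteq> Delta" by (auto simp: S_def Delta_def)
  have zero: "f n x = 0" if "x \<in> Delta" "x \<notin> S" for n x
  proof -
    have "?g (ereal s) + d / 2 < ?g (fst x) \<or> ?g (snd x) < ?g (ereal t)"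
      using that by (auto simp: S_def Delta_def)
    then show ?thesis
    proof
      assume "?g (ereal s) + d / 2 < ?g (fst x)"
      then have "(2 / d) * (d / 2) \<le> k n * (?g (fst x) - ?g (ereal s))"
        using k[of n] d by (intro mult_mono) auto
      then show ?thesis using d by (simp add: f_def clamp01_eqs)
    next
      assume "?g (snd x) < ?g (ereal t)"
      then have "k n * (?g (snd x) - ?g (ereal t)) \<le> 0" using k(2)[of n] by (intro mult_nonneg_nonpos) auto
      then show ?thesis by (simp add: f_def clamp01_eqs)
    qed
  qed
  have Cc: "f n \<in> Cc_Delta" for n
    by (rule Cc_Delta_I[OF _ S SD zero]) (auto simp: f_def[abs_def] intro!: continuous_intros)
  have le: "\<bar>f n x\<bar> \<le> indicator S x" if "x \<in> Delta" for n x
    using zero[OF that, of n] by (auto simp: indicator_def f_def mult_le_one abs_mult)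
  have klim: "filterlim k at_top sequentially"
    unfolding k_def using d
    by (intro filterlim_at_top_mult_tendsto_pos[OF tendsto_const] filterlim_compose[OF filterlim_real_sequentially filterlim_Suc]) auto
  have lim: "(\<lambda>n. f n x) \<longlonglongrightarrow> indicator (box_set s t) x" if x: "x \<in> Delta" for x
  proof -
    have ev: "\<forall>\<^sub>F n in sequentially. 1 \<le> k n * c" if "c > 0" for c
    proof -
      have "\<forall>\<^sub>F n in sequentially. 1 / c \<le> k n" using klim by (simp add: filterlim_at_top)
      then show ?thesis by eventually_elim (use that in \<open>simp add: field_simps\<close>)
    qed
    have "\<forall>\<^sub>F n in sequentially. f n x = indicator (box_set s t) x"
    proof (cases "fst x \<le> ereal s")
      case fst_le: True
      have c1: "clamp01 (1 - k n * (?g (fst x) - ?g (ereal s))) = 1" for n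
        using fst_le k(2)[of n] by (intro clamp01_eqs) (simp add: mult_nonneg_nonpos)
      show ?thesis
      proof (cases "ereal t < snd x")
        case True
        then have "x \<in> box_set s t" using fst_le x by (auto simp: box_set_def Delta_def)
        moreover have "\<forall>\<^sub>F n in sequentially. 1 \<le> k n * (?g (snd x) - ?g (ereal t))" using True by (intro ev) simp
        ultimately show ?thesis by (auto elim!: eventually_mono simp: f_def c1 clamp01_eqs)
      next
        case False
        then have "k n * (?g (snd x) - ?g (ereal t)) \<le> 0" for n using k(2)[of n] by (intro mult_nonneg_nonpos) auto
        moreover have "x \<notin> box_set s t" using False by (auto simp: box_set_def)
        ultimately show ?thesis by (simp add: f_def clamp01_eqs)
      qed
    next
      case False
      then have "\<forall>\<^sub>F n in sequentially. 1 \<le> k n * (?g (fst x) - ?g (ereal s))" by (intro ev) simp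
      moreover have "x \<notin> box_set s t" using False by (auto simp: box_set_def)
      ultimately show ?thesis by (auto elim!: eventually_mono simp: f_def clamp01_eqs)
    qed
    then show ?thesis by (rule tendsto_eventually)
  qed
  show ?thesis
  proof (rule borel_measurable_LIMSEQ_real)
    show "(\<lambda>\<xi>. \<integral>x. f n x \<partial>\<xi>) \<in> borel_measurable (borel_of vague_topology)" for n
      by (intro borel_measurable_borel_of continuous_map_vague_integral Cc)
    fix \<xi> assume "\<xi> \<in> space (borel_of vague_topology)"
    then have xi: "\<xi> \<in> Radon_Delta" by simp
    have Scpt: "compact S" using S by (rule compact_if_closed_ereal_prod)
    have box: "box_set s t \<in> sets \<xi>" "emeasure \<xi> (box_set s t) < \<infinity>" using Radon_box[OF xi st] by auto
    have "(\<lambda>n. \<integral>x. f n x \<partial>\<xi>) \<longlonglongrightarrow> (\<integral>x. indicator (box_set s t) x \<partial>\<xi>)"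
    proof (rule integral_dominated_convergence[where w="indicator S"])
      show "integrable \<xi> (indicator S :: _ \<Rightarrow> real)"
        using Radon_emeasure_compact[OF xi Scpt SD] by (simp add: integrable_indicator_iff sets.Int_space_eq2)
      show "f n \<in> borel_measurable \<xi>" for n by (rule Radon_measurable[OF xi Cc_borel_measurable[OF Cc]])
      show "indicator (box_set s t) \<in> borel_measurable \<xi>" using box by simp
      show "AE x in \<xi>. (\<lambda>n. f n x) \<longlonglongrightarrow> indicator (box_set s t) x"
        using lim by (intro AE_I2) (simp add: Radon_space[OF xi])
      show "AE x in \<xi>. norm (f n x) \<le> indicator S x" for n
        using le by (intro AE_I2) (simp add: Radon_space[OF xi])
    qed
    then show "(\<lambda>n. \<integral>x. f n x \<partial>\<xi>) \<longlonglongrightarrow> measure \<xi> (box_set s t)" using box by simp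
  qed
qed

text \<open>Since box masses are not vaguely continuous, box masses of \<open>\<xi>\<close> at \<open>p\<close> are only compared with
  those of \<open>\<xi>\<^sub>0\<close> at a strictly larger or smaller box \<open>q\<close>.\<close>

definition box_nbhd :: "(real \<times> real) set \<Rightarrow> real \<Rightarrow> (ereal \<times> ereal) measure \<Rightarrow> (real \<times> real \<Rightarrow> real) set" where
  "box_nbhd P d \<xi>0 = {x. \<forall>p\<in>P. \<forall>q\<in>P. nested p q \<longrightarrow> x p \<le> box_mass \<xi>0 q + d \<and> box_mass \<xi>0 p - d \<le> x q}"

text \<open>For a nested pair, the integral of the function squeezed between the two boxes is
  vaguely continuous; keeping it within \<open>d\<close> of its value at \<open>\<xi>0\<close> gives
  both inequalities at once.\<close>

lemma box_nbhd_contains_vague: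
  assumes xi0: "\<xi>0 \<in> Radon_Delta" and P: "finite P" and d: "d > 0"
  obtains G where "openin vague_topology G" "\<xi>0 \<in> G" "\<And>\<xi>. \<xi> \<in> G \<Longrightarrow> box_mass \<xi> \<in> box_nbhd P d \<xi>0"
proof -
  have "\<exists>G. openin vague_topology G \<and> \<xi>0 \<in> G \<and> (\<forall>\<xi>\<in>G. nested p q \<longrightarrow>
     box_mass \<xi> p \<le> box_mass \<xi>0 q + d \<and> box_mass \<xi>0 p - d \<le> box_mass \<xi> q)" for p q
  proof (cases "nested p q")
    case True
    obtain f where f: "f \<in> Cc_Delta"
      "\<And>\<xi>. \<xi> \<in> Radon_Delta \<Longrightarrow> box_mass \<xi> p \<le> (\<integral>x. f x \<partial>\<xi>)"
      "\<And>\<xi>. \<xi> \<in> Radon_Delta \<Longrightarrow> (\<integral>x. f x \<partial>\<xi>) \<le> box_mass \<xi> q"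
      using Cc_between_nested[OF True] by blast
    let ?G = "{\<xi> \<in> Radon_Delta. (\<integral>x. f x \<partial>\<xi>0) - d < (\<integral>x. f x \<partial>\<xi>)} \<inter>
        {\<xi> \<in> Radon_Delta. (\<integral>x. f x \<partial>\<xi>) < (\<integral>x. f x \<partial>\<xi>0) + d}"
    have "openin vague_topology ?G" by (intro openin_Int openin_vague_greater openin_vague_less f)
    moreover have "\<xi>0 \<in> ?G" using xi0 d by simp
    moreover have "box_mass \<xi> p \<le> box_mass \<xi>0 q + d \<and> box_mass \<xi>0 p - d \<le> box_mass \<xi> q" if "\<xi> \<in> ?G" for \<xi>
      using f(2)[OF xi0] f(3)[OF xi0] f(2)[of \<xi>] f(3)[of \<xi>] that by auto
    ultimately show ?thesis by blast
  next
    case False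
    then show ?thesis using xi0 openin_topspace[of vague_topology]
      by (intro exI[of _ Radon_Delta]) (simp only: topspace_vague, simp)
  qed
  then obtain G where G: "\<And>p q. openin vague_topology (G p q)" "\<And>p q. \<xi>0 \<in> G p q"
    "\<And>p q \<xi>. \<xi> \<in> G p q \<Longrightarrow> nested p q \<Longrightarrow> box_mass \<xi> p \<le> box_mass \<xi>0 q + d \<and> box_mass \<xi>0 p - d \<le> box_mass \<xi> q"
    by metis
  let ?H = "topspace vague_topology \<inter> \<Inter>((\<lambda>(p, q). G p q) ` (P \<times> P))"
  show ?thesis
  proof
    show "openin vague_topology ?H"
    proof (cases "P = {}")
      case False
      then have "openin vague_topology (\<Inter>((\<lambda>(p, q). G p q) ` (P \<times> P)))"
        using P G by (intro openin_Inter) auto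
      then show ?thesis by (intro openin_Int) auto
    qed simp
    show "\<xi>0 \<in> ?H" using G xi0 by auto
    show "box_mass \<xi> \<in> box_nbhd P d \<xi>0" if "\<xi> \<in> ?H" for \<xi>
      using that G(3) unfolding box_nbhd_def by blast
  qed
qed

text \<open>By \<open>Radon_eqI\<close> some nested pair \<open>p\<close>, \<open>q\<close> violates
  the comparison strictly. Violation is not an open condition on box masses, so a box
  \<open>r\<close> is inserted: a test function on one side of \<open>r\<close> gives the open set
  \<open>V\<close>, and the violation persists on \<open>V\<close> for the pair with
  \<open>r\<close> in place of \<open>p\<close> or of \<open>q\<close>.\<close>

lemma box_nbhd_separates:
  assumes "\<xi>0 \<in> Radon_Delta" "\<eta> \<in> Radon_Delta" "\<eta> \<noteq> \<xi>0"
  obtains V p q d where "openin vague_topology V" "\<eta> \<in> V" "d > 0" "nested p q"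
    "\<And>\<xi>. \<xi> \<in> V \<Longrightarrow> \<not> (box_mass \<xi> p \<le> box_mass \<xi>0 q + d \<and> box_mass \<xi>0 p - d \<le> box_mass \<xi> q)"
proof -
  have "\<exists>p q. nested p q \<and> (box_mass \<xi>0 q < box_mass \<eta> p \<or> box_mass \<eta> q < box_mass \<xi>0 p)"
    using Radon_eqI[OF assms(2,1)] assms(3) by (metis not_less)
  then obtain p q where pq: "nested p q" and "box_mass \<xi>0 q < box_mass \<eta> p \<or> box_mass \<eta> q < box_mass \<xi>0 p" by blast
  then show ?thesis
  proof (elim disjE)
    assume lt: "box_mass \<xi>0 q < box_mass \<eta> p"
    obtain r where r: "nested p r" "nested r q" using nested_between[OF pq] by blast
    obtain f where f: "f \<in> Cc_Delta"
      "\<And>\<xi>. \<xi> \<in> Radon_Delta \<Longrightarrow> box_mass \<xi> p \<le> (\<integral>x. f x \<partial>\<xi>)"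
      "\<And>\<xi>. \<xi> \<in> Radon_Delta \<Longrightarrow> (\<integral>x. f x \<partial>\<xi>) \<le> box_mass \<xi> r"
      using Cc_between_nested[OF r(1)] by blast
    define d where "d = (box_mass \<eta> p - box_mass \<xi>0 q) / 2"
    let ?V = "{\<xi> \<in> Radon_Delta. box_mass \<xi>0 q + d < (\<integral>x. f x \<partial>\<xi>)}"
    show ?thesis
    proof (rule that[of ?V d r q])
      show "openin vague_topology ?V" by (intro openin_vague_greater f)
      show "d > 0" "nested r q" using lt r by (auto simp: d_def)
      have "box_mass \<xi>0 q + d < box_mass \<eta> p" using lt by (simp add: d_def field_simps)
      then show "\<eta> \<in> ?V" using f(2)[OF assms(2)] assms(2) by simp
    next
      fix \<xi> assume "\<xi> \<in> ?V"
      then show "\<not> (box_mass \<xi> r \<le> box_mass \<xi>0 q + d \<and> box_mass \<xi>0 r - d \<le> box_mass \<xi> q)"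
        using f(3)[of \<xi>] by auto
    qed
  next
    assume lt: "box_mass \<eta> q < box_mass \<xi>0 p"
    obtain r where r: "nested p r" "nested r q" using nested_between[OF pq] by blast
    obtain f where f: "f \<in> Cc_Delta"
      "\<And>\<xi>. \<xi> \<in> Radon_Delta \<Longrightarrow> box_mass \<xi> r \<le> (\<integral>x. f x \<partial>\<xi>)"
      "\<And>\<xi>. \<xi> \<in> Radon_Delta \<Longrightarrow> (\<integral>x. f x \<partial>\<xi>) \<le> box_mass \<xi> q"
      using Cc_between_nested[OF r(2)] by blast
    define d where "d = (box_mass \<xi>0 p - box_mass \<eta> q) / 2"
    let ?V = "{\<xi> \<in> Radon_Delta. (\<integral>x. f x \<partial>\<xi>) < box_mass \<xi>0 p - d}"
    show ?thesis
    proof (rule that[of ?V d p r])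
      show "openin vague_topology ?V" by (intro openin_vague_less f)
      show "d > 0" "nested p r" using lt r by (auto simp: d_def)
      have "box_mass \<eta> q < box_mass \<xi>0 p - d" using lt by (simp add: d_def field_simps)
      then show "\<eta> \<in> ?V" using f(3)[OF assms(2)] assms(2) by simp
    next
      fix \<xi> assume "\<xi> \<in> ?V"
      then show "\<not> (box_mass \<xi> p \<le> box_mass \<xi>0 r + d \<and> box_mass \<xi>0 p - d \<le> box_mass \<xi> r)"
        using f(2)[of \<xi>] by auto
    qed
  qed
qed

text \<open>The part of \<open>S\<close> outside \<open>G\<close> is compact and avoids
  \<open>\<xi>0\<close>, so finitely many sets from \<open>box_nbhd_separates\<close> cover it;
  \<open>P\<close> collects their corners and \<open>d\<close> is the smallest of their
  tolerances.\<close>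

lemma box_nbhd_inside_vague:
  assumes xi0: "\<xi>0 \<in> Radon_Delta" and G: "openin vague_topology G" "\<xi>0 \<in> G"
    and S: "compactin vague_topology S"
  obtains P d where "finite P" "P \<subseteq> {p. 0 \<le> fst p \<and> fst p < snd p}" "d > 0"
    "\<And>\<xi>. \<xi> \<in> S \<Longrightarrow> box_mass \<xi> \<in> box_nbhd P d \<xi>0 \<Longrightarrow> \<xi> \<in> G"
proof -
  let ?D = "S \<inter> (topspace vague_topology - G)"
  have cpt: "compactin vague_topology ?D"
    using S G by (intro compact_Int_closedin closedin_diff closedin_topspace)
  have "\<exists>V p q d. openin vague_topology V \<and> \<eta> \<in> V \<and> d > 0 \<and> nested p q \<and>
    (\<forall>\<xi>\<in>V. \<not> (box_mass \<xi> p \<le> box_mass \<xi>0 q + d \<and> box_mass \<xi>0 p - d \<le> box_mass \<xi> q))"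
    if "\<eta> \<in> ?D" for \<eta>
  proof -
    have "\<eta> \<in> Radon_Delta" "\<eta> \<noteq> \<xi>0" using that G(2) by auto
    then show ?thesis using box_nbhd_separates[OF xi0, of \<eta>] by metis
  qed
  then obtain V p q d where V: "\<And>\<eta>. \<eta> \<in> ?D \<Longrightarrow>
     openin vague_topology (V \<eta>) \<and> \<eta> \<in> V \<eta> \<and> d \<eta> > (0::real) \<and> nested (p \<eta>) (q \<eta>) \<and>
    (\<forall>\<xi>\<in>V \<eta>. \<not> (box_mass \<xi> (p \<eta>) \<le> box_mass \<xi>0 (q \<eta>) + d \<eta> \<and> box_mass \<xi>0 (p \<eta>) - d \<eta> \<le> box_mass \<xi> (q \<eta>)))"
    by metis
  have "\<forall>U\<in>V ` ?D. openin vague_topology U"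
    "?D \<subseteq> \<Union>(V ` ?D)" using V by auto
  then obtain \<F> where \<F>: "finite \<F>" "\<F> \<subseteq> V ` ?D"
    "?D \<subseteq> \<Union>\<F>"
    using cpt unfolding compactin_def by meson
  obtain J where J: "finite J" "J \<subseteq> ?D" "\<F> = V ` J"
    using \<F> finite_subset_image by metis
  \<comment> \<open>The 1 covers the case that \<open>S\<close> lies inside \<open>G\<close> and
    \<open>J\<close> is empty.\<close>
  define d0 where "d0 = Min (insert 1 (d ` J))"
  have d0: "d0 > 0" "\<And>\<eta>. \<eta> \<in> J \<Longrightarrow> d0 \<le> d \<eta>"
    using J V by (auto simp: d0_def)
  have nst: "nested (p \<eta>) (q \<eta>)" if "\<eta> \<in> J" for \<eta> using V J(2) that by blast
  show ?thesis
  proof (rule that[of "p ` J \<union> q ` J" d0])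
    show "finite (p ` J \<union> q ` J)" using J by simp
    show "p ` J \<union> q ` J \<subseteq> {p. 0 \<le> fst p \<and> fst p < snd p}"
      using nst by (auto simp: nested_def) (meson order_less_trans less_imp_le order_trans)+
    show "d0 > 0" by (rule d0)
    fix \<xi> assume xi: "\<xi> \<in> S" "box_mass \<xi> \<in> box_nbhd (p ` J \<union> q ` J) d0 \<xi>0"
    show "\<xi> \<in> G"
    proof (rule ccontr)
      assume "\<xi> \<notin> G"
      then have "\<xi> \<in> ?D"
        using xi compactin_subset_topspace[OF S] by auto
      then obtain \<eta> where eta: "\<eta> \<in> J" "\<xi> \<in> V \<eta>" using \<F> J by auto
      have "box_mass \<xi> (p \<eta>) \<le> box_mass \<xi>0 (q \<eta>) + d0 \<and> box_mass \<xi>0 (p \<eta>) - d0 \<le> box_mass \<xi> (q \<eta>)"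
        using xi(2) eta(1) nst[OF eta(1)] unfolding box_nbhd_def by blast
      moreover have "\<not> (box_mass \<xi> (p \<eta>) \<le> box_mass \<xi>0 (q \<eta>) + d \<eta> \<and> box_mass \<xi>0 (p \<eta>) - d \<eta> \<le> box_mass \<xi> (q \<eta>))"
        using V J(2) eta by blast
      ultimately show False using d0(2)[OF eta(1)] by linarith
    qed
  qed
qed

section \<open>A space-filling curve\<close>

definition add_measure :: "'a measure \<Rightarrow> 'a measure \<Rightarrow> 'a measure" where
  "add_measure M N = measure_of (space M) (sets M) (\<lambda>A. emeasure M A + emeasure N A)"

lemma sets_add_measure [simp, measurable_cong]: "sets (add_measure M N) = sets M"
  by (simp add: add_measure_def)

lemma space_add_measure [simp]: "space (add_measure M N) = space M"
  by (simp add: add_measure_def)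

lemma emeasure_add_measure:
  assumes N: "sets N = sets M" and A: "A \<in> sets M"
  shows "emeasure (add_measure M N) A = emeasure M A + emeasure N A"
  unfolding add_measure_def
proof (rule emeasure_measure_of_sigma[OF sets.sigma_algebra_axioms _ _ A])
  show "positive (sets M) (\<lambda>A. emeasure M A + emeasure N A)" by (simp add: positive_def)
  show "countably_additive (sets M) (\<lambda>A. emeasure M A + emeasure N A)"
    unfolding countably_additive_def
  proof (intro allI impI)
    fix B :: "nat \<Rightarrow> 'a set" assume B: "range B \<subseteq> sets M" "disjoint_family B"
    have "(\<Sum>i. emeasure M (B i) + emeasure N (B i)) = (\<Sum>i. emeasure M (B i)) + (\<Sum>i. emeasure N (B i))"
      by (rule suminf_add[symmetric]) auto
    also have "\<dots> = emeasure M (\<Union>i. B i) + emeasure N (\<Union>i. B i)"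
      using B N by (simp add: suminf_emeasure)
    finally show "(\<Sum>i. emeasure M (B i) + emeasure N (B i)) = emeasure M (\<Union>i. B i) + emeasure N (\<Union>i. B i)" .
  qed
qed

lemma nn_integral_add_measure:
  assumes N: "sets N = sets M" and f: "f \<in> borel_measurable M"
  shows "(\<integral>\<^sup>+x. f x \<partial>add_measure M N) = (\<integral>\<^sup>+x. f x \<partial>M) + (\<integral>\<^sup>+x. f x \<partial>N)"
  using f
proof induction
  have mN: "borel_measurable N = borel_measurable M" by (rule measurable_cong_sets[OF N refl])
  have mA: "borel_measurable (add_measure M N) = borel_measurable M" by (rule measurable_cong_sets) simp_all
  {
    case (cong f g)
    then have "\<And>x. x \<in> space N \<Longrightarrow> f x = g x" using sets_eq_imp_space_eq[OF N] by simp
    then have "integral\<^sup>N N f = integral\<^sup>N N g" by (rule nn_integral_cong)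
    moreover have "integral\<^sup>N M f = integral\<^sup>N M g" "integral\<^sup>N (add_measure M N) f = integral\<^sup>N (add_measure M N) g"
      using cong(3) by (auto intro: nn_integral_cong)
    ultimately show ?case using cong by simp
  next
    case (set A)
    then show ?case using N by (simp add: emeasure_add_measure)
  next
    case (mult u c)
    then show ?case by (simp add: nn_integral_cmult mN mA distrib_left)
  next
    case (add u v)
    then show ?case by (simp add: nn_integral_add mN mA ac_simps)
  next
    case (seq U)
    have "(\<integral>\<^sup>+x. (SUP i. U i) x \<partial>add_measure M N) = (SUP i. \<integral>\<^sup>+x. U i x \<partial>add_measure M N)"
      unfolding SUP_apply using seq by (intro nn_integral_monotone_convergence_SUP) (auto simp: mA)
    also have "\<dots> = (SUP i. (\<integral>\<^sup>+x. U i x \<partial>M) + (\<integral>\<^sup>+x. U i x \<partial>N))" using seq by simp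
    also have "\<dots> = (SUP i. \<integral>\<^sup>+x. U i x \<partial>M) + (SUP i. \<integral>\<^sup>+x. U i x \<partial>N)"
      using seq by (intro ennreal_SUP_add incseq_nn_integral) auto
    also have "\<dots> = (\<integral>\<^sup>+x. (SUP i. U i) x \<partial>M) + (\<integral>\<^sup>+x. (SUP i. U i) x \<partial>N)"
      unfolding SUP_apply using seq by (subst (1 2) nn_integral_monotone_convergence_SUP) (auto simp: mN)
    finally show ?case .
  }
qed

lemma integral_add_measure:
  fixes f :: "'a \<Rightarrow> real"
  assumes N: "sets N = sets M" and f: "integrable M f" "integrable N f"
  shows "(\<integral>x. f x \<partial>add_measure M N) = (\<integral>x. f x \<partial>M) + (\<integral>x. f x \<partial>N)"
proof -
  have m: "f \<in> borel_measurable M" using f by simp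
  have fin: "(\<integral>\<^sup>+x. ennreal (f x) \<partial>M) < \<infinity>" "(\<integral>\<^sup>+x. ennreal (f x) \<partial>N) < \<infinity>"
    "(\<integral>\<^sup>+x. ennreal (- f x) \<partial>M) < \<infinity>" "(\<integral>\<^sup>+x. ennreal (- f x) \<partial>N) < \<infinity>"
    using f by (auto simp: real_integrable_def less_top)
  have "integrable (add_measure M N) f"
    unfolding real_integrable_def using m fin
    by (auto simp: nn_integral_add_measure[OF N] measurable_cong_sets[of "add_measure M N" M] less_top)
  then show ?thesis
    using f m fin by (simp add: real_lebesgue_integral_def nn_integral_add_measure[OF N] enn2real_plus)
qed

text \<open>A continuous function of period 1 that reads off a digit: it is 0 on [0,1/6] and 1 on
  [1/3,1/2], and these intervals contain the numbers with ternary digits 0 and 1 only whose leading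
  digit is 0 and 1, respectively. The cosine crosses 1/2 and -1/2 at 1/6 and 1/3 of a
  period.\<close>

definition wave :: "real \<Rightarrow> real" where
  "wave x = clamp01 (1/2 - cos (2 * pi * x))"

lemma wave_bounds: "0 \<le> wave x" "wave x \<le> 1"
  by (simp_all add: wave_def)

lemma wave_shift: "wave (of_int n + x) = wave x"
proof -
  have "cos (2 * pi * (of_int n + x)) = cos (2 * pi * x)"
    by (simp add: distrib_left cos_add)
  then show ?thesis by (simp add: wave_def)
qed

lemma wave_low: "0 \<le> x \<Longrightarrow> x \<le> 1/6 \<Longrightarrow> wave x = 0"
proof -
  assume x: "0 \<le> x" "x \<le> 1/6"
  have "cos (pi / 3) \<le> cos (2 * pi * x)"
    using x by (intro cos_monotone_0_pi_le) (auto simp: field_simps)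
  then show ?thesis unfolding wave_def by (intro clamp01_eqs) (simp add: cos_60)
qed

lemma wave_high: "1/3 \<le> x \<Longrightarrow> x \<le> 1/2 \<Longrightarrow> wave x = 1"
proof -
  assume x: "1/3 \<le> x" "x \<le> 1/2"
  have "cos (2 * pi * x) \<le> cos (pi - pi / 3)"
    using x by (intro cos_monotone_0_pi_le) (auto simp: field_simps)
  also have "\<dots> = - (1/2)" by (simp only: cos_pi_minus cos_60)
  finally show ?thesis unfolding wave_def by (intro clamp01_eqs) simp
qed

definition ternary :: "(nat \<Rightarrow> real) \<Rightarrow> real" where
  "ternary c = (\<Sum>m. c m * (1/3) ^ Suc m)"

lemma ternary_summable:
  assumes "\<And>m. c m \<in> {0, 1}"
  shows "summable (\<lambda>m. c m * (1/3::real) ^ Suc m)"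
proof (rule summable_comparison_test')
  show "summable (\<lambda>m. (1/3::real) ^ Suc m)" by (subst summable_Suc_iff) (simp add: summable_geometric)
  show "norm (c m * (1/3) ^ Suc m) \<le> (1/3) ^ Suc m" for m using assms[of m] by auto
qed

lemma ternary_bounds:
  assumes "\<And>m. c m \<in> {0, 1}"
  shows "0 \<le> ternary c" "ternary c \<le> 1/2"
proof -
  have s: "(\<lambda>m. (1/3::real) ^ Suc m) sums (1/2)"
    using sums_mult[OF geometric_sums[of "1/3::real"], of "1/3"] by simp
  have c: "c m * (1/3) ^ Suc m \<le> (1/3) ^ Suc m" "0 \<le> c m * (1/3) ^ Suc m" for m using assms[of m] by auto
  show "0 \<le> ternary c" unfolding ternary_def using c by (intro suminf_nonneg ternary_summable assms)
  have "ternary c \<le> (\<Sum>m. (1/3) ^ Suc m)" unfolding ternary_def using c s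
    by (intro suminf_le ternary_summable assms) (auto simp: sums_iff)
  also have "\<dots> = 1/2" using s by (simp add: sums_iff)
  finally show "ternary c \<le> 1/2" .
qed

lemma ternary_shift:
  assumes "\<And>m. c m \<in> {0, 1}"
  shows "3 * ternary c = c 0 + ternary (\<lambda>m. c (Suc m))"
proof -
  have s: "summable (\<lambda>m. c m * (1/3::real) ^ Suc m)" by (rule ternary_summable[OF assms])
  have s': "summable (\<lambda>m. c (Suc m) * (1/3::real) ^ Suc m)" by (rule ternary_summable) (rule assms)
  have "ternary c = c 0 * (1/3) + (\<Sum>m. c (Suc m) * (1/3) ^ Suc (Suc m))"
    unfolding ternary_def using suminf_split_head[OF s] by simp
  also have "(\<Sum>m. c (Suc m) * (1/3) ^ Suc (Suc m)) = (\<Sum>m. (1/3) * (c (Suc m) * (1/3) ^ Suc m))"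
    by (simp add: ac_simps)
  also have "\<dots> = (1/3) * ternary (\<lambda>m. c (Suc m))" unfolding ternary_def by (rule suminf_mult[OF s'])
  finally show ?thesis by simp
qed

text \<open>Multiplication by 3 moves the leading digit into the integer part, which the period of
  \<open>wave\<close> removes, and shifts the remaining digits.\<close>

lemma wave_ternary:
  assumes "\<And>m. c m \<in> {0, 1}"
  shows "wave (3 ^ k * ternary c) = c k"
  using assms
proof (induction k arbitrary: c)
  case 0
  have b: "0 \<le> ternary (\<lambda>m. c (Suc m))" "ternary (\<lambda>m. c (Suc m)) \<le> 1/2"
    using ternary_bounds[of "\<lambda>m. c (Suc m)"] 0 by auto
  have e: "3 * ternary c = c 0 + ternary (\<lambda>m. c (Suc m))" by (rule ternary_shift[OF 0])
  consider "c 0 = 0" | "c 0 = 1" using 0[of 0] by auto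
  then show ?case
  proof cases
    case 1 then show ?thesis using wave_low[of "ternary c"] b e by simp
  next
    case 2 then show ?thesis using wave_high[of "ternary c"] b e by simp
  qed
next
  case (Suc k)
  have "c 0 = of_int (if c 0 = 0 then 0 else 1)" using Suc.prems[of 0] by auto
  then obtain n :: int where n: "c 0 = of_int n" by blast
  have "3 ^ Suc k * ternary c = 3 ^ k * (3 * ternary c)" by simp
  also have "\<dots> = of_int (3 ^ k * n) + 3 ^ k * ternary (\<lambda>m. c (Suc m))"
    by (simp add: ternary_shift[OF Suc.prems] n distrib_left)
  finally have "wave (3 ^ Suc k * ternary c) = wave (3 ^ k * ternary (\<lambda>m. c (Suc m)))"
    by (simp only: wave_shift)
  also have "\<dots> = c (Suc k)" by (rule Suc.IH) (rule Suc.prems)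
  finally show ?case .
qed

definition binary_digit :: "real \<Rightarrow> nat \<Rightarrow> real" where
  "binary_digit x k = of_int (\<lfloor>2 ^ Suc k * x\<rfloor> - 2 * \<lfloor>2 ^ k * x\<rfloor>)"

lemma binary_digit_range: "binary_digit x k \<in> {0, 1}"
proof -
  have "2 * \<lfloor>2 ^ k * x\<rfloor> \<le> \<lfloor>2 ^ Suc k * x\<rfloor>" by (simp add: le_floor_iff)
  moreover have "\<lfloor>2 ^ Suc k * x\<rfloor> < 2 * \<lfloor>2 ^ k * x\<rfloor> + 2" 
    unfolding floor_less_iff by (simp add: mult.assoc) linarith
  ultimately have "\<lfloor>2 ^ Suc k * x\<rfloor> - 2 * \<lfloor>2 ^ k * x\<rfloor> \<in> {0, 1}" by auto
  then show ?thesis unfolding binary_digit_def by auto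
qed

text \<open>The partial sums telescope to the dyadic truncations
  \<open>\<lfloor>2 ^ n * x\<rfloor> / 2 ^ n\<close>.\<close>

lemma binary_digit_sums:
  assumes "0 \<le> x" "x < 1"
  shows "(\<lambda>k. (1/2) ^ Suc k * binary_digit x k) sums x"
proof -
  have fl0: "\<lfloor>x\<rfloor> = 0" using assms by (simp add: floor_eq_iff)
  have part: "(\<Sum>k<n. (1/2) ^ Suc k * binary_digit x k) = of_int \<lfloor>2 ^ n * x\<rfloor> / 2 ^ n" for n
  proof (induction n)
    case (Suc n)
    have "(\<Sum>k<Suc n. (1/2) ^ Suc k * binary_digit x k) = of_int \<lfloor>2 ^ n * x\<rfloor> / 2 ^ n + (1/2) ^ Suc n * binary_digit x n"
      using Suc.IH by simp
    also have "\<dots> = of_int \<lfloor>2 ^ Suc n * x\<rfloor> / 2 ^ Suc n"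
      by (simp add: binary_digit_def field_simps power_divide)
    finally show ?case .
  qed (simp add: fl0)
  have "(\<lambda>n. of_int \<lfloor>2 ^ n * x\<rfloor> / 2 ^ n) \<longlonglongrightarrow> x"
  proof (rule real_tendsto_sandwich[of "\<lambda>n. x - (1/2) ^ n" _ _ "\<lambda>n. x"])
    show "\<forall>\<^sub>F n in sequentially. x - (1/2) ^ n \<le> of_int \<lfloor>2 ^ n * x\<rfloor> / 2 ^ n"
    proof (intro always_eventually allI)
      fix n :: nat
      have "2 ^ n * x - 1 \<le> of_int \<lfloor>2 ^ n * x\<rfloor>" by linarith
      then have "(2 ^ n * x - 1) / 2 ^ n \<le> of_int \<lfloor>2 ^ n * x\<rfloor> / 2 ^ n" by (intro divide_right_mono) auto
      then show "x - (1/2) ^ n \<le> of_int \<lfloor>2 ^ n * x\<rfloor> / 2 ^ n" by (simp add: diff_divide_distrib power_divide)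
    qed
    show "\<forall>\<^sub>F n in sequentially. of_int \<lfloor>2 ^ n * x\<rfloor> / 2 ^ n \<le> x"
    proof (intro always_eventually allI)
      fix n :: nat
      have "of_int \<lfloor>2 ^ n * x\<rfloor> \<le> 2 ^ n * x" by linarith
      then show "of_int \<lfloor>2 ^ n * x\<rfloor> / 2 ^ n \<le> x" by (simp add: divide_le_eq mult.commute)
    qed
    have "(\<lambda>n. x - (1/2) ^ n) \<longlonglongrightarrow> x - 0" by (intro tendsto_intros LIMSEQ_realpow_zero) auto
    then show "(\<lambda>n. x - (1/2) ^ n) \<longlonglongrightarrow> x" by simp
  qed simp
  then show ?thesis unfolding sums_def part .
qed

text \<open>Schoenberg's space-filling curve, with coordinates \<open>i = 0, 1\<close>; \<open>curve_code\<close> is a Borel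
  right inverse of it.\<close>

definition curve_coord :: "nat \<Rightarrow> real \<Rightarrow> real" where
  "curve_coord i t = (\<Sum>k. (1/2) ^ Suc k * wave (3 ^ (2 * k + i) * t))"

definition curve_code :: "real \<Rightarrow> real \<Rightarrow> real" where
  "curve_code x y = ternary (\<lambda>m. if even m then binary_digit x (m div 2) else binary_digit y (m div 2))"

lemma continuous_on_wave [continuous_intros]:
  fixes f :: "real \<Rightarrow> real"
  shows "continuous_on S f \<Longrightarrow> continuous_on S (\<lambda>x. wave (f x))"
  unfolding wave_def by (intro continuous_intros)

lemma continuous_on_curve_coord: "continuous_on S (curve_coord i)"
proof -
  have "uniform_limit UNIV (\<lambda>n t. \<Sum>k<n. (1/2) ^ Suc k * wave (3 ^ (2 * k + i) * t)) (curve_coord i) sequentially"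
    unfolding curve_coord_def
  proof (rule Weierstrass_m_test)
    show "norm ((1/2) ^ Suc k * wave (3 ^ (2 * k + i) * t)) \<le> (1/2) ^ Suc k" for k t
      using wave_bounds by (simp add: abs_mult mult_le_cancel_left1)
    show "summable (\<lambda>k. (1/2::real) ^ Suc k)" by (subst summable_Suc_iff) (simp add: summable_geometric)
  qed
  then have "continuous_on UNIV (curve_coord i)"
    by (rule uniform_limit_theorem[rotated]) (auto intro!: always_eventually continuous_intros)
  then show ?thesis by (rule continuous_on_subset) simp
qed

lemma curve_coord_nonneg: "0 \<le> curve_coord i t"
  unfolding curve_coord_def
proof (rule suminf_nonneg)
  show "summable (\<lambda>k. (1/2) ^ Suc k * wave (3 ^ (2 * k + i) * t))"
  proof (rule summable_comparison_test')
    show "summable (\<lambda>k. (1/2::real) ^ Suc k)" by (subst summable_Suc_iff) (simp add: summable_geometric)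
    show "norm ((1/2) ^ Suc k * wave (3 ^ (2 * k + i) * t)) \<le> (1/2) ^ Suc k" for k
      using wave_bounds by (simp add: abs_mult mult_le_cancel_left1)
  qed
qed (simp add: wave_bounds)

lemma curve_coord_0: "curve_coord i 0 = 0"
  by (simp add: curve_coord_def wave_low)

text \<open>Even ternary positions of the code carry the binary digits of \<open>x\<close>, odd ones
  those of \<open>y\<close>. Binary expansion without integer part is why the coordinates must lie
  strictly below 1.\<close>

lemma curve_coord_code:
  assumes "0 \<le> x" "x < 1" "0 \<le> y" "y < 1"
  shows "curve_coord 0 (curve_code x y) = x" "curve_coord 1 (curve_code x y) = y"
proof -
  let ?c = "\<lambda>m. if even m then binary_digit x (m div 2) else binary_digit y (m div 2)"
  have c: "?c m \<in> {0, 1}" for m using binary_digit_range by auto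
  have w: "wave (3 ^ m * curve_code x y) = ?c m" for m
    unfolding curve_code_def by (rule wave_ternary[OF c])
  have "wave (3 ^ (2 * k + 0) * curve_code x y) = binary_digit x k" for k using w[of "2 * k + 0"] by simp
  then show "curve_coord 0 (curve_code x y) = x"
    unfolding curve_coord_def using binary_digit_sums[OF assms(1,2)] by (simp add: sums_iff)
  have "wave (3 ^ (2 * k + 1) * curve_code x y) = binary_digit y k" for k using w[of "2 * k + 1"] by simp
  then show "curve_coord 1 (curve_code x y) = y"
    unfolding curve_coord_def using binary_digit_sums[OF assms(3,4)] by (simp add: sums_iff)
qed

lemma curve_code_bounds: "0 \<le> curve_code x y" "curve_code x y \<le> 1/2"
  unfolding curve_code_def using ternary_bounds binary_digit_range by presburger+

lemma borel_measurable_curve_code: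
  assumes [measurable]: "f \<in> borel_measurable M" "g \<in> borel_measurable M"
  shows "(\<lambda>x. curve_code (f x) (g x)) \<in> borel_measurable M"
  unfolding curve_code_def ternary_def
proof (rule borel_measurable_suminf)
  fix m
  show "(\<lambda>x. (if even m then binary_digit (f x) (m div 2) else binary_digit (g x) (m div 2)) * (1/3) ^ Suc m) \<in> borel_measurable M"
    unfolding binary_digit_def by (cases "even m") auto
qed

text \<open>An infinite endpoint has \<open>to_unit\<close> value 1, which
  \<open>curve_coord_code\<close> excludes, so \<open>curve_section\<close> encodes half of each
  coordinate and the curve doubles it; \<open>min\<close> keeps the doubled value within the range
  where \<open>of_unit\<close> is continuous.\<close>

definition curve :: "real \<Rightarrow> ereal \<times> ereal" where
  "curve t = (of_unit (min 1 (2 * curve_coord 0 t)), of_unit (min 1 (2 * curve_coord 1 t)))"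

definition curve_section :: "ereal \<times> ereal \<Rightarrow> real" where
  "curve_section x = curve_code (to_unit (fst x) / 2) (to_unit (snd x) / 2)"

lemma continuous_on_curve: "continuous_on S curve"
proof -
  have "continuous_on S (\<lambda>t. of_unit (min 1 (2 * curve_coord i t)))" for i
    using order_trans[of "-1" 0, OF _ mult_nonneg_nonneg[of 2, OF _ curve_coord_nonneg[of i]]]
    by (intro continuous_on_compose2[OF continuous_on_of_unit] continuous_intros continuous_on_curve_coord)
      auto
  then show ?thesis unfolding curve_def by (intro continuous_intros)
qed

lemma borel_measurable_curve [measurable]: "curve \<in> borel_measurable borel"
  by (intro borel_measurable_continuous_onI continuous_on_curve)

lemma borel_measurable_curve_section [measurable]: "curve_section \<in> borel_measurable borel"
proof -
  have "(\<lambda>x::ereal \<times> ereal. fst x) \<in> borel_measurable borel" "(\<lambda>x::ereal \<times> ereal. snd x) \<in> borel_measurable borel"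
    by (intro borel_measurable_continuous_onI continuous_intros)+
  then have "(\<lambda>x::ereal \<times> ereal. to_unit (fst x)) \<in> borel_measurable borel"
    "(\<lambda>x::ereal \<times> ereal. to_unit (snd x)) \<in> borel_measurable borel"
    by (auto intro: measurable_compose[OF _ borel_measurable_to_unit])
  then show ?thesis unfolding curve_section_def by (intro borel_measurable_curve_code) auto
qed

lemma curve_nonneg: "0 \<le> fst (curve t)"
proof -
  have "of_unit 0 \<le> of_unit (min 1 (2 * curve_coord 0 t))"
    using curve_coord_nonneg[of 0 t] by (subst of_unit_le_iff) (auto intro: order_trans[of _ 0])
  then show ?thesis by (simp add: curve_def)
qed

text \<open>The curve starts at (0,0), on the diagonal. This makes the parameter 0 the place for
  mass that must not be seen in \<open>Delta\<close>.\<close>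

lemma curve_0_notin: "curve 0 \<notin> Delta"
  by (simp add: curve_def curve_coord_0 Delta_def)

lemma curve_curve_section:
  assumes "x \<in> Delta"
  shows "curve (curve_section x) = x"
proof -
  have x: "0 \<le> fst x" "0 \<le> snd x" using assms by (auto simp: Delta_def)
  have b: "0 \<le> to_unit u / 2" "to_unit u / 2 < 1" if "0 \<le> u" for u
    using to_unit_bounds(2)[of u] to_unit_le_iff[of 0 u] that by auto
  have "2 * curve_coord 0 (curve_section x) = to_unit (fst x)"
    "2 * curve_coord 1 (curve_section x) = to_unit (snd x)"
    unfolding curve_section_def using curve_coord_code[OF b[OF x(1)] b[OF x(2)]] by simp_all
  then show ?thesis
    unfolding curve_def by (simp only: min_absorb2[OF to_unit_bounds(2)] of_unit_inverse prod.collapse)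
qed

lemma curve_section_bounds: "0 \<le> curve_section x" "curve_section x \<le> 1/2"
  unfolding curve_section_def by (rule curve_code_bounds)+

section \<open>Vague compactness\<close>

text \<open>Distribution functions of laws on [0,1], known at rationals only and without right
  continuity, so that all conditions are closed under pointwise limits. Countability of the index
  set makes the function space metric.\<close>

definition rat_cdfs :: "(rat \<Rightarrow> real) set" where
  "rat_cdfs = {g. (\<forall>q r. q \<le> r \<longrightarrow> g q \<le> g r) \<and> (\<forall>q. 0 \<le> g q \<and> g q \<le> 1) \<and>
     (\<forall>q<0. g q = 0) \<and> (\<forall>q\<ge>1. g q = 1)}"

lemma compact_rat_cdfs: "compact rat_cdfs"
proof -
  have c: "continuous_on UNIV (\<lambda>g::rat \<Rightarrow> real. g q)" for q by simp
  have "rat_cdfs = (\<Inter>q. \<Inter>r. {g. q \<le> r \<longrightarrow> g q \<le> g r}) \<inter> (\<Inter>q. {g. 0 \<le> g q} \<inter> {g. g q \<le> 1}) \<inter>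
     (\<Inter>q. {g. q < 0 \<longrightarrow> g q = 0}) \<inter> (\<Inter>q. {g. 1 \<le> q \<longrightarrow> g q = 1})"
    by (auto simp: rat_cdfs_def)
  also have "closed \<dots>"
    by (intro closed_Int closed_INT ballI closed_Collect_imp closed_Collect_le closed_Collect_eq c continuous_on_const open_Collect_const)
  finally have "closed rat_cdfs" .
  moreover have "compact (PiE UNIV (\<lambda>_::rat. {0..1::real}))"
    unfolding compactin_euclidean_iff[symmetric] euclidean_product_topology[symmetric] compactin_PiE by simp
  moreover have "rat_cdfs \<subseteq> PiE UNIV (\<lambda>_. {0..1})" by (auto simp: rat_cdfs_def)
  ultimately show ?thesis by (metis closed_Int_compact inf.absorb_iff1)
qed

text \<open>Restores the right continuity that pointwise limits on the rationals may lose.\<close>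

definition right_envelope :: "(rat \<Rightarrow> real) \<Rightarrow> real \<Rightarrow> real" where
  "right_envelope g x = (INF q\<in>{q. x < of_rat q}. g q)"

lemma right_envelope_le:
  assumes "g \<in> rat_cdfs" "x < of_rat q"
  shows "right_envelope g x \<le> g q"
  unfolding right_envelope_def using assms
  by (intro cINF_lower bdd_belowI[of _ 0]) (auto simp: rat_cdfs_def)

lemma right_envelope_ge:
  assumes "\<And>q. x < of_rat q \<Longrightarrow> c \<le> g q"
  shows "c \<le> right_envelope g x"
proof -
  obtain q where "x < of_rat q" using of_rat_dense[of x "x + 1"] by auto
  then show ?thesis unfolding right_envelope_def using assms by (intro cINF_greatest) auto
qed

lemma right_envelope_less:
  assumes "right_envelope g x < c"
  obtains q where "x < of_rat q" "g q < c"
  using right_envelope_ge[of x c g] assms by (metis not_le)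

lemma right_envelope_mono: "g \<in> rat_cdfs \<Longrightarrow> x \<le> y \<Longrightarrow> right_envelope g x \<le> right_envelope g y"
  by (intro right_envelope_ge right_envelope_le) auto

lemma right_envelope_right_continuous:
  assumes g: "g \<in> rat_cdfs"
  shows "continuous (at_right x) (right_envelope g)"
proof (subst continuous_at_right_real_increasing[OF right_envelope_mono[OF g]], assumption, intro allI impI)
  fix e :: real assume "e > 0"
  then obtain q where q: "x < of_rat q" "g q < right_envelope g x + e"
    using right_envelope_less[of g x "right_envelope g x + e"] by auto
  have "right_envelope g (x + (of_rat q - x) / 2) \<le> g q"
    using q by (intro right_envelope_le[OF g]) (simp add: field_simps)
  then show "\<exists>d>0. right_envelope g (x + d) - right_envelope g x < e"
    using q by (intro exI[of _ "(of_rat q - x) / 2"]) auto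
qed

lemma right_envelope_lims:
  assumes g: "g \<in> rat_cdfs"
  shows "(right_envelope g \<longlongrightarrow> 0) at_bot" "(right_envelope g \<longlongrightarrow> 1) at_top"
proof -
  have "right_envelope g x = 0" if neg: "x < 0" for x
  proof (rule antisym)
    obtain q where "x < of_rat q" "of_rat q < (0::real)" using of_rat_dense[OF neg] by auto
    then show "right_envelope g x \<le> 0" using right_envelope_le[OF g, of x q] g by (auto simp: rat_cdfs_def)
    show "0 \<le> right_envelope g x" using g by (intro right_envelope_ge) (auto simp: rat_cdfs_def)
  qed
  then show "(right_envelope g \<longlongrightarrow> 0) at_bot"
    by (intro tendsto_eventually) (auto intro: eventually_mono[OF eventually_gt_at_bot[of 0]])
  have "right_envelope g x = 1" if "1 < x" for x
  proof (rule antisym)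
    obtain q where q: "x < of_rat q" using of_rat_dense[of x "x + 1"] by auto
    then show "right_envelope g x \<le> 1" using right_envelope_le[OF g q] g by (auto simp: rat_cdfs_def intro: order_trans)
    show "1 \<le> right_envelope g x"
    proof (rule right_envelope_ge)
      fix q assume "x < of_rat q"
      then have "(of_rat 1 :: real) \<le> of_rat q" using that unfolding of_rat_1 by linarith
      then have "1 \<le> q" unfolding of_rat_less_eq .
      then show "1 \<le> g q" using g by (auto simp: rat_cdfs_def)
    qed
  qed
  then show "(right_envelope g \<longlongrightarrow> 1) at_top"
    by (intro tendsto_eventually) (auto intro: eventually_mono[OF eventually_gt_at_top[of 1]])
qed

definition rat_law :: "(rat \<Rightarrow> real) \<Rightarrow> real measure" where
  "rat_law g = interval_measure (right_envelope g)"

lemma sets_rat_law [simp, measurable_cong]: "sets (rat_law g) = sets borel"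
  by (simp add: rat_law_def)

lemma rat_law:
  assumes g: "g \<in> rat_cdfs"
  shows "real_distribution (rat_law g)" "cdf (rat_law g) = right_envelope g"
  unfolding rat_law_def using right_envelope_lims[OF g]
  by (auto intro!: real_distribution_interval_measure cdf_interval_measure right_envelope_mono[OF g] right_envelope_right_continuous[OF g])

text \<open>The upper estimate uses one rational to the right of \<open>x\<close>. For the lower
  one, continuity from the left provides a rational below \<open>x\<close> at which \<open>g\<close>
  is still above the threshold.\<close>

lemma right_envelope_converges:
  assumes h: "\<And>n. h n \<in> rat_cdfs" and g: "g \<in> rat_cdfs" and lim: "\<And>q. (\<lambda>n. h n q) \<longlonglongrightarrow> g q"
    and cont: "isCont (right_envelope g) x"
  shows "(\<lambda>n. right_envelope (h n) x) \<longlonglongrightarrow> right_envelope g x"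
proof (rule order_tendstoI)
  fix c assume "right_envelope g x < c"
  then obtain q where q: "x < of_rat q" "g q < c" by (rule right_envelope_less)
  have "\<forall>\<^sub>F n in sequentially. h n q < c" using lim q(2) by (rule order_tendstoD)
  then show "\<forall>\<^sub>F n in sequentially. right_envelope (h n) x < c"
    by eventually_elim (use right_envelope_le[OF h q(1)] in \<open>rule order_le_less_trans\<close>)
next
  fix c assume c: "c < right_envelope g x"
  have "(right_envelope g \<longlongrightarrow> right_envelope g x) (at_left x)"
    using cont by (simp add: isCont_def filterlim_at_split)
  then have "\<forall>\<^sub>F y in at_left x. c < right_envelope g y" using c by (rule order_tendstoD)
  then obtain y where y: "y < x" "c < right_envelope g y"
    by (metis eventually_at_left dense lt_ex)
  obtain q where q: "y < of_rat q" "of_rat q < x" using of_rat_dense[OF y(1)] by auto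
  have "c < g q" using y(2) right_envelope_le[OF g q(1)] by simp
  then have "\<forall>\<^sub>F n in sequentially. c < h n q" using lim by (rule order_tendstoD[rotated])
  then show "\<forall>\<^sub>F n in sequentially. c < right_envelope (h n) x"
  proof eventually_elim
    case (elim n)
    have "h n q \<le> right_envelope (h n) x"
    proof (rule right_envelope_ge)
      fix r assume "x < of_rat r"
      then have "(of_rat q :: real) < of_rat r" using q by simp
      then show "h n q \<le> h n r" using h[of n] by (auto simp: rat_cdfs_def of_rat_less)
    qed
    with elim show ?case by simp
  qed
qed

text \<open>A genuine distribution function is right continuous, hence recovered from its rational
  values; so \<open>rat_law\<close> reaches every law with these tails.\<close>

lemma cdf_rat_restriction:
  assumes nu: "real_distribution \<nu>" and "\<And>x. x < 0 \<Longrightarrow> cdf \<nu> x = 0" "\<And>x. 1 \<le> x \<Longrightarrow> cdf \<nu> x = 1"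
  shows "(\<lambda>q. cdf \<nu> (of_rat q)) \<in> rat_cdfs" "rat_law (\<lambda>q. cdf \<nu> (of_rat q)) = \<nu>"
proof -
  interpret real_distribution \<nu> by fact
  let ?g = "\<lambda>q. cdf \<nu> (of_rat q)"
  show g: "?g \<in> rat_cdfs"
    unfolding rat_cdfs_def using assms(2,3) cdf_nonneg cdf_bounded_prob
    by (auto intro!: cdf_nondecreasing simp: of_rat_less_eq)
  have "right_envelope ?g = cdf \<nu>"
  proof (rule ext, rule antisym)
    fix x
    show "cdf \<nu> x \<le> right_envelope ?g x" by (intro right_envelope_ge cdf_nondecreasing) simp
    show "right_envelope ?g x \<le> cdf \<nu> x"
    proof (rule field_le_epsilon)
      fix e :: real assume "0 < e"
      then obtain d where d: "d > 0" "cdf \<nu> (x + d) - cdf \<nu> x < e"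
        using iffD1[OF continuous_at_right_real_increasing cdf_is_right_cont[of x]] cdf_nondecreasing by meson
      obtain q where q: "x < of_rat q" "of_rat q < x + d" using of_rat_dense[of x "x + d"] d by auto
      have "right_envelope ?g x \<le> cdf \<nu> (of_rat q)" by (rule right_envelope_le[OF g q(1)])
      also have "\<dots> \<le> cdf \<nu> (x + d)" using q by (intro cdf_nondecreasing) simp
      finally show "right_envelope ?g x \<le> cdf \<nu> x + e" using d by simp
    qed
  qed
  then show "rat_law ?g = \<nu>" using rat_law[OF g] by (intro cdf_unique nu) simp_all
qed

text \<open>Whatever the curve carries outside \<open>Delta\<close> is discarded, so laws of mass
  one also produce measures of total mass below \<open>K\<close>.\<close>

definition Delta_of_law :: "real \<Rightarrow> real measure \<Rightarrow> (ereal \<times> ereal) measure" where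
  "Delta_of_law K \<nu> = density (restrict_space (distr \<nu> borel curve) Delta) (\<lambda>_. ennreal K)"

lemma sets_Delta_of_law [simp]: "sets (Delta_of_law K \<nu>) = sets (restrict_space borel Delta)"
  by (simp add: Delta_of_law_def sets_restrict_space)

lemma emeasure_Delta_of_law:
  assumes [measurable_cong]: "sets \<nu> = sets borel" and A: "A \<in> sets (restrict_space borel Delta)"
  shows "emeasure (Delta_of_law K \<nu>) A = ennreal K * emeasure \<nu> (curve -` A)"
proof -
  have A': "A \<subseteq> Delta" "A \<in> sets borel" using A by (auto simp: sets_restrict_space_iff)
  have sp: "space \<nu> = UNIV" using sets_eq_imp_space_eq[OF assms(1)] by simp
  have "emeasure (Delta_of_law K \<nu>) A = ennreal K * emeasure (restrict_space (distr \<nu> borel curve) Delta) A"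
    unfolding Delta_of_law_def using A by (intro emeasure_density_const) (simp add: sets_restrict_space)
  also have "emeasure (restrict_space (distr \<nu> borel curve) Delta) A = emeasure (distr \<nu> borel curve) A"
    using A' by (intro emeasure_restrict_space) auto
  also have "\<dots> = emeasure \<nu> (curve -` A)"
    using A' by (subst emeasure_distr) (auto simp: sp)
  finally show ?thesis .
qed

lemma Delta_of_law_mass_le:
  assumes nu: "real_distribution \<nu>"
  shows "Delta_of_law K \<nu> \<in> mass_le K"
proof -
  interpret real_distribution \<nu> by fact
  have D: "emeasure (Delta_of_law K \<nu>) Delta \<le> ennreal K"
  proof -
    have "emeasure (Delta_of_law K \<nu>) Delta = ennreal K * emeasure \<nu> (curve -` Delta)"
      by (intro emeasure_Delta_of_law) (simp_all add: sets_restrict_space_iff)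
    also have "\<dots> \<le> ennreal K * 1" by (intro mult_left_mono emeasure_le_1) simp
    finally show ?thesis by simp
  qed
  have "Delta_of_law K \<nu> \<in> Radon_Delta"
    unfolding Radon_Delta_def
  proof (intro CollectI conjI allI impI)
    fix C assume C: "compact C \<and> C \<subseteq> Delta"
    have "emeasure (Delta_of_law K \<nu>) C \<le> emeasure (Delta_of_law K \<nu>) Delta"
      using C by (intro emeasure_mono) (simp_all add: sets_restrict_space_iff)
    also note D
    finally show "emeasure (Delta_of_law K \<nu>) C < \<infinity>" by (rule order_le_less_trans) simp
  qed simp
  with D show ?thesis by (simp add: mass_le_def)
qed

text \<open>The function is continuous on the open set of parameters mapped into
  \<open>Delta\<close> and vanishes on the open set of those mapped off its support; the two cover
  the line. The first is open, although \<open>Delta\<close> is not open in the square of the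
  extended reals, because the curve never leaves nonnegative abscissas.\<close>

lemma Cc_curve:
  assumes f: "f \<in> Cc_Delta"
  shows "continuous_on UNIV (\<lambda>t. indicator Delta (curve t) * f (curve t))"
    "\<exists>B. \<forall>t. \<bar>indicator Delta (curve t) * f (curve t)\<bar> \<le> B"
proof -
  obtain C where C: "compact C" "C \<subseteq> Delta" "\<And>x. x \<in> Delta - C \<Longrightarrow> f x = 0" and cf: "continuous_on Delta f"
    using f by (auto simp: Cc_Delta_def)
  let ?h = "\<lambda>t. indicator Delta (curve t) * f (curve t)"
  let ?U = "{t. fst (curve t) < snd (curve t)}"
  let ?V = "- (curve -` C)"
  have U: "?U = {t. curve t \<in> Delta}" using curve_nonneg by (auto simp: Delta_def split_beta)
  have oU: "open ?U" by (intro open_Collect_less continuous_intros continuous_on_curve)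
  have oV: "open ?V"
    using closed_vimage[OF compact_imp_closed[OF C(1)] continuous_on_curve[of UNIV]] by (simp add: open_Compl)
  have "continuous_on ?U (\<lambda>t. f (curve t))"
    by (intro continuous_on_compose2[OF cf] continuous_on_curve) (auto simp: U)
  then have cU: "continuous_on ?U ?h" by (rule continuous_on_eq) (auto simp: U)
  have "?h t = 0" if "t \<in> ?V" for t using C(3)[of "curve t"] that by (auto simp: indicator_def)
  then have cV: "continuous_on ?V ?h" by (intro continuous_on_eq[OF continuous_on_const[of _ 0]]) auto
  have "?U \<union> ?V = UNIV" unfolding U using C(2) by auto
  then show "continuous_on UNIV ?h" using continuous_on_open_Un[OF oU oV cU cV] by simp
  obtain b K' where b: "0 \<le> b" "\<And>x. x \<in> Delta \<Longrightarrow> \<bar>f x\<bar> \<le> b * indicator K' x" using Cc_bounded[OF f] by metis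
  have "\<bar>?h t\<bar> \<le> b" for t
    using b(1) b(2)[of "curve t"] by (cases "curve t \<in> Delta"; cases "curve t \<in> K'") auto
  then show "\<exists>B. \<forall>t. \<bar>?h t\<bar> \<le> B" by blast
qed

lemma integral_Delta_of_law:
  assumes [measurable_cong]: "sets \<nu> = sets borel" and f: "f \<in> Cc_Delta" and K: "0 \<le> K"
  shows "(\<integral>x. f x \<partial>Delta_of_law K \<nu>) = K * (\<integral>t. indicator Delta (curve t) * f (curve t) \<partial>\<nu>)"
proof -
  let ?R = "restrict_space (distr \<nu> borel curve) Delta"
  have fm: "f \<in> borel_measurable ?R"
    using Cc_borel_measurable[OF f] measurable_cong_sets[of ?R "restrict_space borel Delta"]
    by (simp add: sets_restrict_space)
  have fm': "(\<lambda>x. indicator Delta x *\<^sub>R f x) \<in> borel_measurable borel"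
    using Cc_borel_measurable[OF f] by (subst (asm) borel_measurable_restrict_space_iff) simp_all
  have "(\<integral>x. f x \<partial>Delta_of_law K \<nu>) = (\<integral>x. K *\<^sub>R f x \<partial>?R)"
    unfolding Delta_of_law_def using fm K by (intro integral_density) auto
  also have "\<dots> = K * (\<integral>x. f x \<partial>?R)" by simp
  also have "(\<integral>x. f x \<partial>?R) = (\<integral>x. indicator Delta x *\<^sub>R f x \<partial>distr \<nu> borel curve)"
    by (intro integral_restrict_space) simp
  also have "\<dots> = (\<integral>t. indicator Delta (curve t) * f (curve t) \<partial>\<nu>)"
    using fm' by (subst integral_distr) auto
  finally show ?thesis .
qed

text \<open>Push the measure to the line by \<open>curve_section\<close>, divide by
  \<open>K\<close>, and put the missing probability \<open>1 - m / K\<close> at 0.\<close>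

lemma mass_le_law:
  assumes xi: "\<xi> \<in> mass_le K" and K: "K > 0"
  obtains \<nu> where "real_distribution \<nu>" "\<And>x. x < 0 \<Longrightarrow> cdf \<nu> x = 0" "\<And>x. 1 \<le> x \<Longrightarrow> cdf \<nu> x = 1"
    "Delta_of_law K \<nu> = \<xi>"
proof -
  have R: "\<xi> \<in> Radon_Delta" and le: "emeasure \<xi> Delta \<le> ennreal K" using xi by (auto simp: mass_le_def)
  have sec: "curve_section \<in> measurable \<xi> borel"
    using measurable_restrict_space1[OF borel_measurable_curve_section] by (rule Radon_measurable[OF R])
  define m where "m = measure \<xi> Delta"
  have em: "emeasure \<xi> Delta = ennreal m"
    unfolding m_def using le by (intro emeasure_eq_ennreal_measure) (auto simp: top_unique)
  have m: "0 \<le> m" "m \<le> K" using le K unfolding em by (auto simp: m_def)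
  define \<nu>1 where "\<nu>1 = density (distr \<xi> borel curve_section) (\<lambda>_. ennreal (1 / K))"
  define \<nu>2 where "\<nu>2 = density (return borel (0::real)) (\<lambda>_. ennreal (1 - m / K))"
  define \<nu> where "\<nu> = add_measure \<nu>1 \<nu>2"
  have s: "sets \<nu>1 = sets borel" "sets \<nu>2 = sets borel" by (simp_all add: \<nu>1_def \<nu>2_def)
  have emN: "emeasure \<nu> A = ennreal (1 / K) * emeasure \<xi> (curve_section -` A \<inter> Delta) + ennreal (1 - m / K) * indicator A 0"
    if "A \<in> sets borel" for A
    unfolding \<nu>_def using that s
    by (simp add: emeasure_add_measure \<nu>1_def \<nu>2_def emeasure_density_const emeasure_distr[OF sec] Radon_space[OF R])
  have sN: "sets \<nu> = sets borel" by (simp add: \<nu>_def s)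
  have one: "emeasure \<nu> A = 1" if A: "A \<in> sets borel" "{0..1/2} \<subseteq> A" for A
  proof -
    have "curve_section -` A \<inter> Delta = Delta" using subsetD[OF A(2)] curve_section_bounds by auto
    moreover have "0 \<in> A" using A by auto
    ultimately have "emeasure \<nu> A = ennreal (1 / K) * ennreal m + ennreal (1 - m / K)"
      using emN[OF A(1)] by (simp add: em)
    also have "\<dots> = ennreal (1 / K * m + (1 - m / K))"
      using m K by (simp add: ennreal_mult[symmetric] ennreal_plus[symmetric] del: ennreal_plus)
    finally show ?thesis using K by simp
  qed
  have spN: "space \<nu> = UNIV" using sets_eq_imp_space_eq[OF sN] by simp
  interpret prob_space \<nu> by (rule prob_spaceI) (simp add: spN one)
  have rd: "real_distribution \<nu>" by unfold_locales (simp_all add: sN spN)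
  show ?thesis
  proof
    show "real_distribution \<nu>" by (rule rd)
    show "cdf \<nu> x = 1" if "1 \<le> x" for x
    proof -
      have "emeasure \<nu> {..x} = 1" using that by (intro one) auto
      then show ?thesis by (simp add: cdf_def measure_def)
    qed
    show "cdf \<nu> x = 0" if "x < 0" for x
    proof -
      have "\<not> curve_section y \<le> x" for y using curve_section_bounds(1)[of y] that by linarith
      then have "curve_section -` {..x} \<inter> Delta = {}" by auto
      then have "emeasure \<nu> {..x} = 0" using that by (subst emN) auto
      then show ?thesis by (simp add: cdf_def measure_def)
    qed
    show "Delta_of_law K \<nu> = \<xi>"
    proof (rule measure_eqI)
      show "sets (Delta_of_law K \<nu>) = sets \<xi>" by (simp add: Radon_sets[OF R])
      fix A assume "A \<in> sets (Delta_of_law K \<nu>)"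
      then have A: "A \<in> sets (restrict_space borel Delta)" by simp
      then have A': "A \<subseteq> Delta" "A \<in> sets borel" by (auto simp: sets_restrict_space_iff)
      have cA: "curve -` A \<in> sets borel" using measurable_sets[OF borel_measurable_curve A'(2)] by simp
      \<comment> \<open>The right inverse undoes the curve on \<open>Delta\<close>, and the point
        mass at 0 does not contribute because its image lies outside \<open>A\<close>.\<close>
      have "curve_section -` (curve -` A) \<inter> Delta = A" using A'(1) curve_curve_section by auto
      moreover have "curve 0 \<notin> A" using curve_0_notin A' by blast
      ultimately have "emeasure \<nu> (curve -` A) = ennreal (1 / K) * emeasure \<xi> A"
        using emN[OF cA] by simp
      then have "emeasure (Delta_of_law K \<nu>) A = ennreal K * (ennreal (1 / K) * emeasure \<xi> A)"
        using emeasure_Delta_of_law[OF sN A] by simp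
      also have "\<dots> = ennreal (K * (1 / K)) * emeasure \<xi> A"
        using K by (subst ennreal_mult) (auto simp: mult.assoc)
      finally show "emeasure (Delta_of_law K \<nu>) A = emeasure \<xi> A" using K by simp
    qed
  qed
qed

text \<open>The set is the image of the compact set \<open>rat_cdfs\<close>. Pointwise convergence
  on rationals gives weak convergence of the laws, and by \<open>Cc_curve\<close> a vague test
  function pulled back along the curve is bounded and continuous.\<close>

theorem compactin_mass_le:
  assumes K: "K > 0"
  shows "compactin vague_topology (mass_le K)"
proof -
  let ?B = "{{\<xi> \<in> Radon_Delta. (\<integral>x. f x \<partial>\<xi>) \<in> U} | f U. f \<in> Cc_Delta \<and> open U}"
  let ?h = "\<lambda>f t. indicator Delta (curve t) * f (curve t)"
  let ?T = "\<lambda>g. Delta_of_law K (rat_law g)"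
  have "mass_le K = ?T ` rat_cdfs"
  proof
    show "?T ` rat_cdfs \<subseteq> mass_le K" using Delta_of_law_mass_le rat_law by auto
    show "mass_le K \<subseteq> ?T ` rat_cdfs"
    proof
      fix \<xi> assume "\<xi> \<in> mass_le K"
      then obtain \<nu> where "real_distribution \<nu>" "\<And>x. x < 0 \<Longrightarrow> cdf \<nu> x = 0" "\<And>x. 1 \<le> x \<Longrightarrow> cdf \<nu> x = 1"
        "Delta_of_law K \<nu> = \<xi>" using mass_le_law[OF _ K] by blast
      then show "\<xi> \<in> ?T ` rat_cdfs" using cdf_rat_restriction[of \<nu>] by (metis imageI)
    qed
  qed
  moreover have "continuous_map (top_of_set rat_cdfs) vague_topology ?T"
    unfolding vague_topology_def
  proof (rule continuous_on_generated_topo)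
    show "?T ` topspace (top_of_set rat_cdfs) \<subseteq> \<Union>?B"
    proof -
      have "\<Union>?B = Radon_Delta"
        using topspace_vague unfolding vague_topology_def topology_generated_by_topspace .
      then show ?thesis using calculation by (auto simp: mass_le_def)
    qed
    fix B assume "B \<in> ?B"
    then obtain f U where B: "B = {\<xi> \<in> Radon_Delta. (\<integral>x. f x \<partial>\<xi>) \<in> U}" and f: "f \<in> Cc_Delta" and U: "open U" by blast
    have "continuous_on rat_cdfs (\<lambda>g. \<integral>x. f x \<partial>?T g)"
      \<comment> \<open>Sequences suffice on the metric side; nothing is claimed about sequences in
        the vague topology.\<close>
      unfolding continuous_on_sequentially
    proof (intro allI ballI impI)
      fix h g assume g: "g \<in> rat_cdfs" and "(\<forall>n. h n \<in> rat_cdfs) \<and> h \<longlonglongrightarrow> g"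
      then have h: "\<And>n. h n \<in> rat_cdfs" and lim: "h \<longlonglongrightarrow> g" by auto
      have limq: "(\<lambda>n. h n q) \<longlonglongrightarrow> g q" for q
        using continuous_on_tendsto_compose[OF continuous_on_product_coordinates[of q] lim] by simp
      have weak: "weak_conv_m (\<lambda>n. rat_law (h n)) (rat_law g)"
        unfolding weak_conv_m_def weak_conv_def using rat_law(2) h g right_envelope_converges[OF h g limq] by simp
      obtain C where C: "\<And>t. \<bar>?h f t\<bar> \<le> C" using Cc_curve(2)[OF f] by blast
      have "(\<lambda>n. \<integral>t. ?h f t \<partial>rat_law (h n)) \<longlonglongrightarrow>
          (\<integral>t. ?h f t \<partial>rat_law g)"
        using Cc_curve(1)[OF f] C
        by (intro weak_conv_imp_integral_bdd_continuous_conv[where B=C] rat_law(1) h g weak)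
          (auto simp: continuous_on_eq_continuous_at)
      then show "((\<lambda>g. \<integral>x. f x \<partial>?T g) \<circ> h) \<longlonglongrightarrow> (\<integral>x. f x \<partial>?T g)"
        using K by (simp add: o_def integral_Delta_of_law[OF sets_rat_law f] tendsto_mult_left)
    qed
    then have "openin (top_of_set rat_cdfs) (rat_cdfs \<inter> (\<lambda>g. \<integral>x. f x \<partial>?T g) -` U)"
      using U by (rule continuous_openin_preimage_gen)
    moreover have "?T -` B \<inter> topspace (top_of_set rat_cdfs) = rat_cdfs \<inter> (\<lambda>g. \<integral>x. f x \<partial>?T g) -` U"
      using \<open>mass_le K = ?T ` rat_cdfs\<close> unfolding B by (auto simp: mass_le_def)
    ultimately show "openin (top_of_set rat_cdfs) (?T -` B \<inter> topspace (top_of_set rat_cdfs))" by simp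
  qed
  moreover have "compactin (top_of_set rat_cdfs) rat_cdfs"
    using compact_rat_cdfs by (simp add: compactin_subtopology)
  ultimately show ?thesis using image_compactin by metis
qed

section \<open>The large deviation principle\<close>

lemma Cc_add:
  assumes "f \<in> Cc_Delta" "g \<in> Cc_Delta"
  shows "(\<lambda>x. f x + g x) \<in> Cc_Delta"
proof -
  obtain K K' where K: "compact K" "K \<subseteq> Delta" "\<And>x. x \<in> Delta - K \<Longrightarrow> f x = 0" "continuous_on Delta f"
    and K': "compact K'" "K' \<subseteq> Delta" "\<And>x. x \<in> Delta - K' \<Longrightarrow> g x = 0" "continuous_on Delta g"
    using assms by (auto simp: Cc_Delta_def)
  show ?thesis
    by (rule Cc_Delta_I[of _ "K \<union> K'"])
      (use K K' in \<open>auto intro!: continuous_intros closed_Un compact_imp_closed\<close>)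
qed

lemma Cc_cmult: "f \<in> Cc_Delta \<Longrightarrow> (\<lambda>x. c * f x) \<in> Cc_Delta"
  by (auto simp: Cc_Delta_def intro!: continuous_intros)

lemma Cc_sum: "(\<And>i. i < k \<Longrightarrow> f i \<in> Cc_Delta) \<Longrightarrow> (\<lambda>x. \<Sum>i<(k::nat). f i x) \<in> Cc_Delta"
  by (induction k) (auto simp: Cc_zero intro!: Cc_add)

lemma Cc_integral_bound:
  assumes f: "f \<in> Cc_Delta"
  obtains b where "0 < b" "\<And>\<xi>. \<xi> \<in> Radon_Delta \<Longrightarrow> emeasure \<xi> Delta \<noteq> \<infinity> \<Longrightarrow> \<bar>\<integral>x. f x \<partial>\<xi>\<bar> \<le> b * measure \<xi> Delta"
proof -
  obtain b K where b: "0 \<le> b" "compact K" "K \<subseteq> Delta" "\<And>x. x \<in> Delta \<Longrightarrow> \<bar>f x\<bar> \<le> b * indicator K x"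
    using Cc_bounded[OF f] by blast
  \<comment> \<open>The added 1 makes the constant positive, as the exponential moments are assumed
    for positive parameters.\<close>
  have "\<bar>\<integral>x. f x \<partial>\<xi>\<bar> \<le> (b + 1) * measure \<xi> Delta" if xi: "\<xi> \<in> Radon_Delta" and fin: "emeasure \<xi> Delta \<noteq> \<infinity>" for \<xi>
  proof -
    interpret finite_measure \<xi> by (rule finite_measureI) (use fin Radon_space[OF xi] in simp)
    have int: "integrable \<xi> (\<lambda>x. \<bar>f x\<bar>)" using Cc_integrable[OF xi f] by simp
    have "\<bar>\<integral>x. f x \<partial>\<xi>\<bar> \<le> (\<integral>x. \<bar>f x\<bar> \<partial>\<xi>)" by (rule integral_abs_bound)
    also have "\<dots> \<le> (\<integral>x. b + 1 \<partial>\<xi>)"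
    proof (rule integral_mono[OF int])
      fix x assume "x \<in> space \<xi>"
      then have "\<bar>f x\<bar> \<le> b * indicator K x" using b(4) Radon_space[OF xi] by simp
      then show "\<bar>f x\<bar> \<le> b + 1" using b(1) by (cases "x \<in> K") auto
    qed simp
    also have "\<dots> = (b + 1) * measure \<xi> Delta" by (simp add: Radon_space[OF xi] mult.commute)
    finally show ?thesis .
  qed
  with b(1) show ?thesis by (intro that[of "b + 1"]) auto
qed

section \<open>Convex combinations of Radon measures\<close>

definition mix :: "real \<Rightarrow> 'a measure \<Rightarrow> 'a measure \<Rightarrow> 'a measure" where
  "mix u M N = add_measure (density M (\<lambda>_. ennreal u)) (density N (\<lambda>_. ennreal (1 - u)))"

context
  fixes \<mu> \<nu> :: "(ereal \<times> ereal) measure" and u :: real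
  assumes mu: "\<mu> \<in> Radon_Delta" and nu: "\<nu> \<in> Radon_Delta" and u: "0 \<le> u" "u \<le> 1"
begin

lemma emeasure_mix:
  assumes A: "A \<in> sets (restrict_space borel Delta)"
  shows "emeasure (mix u \<mu> \<nu>) A = ennreal u * emeasure \<mu> A + ennreal (1 - u) * emeasure \<nu> A"
  unfolding mix_def using A Radon_sets[OF mu] Radon_sets[OF nu]
  by (subst emeasure_add_measure) (simp_all add: emeasure_density_const)

lemma mix_Radon: "mix u \<mu> \<nu> \<in> Radon_Delta"
  unfolding Radon_Delta_def
proof (intro CollectI conjI allI impI)
  show "sets (mix u \<mu> \<nu>) = sets (restrict_space borel Delta)" by (simp add: mix_def Radon_sets[OF mu])
  fix K assume K: "compact K \<and> K \<subseteq> Delta"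
  then have "K \<in> sets (restrict_space borel Delta)" by (simp add: sets_restrict_space_iff borel_compact)
  then have "emeasure (mix u \<mu> \<nu>) K = ennreal u * emeasure \<mu> K + ennreal (1 - u) * emeasure \<nu> K" by (rule emeasure_mix)
  also have "\<dots> < \<infinity>"
    using Radon_emeasure_compact(1)[OF mu] Radon_emeasure_compact(1)[OF nu] K by (simp add: ennreal_mult_less_top)
  finally show "emeasure (mix u \<mu> \<nu>) K < \<infinity>" .
qed

lemma box_mass_mix:
  assumes "fst p < snd p"
  shows "box_mass (mix u \<mu> \<nu>) p = u * box_mass \<mu> p + (1 - u) * box_mass \<nu> p"
proof -
  have "box_set (fst p) (snd p) \<in> sets (restrict_space borel Delta)"
    using Radon_box(1)[OF mu assms] Radon_sets[OF mu] by simp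
  then have "emeasure (mix u \<mu> \<nu>) (box_set (fst p) (snd p)) = ennreal u * ennreal (box_mass \<mu> p) + ennreal (1 - u) * ennreal (box_mass \<nu> p)"
    using Radon_box(4)[OF mu assms] Radon_box(4)[OF nu assms] by (simp add: emeasure_mix emeasure_eq_ennreal_measure)
  also have "\<dots> = ennreal (u * box_mass \<mu> p + (1 - u) * box_mass \<nu> p)"
    using u by (simp add: ennreal_mult ennreal_plus)
  finally show ?thesis
    using u by (intro measure_eq_emeasure_eq_ennreal add_nonneg_nonneg mult_nonneg_nonneg) auto
qed

lemma integral_mix:
  assumes f: "f \<in> Cc_Delta"
  shows "(\<integral>x. f x \<partial>mix u \<mu> \<nu>) = u * (\<integral>x. f x \<partial>\<mu>) + (1 - u) * (\<integral>x. f x \<partial>\<nu>)"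
proof -
  have i: "integrable \<mu> f" "integrable \<nu> f" using Cc_integrable mu nu f by auto
  then have m: "f \<in> borel_measurable \<mu>" "f \<in> borel_measurable \<nu>" by auto
  have "integrable (density \<mu> (\<lambda>_. ennreal u)) f" "integrable (density \<nu> (\<lambda>_. ennreal (1 - u))) f"
    using i m u by (subst integrable_density; simp)+
  then have "(\<integral>x. f x \<partial>mix u \<mu> \<nu>) = (\<integral>x. f x \<partial>density \<mu> (\<lambda>_. ennreal u)) + (\<integral>x. f x \<partial>density \<nu> (\<lambda>_. ennreal (1 - u)))"
    unfolding mix_def using Radon_sets[OF mu] Radon_sets[OF nu] by (intro integral_add_measure) auto
  also have "\<dots> = u * (\<integral>x. f x \<partial>\<mu>) + (1 - u) * (\<integral>x. f x \<partial>\<nu>)"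
    using m u by (simp add: integral_density)
  finally show ?thesis .
qed

end

text \<open>\<open>box_nbhd\<close> for vectors indexed by a list of corners. The closed form meets
  the finite-dimensional upper bound, the open form below the lower bound.\<close>

definition fd_closed :: "(real \<times> real) list \<Rightarrow> real \<Rightarrow> (ereal \<times> ereal) measure \<Rightarrow> (nat \<Rightarrow> real) set" where
  "fd_closed P d \<mu> = {x \<in> topspace (Rh_topology (length P)). \<forall>i<length P. \<forall>j<length P. nested (P ! i) (P ! j) \<longrightarrow>
     x i \<le> box_mass \<mu> (P ! j) + d \<and> box_mass \<mu> (P ! i) - d \<le> x j}"

definition fd_open :: "(real \<times> real) list \<Rightarrow> real \<Rightarrow> (ereal \<times> ereal) measure \<Rightarrow> (nat \<Rightarrow> real) set" where
  "fd_open P d \<mu> = {x \<in> topspace (Rh_topology (length P)). \<forall>i<length P. \<forall>j<length P. nested (P ! i) (P ! j) \<longrightarrow>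
     x i < box_mass \<mu> (P ! j) + d \<and> box_mass \<mu> (P ! i) - d < x j}"

lemma continuous_map_Rh_coordinate:
  "i < h \<Longrightarrow> continuous_map (Rh_topology h) euclideanreal (\<lambda>x. x i)"
  by (rule continuous_map_product_projection) simp

lemma closedin_fd_closed: "closedin (Rh_topology (length P)) (fd_closed P d \<mu>)"
proof -
  let ?X = "Rh_topology (length P)" and ?I = "{(i, j). i < length P \<and> j < length P \<and> nested (P ! i) (P ! j)}"
  define A where "A i j = {x \<in> topspace ?X. x i \<in> {..box_mass \<mu> (P ! j) + d}} \<inter>
      {x \<in> topspace ?X. x j \<in> {box_mass \<mu> (P ! i) - d..}}" for i j
  have A: "closedin ?X (A i j)" if "i < length P" "j < length P" for i j
    unfolding A_def using that
    by (intro closedin_Int closedin_continuous_map_preimage[OF continuous_map_Rh_coordinate]) auto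
  define T where "T = topspace ?X"
  have "x \<in> A i j \<longleftrightarrow> x \<in> T \<and> x i \<le> box_mass \<mu> (P ! j) + d \<and> box_mass \<mu> (P ! i) - d \<le> x j" for x i j
    unfolding A_def T_def[symmetric] by auto
  then have "fd_closed P d \<mu> = T \<inter> (\<Inter>ij\<in>?I. A (fst ij) (snd ij))"
    unfolding fd_closed_def T_def[symmetric] by (intro set_eqI) (simp, blast)
  moreover have "closedin ?X (T \<inter> (\<Inter>ij\<in>?I. A (fst ij) (snd ij)))"
  proof (cases "?I = {}")
    case False
    have "closedin ?X (\<Inter>ij\<in>?I. A (fst ij) (snd ij))" using A by (intro closedin_INT[OF False]) auto
    then show ?thesis unfolding T_def by (intro closedin_Int closedin_topspace)
  qed (simp only: T_def INT_empty Int_UNIV_right closedin_topspace)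
  ultimately show ?thesis by simp
qed

lemma openin_fd_open: "openin (Rh_topology (length P)) (fd_open P d \<mu>)"
proof -
  let ?X = "Rh_topology (length P)" and ?I = "{(i, j). i < length P \<and> j < length P \<and> nested (P ! i) (P ! j)}"
  define A where "A i j = {x \<in> topspace ?X. x i \<in> {..<box_mass \<mu> (P ! j) + d}} \<inter>
      {x \<in> topspace ?X. x j \<in> {box_mass \<mu> (P ! i) - d<..}}" for i j
  have A: "openin ?X (A i j)" if "i < length P" "j < length P" for i j
    unfolding A_def using that
    by (intro openin_Int openin_continuous_map_preimage[OF continuous_map_Rh_coordinate]) auto
  have fin: "finite ?I" by (rule finite_subset[of _ "{..<length P} \<times> {..<length P}"]) auto
  define T where "T = topspace ?X"
  have "x \<in> A i j \<longleftrightarrow> x \<in> T \<and> x i < box_mass \<mu> (P ! j) + d \<and> box_mass \<mu> (P ! i) - d < x j" for x i j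
    unfolding A_def T_def[symmetric] by auto
  then have "fd_open P d \<mu> = T \<inter> (\<Inter>ij\<in>?I. A (fst ij) (snd ij))"
    unfolding fd_open_def T_def[symmetric] by (intro set_eqI) (simp, blast)
  moreover have "openin ?X (T \<inter> (\<Inter>ij\<in>?I. A (fst ij) (snd ij)))"
  proof (cases "?I = {}")
    case False
    have "openin ?X (\<Inter>ij\<in>?I. A (fst ij) (snd ij))" using A False fin by (intro openin_Inter) auto
    then show ?thesis unfolding T_def by (intro openin_Int openin_topspace)
  qed (simp only: T_def INT_empty Int_UNIV_right openin_topspace)
  ultimately show ?thesis by simp
qed

lemma fd_closedD:
  assumes "x \<in> fd_closed P d \<mu>" "i < length P" "j < length P" "nested (P ! i) (P ! j)"
  shows "x i \<le> box_mass \<mu> (P ! j) + d" "box_mass \<mu> (P ! i) - d \<le> x j"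
  using assms unfolding fd_closed_def by blast+

lemma fd_closed_subset_open: "d < d' \<Longrightarrow> fd_closed P d \<mu> \<subseteq> fd_open P d' \<mu>"
  unfolding fd_closed_def fd_open_def by fastforce

lemma fd_open_subset_closed: "fd_open P d \<mu> \<subseteq> fd_closed P d \<mu>"
  unfolding fd_closed_def fd_open_def by (auto simp: less_imp_le)

lemma fd_vector_in_closed: "fd_vector P \<xi> \<in> fd_closed P d \<mu> \<longleftrightarrow> box_mass \<xi> \<in> box_nbhd (set P) d \<mu>"
proof -
  have "fd_vector P \<xi> \<in> topspace (Rh_topology (length P))" by (simp add: fd_vector_def)
  then show ?thesis
    by (simp add: fd_closed_def box_nbhd_def fd_vector_def all_set_conv_all_nth)
qed

section \<open>Transfer of the finite-dimensional principles to the vague topology\<close>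

locale box_LDP = random_process a vague_topology M \<xi>
  for a :: "nat \<Rightarrow> real" and M :: "nat \<Rightarrow> 'w measure" and \<xi> :: "nat \<Rightarrow> 'w \<Rightarrow> (ereal \<times> ereal) measure" +
  fixes IP :: "(real \<times> real) list \<Rightarrow> (nat \<Rightarrow> real) \<Rightarrow> ereal"
  assumes expmom: "\<And>lam::real. lam > 0 \<Longrightarrow>
        \<exists>C::real. \<forall>n. ereal (1 / a n) * lnEnn (exp_total_mass (M n) (\<xi> n) (a n * lam)) \<le> ereal C"
    and fdLDP: "\<And>P. admissible_family P \<Longrightarrow>
        good_rate_function (Rh_topology (length P)) (IP P) \<and>
        LDP (Rh_topology (length P)) M (\<lambda>n \<omega>. fd_vector P (\<xi> n \<omega>)) a (IP P)"
begin

definition fd_pr :: "(real \<times> real) list \<Rightarrow> (nat \<Rightarrow> real) set \<Rightarrow> nat \<Rightarrow> real" where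
  "fd_pr P A n = measure (M n) {\<omega> \<in> space (M n). fd_vector P (\<xi> n \<omega>) \<in> A}"

lemma xi_Radon: "\<omega> \<in> space (M n) \<Longrightarrow> \<xi> n \<omega> \<in> Radon_Delta"
  using Y_in by simp

lemma fd_upper:
  "admissible_family P \<Longrightarrow> closedin (Rh_topology (length P)) C \<Longrightarrow> upper_rate (fd_pr P C) \<le> - (INF x\<in>C. IP P x)"
  using fdLDP[of P] by (simp add: LDP_def upper_rate_def log_rate_def fd_pr_def)

lemma fd_lower:
  "admissible_family P \<Longrightarrow> openin (Rh_topology (length P)) G \<Longrightarrow> - (INF x\<in>G. IP P x) \<le> lower_rate (fd_pr P G)"
  using fdLDP[of P] by (simp add: LDP_def lower_rate_def log_rate_def fd_pr_def)

lemma exp_total_mass_bound: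
  assumes "lam > 0"
  obtains C where "\<And>n. exp_total_mass (M n) (\<xi> n) (a n * lam) \<le> ennreal (exp (a n * C))"
  using expmom[OF assms] scaled_lnEnn_leD[OF a_pos] by metis

text \<open>Exponential Markov inequality with parameter 1. Infinite total mass causes no trouble,
  since the integrand of \<open>exp_total_mass\<close> is infinite there.\<close>

lemma exponential_tightness:
  obtains K where "K > 0" "upper_rate (pr (topspace vague_topology - mass_le K)) \<le> ereal (- m)"
proof -
  obtain C where C: "\<And>n. exp_total_mass (M n) (\<xi> n) (a n * 1) \<le> ennreal (exp (a n * C))"
    using exp_total_mass_bound[of 1] by auto
  \<comment> \<open>Markov gives \<open>exp (a n * (C - K))\<close>, so \<open>C - K\<close> has to
    be at most \<open>- m\<close>; the 1 makes \<open>K\<close> positive.\<close>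
  define K where "K = \<bar>C\<bar> + \<bar>m\<bar> + 1"
  have K: "K > 0" "C - K \<le> - m" by (auto simp: K_def)
  let ?A = "topspace vague_topology - mass_le K"
  have A: "?A \<in> sets (borel_of vague_topology)" using K(1) by (intro mass_gt_borel) simp
  have "pr ?A n \<le> exp (a n * (- m))" for n
  proof -
    let ?B = "{\<omega> \<in> space (M n). \<xi> n \<omega> \<in> ?A}"
    have "ennreal (exp (a n * K)) * emeasure (M n) ?B = (\<integral>\<^sup>+\<omega>. ennreal (exp (a n * K)) * indicator ?B \<omega> \<partial>M n)"
      using event_sets[OF A, of n] by (rule nn_integral_cmult_indicator[symmetric])
    also have "\<dots> \<le> exp_total_mass (M n) (\<xi> n) (a n * 1)"
      unfolding exp_total_mass_def
    proof (rule nn_integral_mono)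
      fix \<omega> assume \<omega>: "\<omega> \<in> space (M n)"
      show "ennreal (exp (a n * K)) * indicator ?B \<omega> \<le> (if emeasure (\<xi> n \<omega>) Delta = \<infinity> then \<infinity>
        else ennreal (exp (a n * 1 * measure (\<xi> n \<omega>) Delta)))"
      proof (cases "\<omega> \<in> ?B \<and> emeasure (\<xi> n \<omega>) Delta \<noteq> \<infinity>")
        case True
        then have "\<not> emeasure (\<xi> n \<omega>) Delta \<le> ennreal K" by (auto simp: mass_le_def)
        then have "\<not> ennreal (measure (\<xi> n \<omega>) Delta) \<le> ennreal K" using True by (simp add: emeasure_eq_ennreal_measure)
        then have "K \<le> measure (\<xi> n \<omega>) Delta" using ennreal_leI by (metis linear)
        then show ?thesis using True a_pos[of n] by (auto intro!: ennreal_leI mult_left_mono)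
      qed auto
    qed
    also note C
    finally have "ennreal (exp (a n * K)) * ennreal (pr ?A n) \<le> ennreal (exp (a n * C))"
      unfolding pr_def finite_measure.emeasure_eq_measure[OF finite_M] .
    then have "exp (a n * K) * pr ?A n \<le> exp (a n * C)"
      by (subst (asm) ennreal_mult[symmetric]) (auto simp: pr_def)
    then have "pr ?A n \<le> exp (a n * C) / exp (a n * K)" by (simp add: field_simps)
    also have "\<dots> = exp (a n * (C - K))" by (simp add: exp_diff[symmetric] algebra_simps)
    also have "\<dots> \<le> exp (a n * (- m))"
      unfolding exp_le_cancel_iff using a_pos[of n] K by (intro mult_left_mono) auto
    finally show ?thesis .
  qed
  then have "upper_rate (pr ?A) \<le> ereal (- m)" by (intro upper_rate_leI) simp
  with K that show ?thesis by blast
qed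

text \<open>The conditions concern box masses, which are Borel but not continuous, so measurability
  rests on \<open>borel_measurable_box_mass\<close>.\<close>

lemma fd_closed_event:
  assumes P: "admissible_family P"
  shows "{\<xi> \<in> Radon_Delta. box_mass \<xi> \<in> box_nbhd (set P) d \<mu>} \<in> sets (borel_of vague_topology)"
proof -
  have [measurable]: "(\<lambda>\<xi>. box_mass \<xi> p) \<in> borel_measurable (borel_of vague_topology)" if "p \<in> set P" for p
    using P that by (intro borel_measurable_box_mass) (auto simp: admissible_family_def split_beta)
  let ?X = "borel_of vague_topology"
  have "{\<xi> \<in> space ?X. \<forall>p\<in>set P. \<forall>q\<in>set P. nested p q \<longrightarrow>
      box_mass \<xi> p \<le> box_mass \<mu> q + d \<and> box_mass \<mu> p - d \<le> box_mass \<xi> q} \<in> sets ?X"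
    by measurable
  then show ?thesis unfolding space_borel_of topspace_vague box_nbhd_def mem_Collect_eq .
qed

lemma upper_rate_near:
  assumes mu: "\<mu> \<in> Radon_Delta" and P: "admissible_family P" and d: "d > 0"
  obtains G where "openin vague_topology G" "\<mu> \<in> G" "upper_rate (pr G) \<le> - (INF x\<in>fd_closed P d \<mu>. IP P x)"
proof -
  obtain G where G: "openin vague_topology G" "\<mu> \<in> G" "\<And>\<xi>. \<xi> \<in> G \<Longrightarrow> box_mass \<xi> \<in> box_nbhd (set P) d \<mu>"
    using box_nbhd_contains_vague[OF mu _ d, of "set P"] by auto
  let ?B = "{\<xi> \<in> Radon_Delta. box_mass \<xi> \<in> box_nbhd (set P) d \<mu>}"
  have eq: "pr ?B n = fd_pr P (fd_closed P d \<mu>) n" for n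
    unfolding pr_def fd_pr_def fd_vector_in_closed using xi_Radon by (intro arg_cong[where f="measure (M n)"]) auto
  have "pr G n \<le> pr ?B n" for n
    using G openin_subset[OF G(1)] by (intro pr_mono fd_closed_event P) auto
  then have "upper_rate (pr G) \<le> upper_rate (fd_pr P (fd_closed P d \<mu>))"
    unfolding eq by (rule upper_rate_mono)
  also have "\<dots> \<le> - (INF x\<in>fd_closed P d \<mu>. IP P x)" by (intro fd_upper P closedin_fd_closed)
  finally show ?thesis using G that by blast
qed

text \<open>Passes information from \<open>local_rate\<close> down to the finite-dimensional rate
  functions: a measure of small rate has vectors of nearly as small rate close to its box masses.
  Uniqueness and convexity both start here.\<close>

lemma INF_fd_closed_le_local_rate:
  assumes "\<mu> \<in> Radon_Delta" "admissible_family P" "d > 0"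
  shows "(INF x\<in>fd_closed P d \<mu>. IP P x) \<le> local_rate \<mu>"
proof -
  obtain G where G: "openin vague_topology G" "\<mu> \<in> G" "upper_rate (pr G) \<le> - (INF x\<in>fd_closed P d \<mu>. IP P x)"
    using upper_rate_near[OF assms] by blast
  have "- local_rate \<mu> \<le> - (INF x\<in>fd_closed P d \<mu>. IP P x)"
    using upper_rate_ge_local_rate[OF G(1,2)] G(3) by (rule order_trans)
  then show ?thesis by simp
qed

text \<open>On the compact set \<open>mass_le K\<close> the open box conditions force membership in
  \<open>G\<close>; the complement of that set costs at most the rate \<open>- m\<close>, removed by
  \<open>lower_rate_add\<close>.\<close>

lemma lower_rate_near:
  assumes G: "openin vague_topology G" "\<mu> \<in> G"
  obtains P d where "admissible_family P" "d > 0"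
    "- (INF x\<in>fd_open P d \<mu>. IP P x) \<le> max (lower_rate (pr G)) (ereal (- m))"
proof -
  have mu: "\<mu> \<in> Radon_Delta" using G openin_subset[OF G(1)] by auto
  obtain K where K: "K > 0" "upper_rate (pr (topspace vague_topology - mass_le K)) \<le> ereal (- m)"
    using exponential_tightness by blast
  obtain Q d where Q: "finite Q" "Q \<subseteq> {p. 0 \<le> fst p \<and> fst p < snd p}" and d: "d > 0"
    and sub: "\<And>\<xi>. \<xi> \<in> mass_le K \<Longrightarrow> box_mass \<xi> \<in> box_nbhd Q d \<mu> \<Longrightarrow> \<xi> \<in> G"
    using box_nbhd_inside_vague[OF mu G compactin_mass_le[OF K(1)]] by blast
  obtain P where P: "set P = Q" using finite_list[OF Q(1)] by blast
  have adm: "admissible_family P" using Q(2) P by (auto simp: admissible_family_def)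
  let ?A = "topspace vague_topology - mass_le K"
  have A: "?A \<in> sets (borel_of vague_topology)" using K(1) by (intro mass_gt_borel) simp
  have "fd_pr P (fd_open P d \<mu>) n \<le> pr G n + pr ?A n" for n
  proof -
    have "fd_pr P (fd_open P d \<mu>) n \<le> pr (G \<union> ?A) n"
      unfolding fd_pr_def pr_def
    proof (rule finite_measure.finite_measure_mono[OF finite_M])
      show "{\<omega> \<in> space (M n). \<xi> n \<omega> \<in> G \<union> ?A} \<in> sets (M n)"
        using A openin_borel_of[OF G(1)] by (intro event_sets) auto
      show "{\<omega> \<in> space (M n). fd_vector P (\<xi> n \<omega>) \<in> fd_open P d \<mu>} \<subseteq> {\<omega> \<in> space (M n). \<xi> n \<omega> \<in> G \<union> ?A}"
      proof
        fix \<omega> assume "\<omega> \<in> {\<omega> \<in> space (M n). fd_vector P (\<xi> n \<omega>) \<in> fd_open P d \<mu>}"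
        then have w: "\<omega> \<in> space (M n)" "fd_vector P (\<xi> n \<omega>) \<in> fd_open P d \<mu>" by auto
        then have "box_mass (\<xi> n \<omega>) \<in> box_nbhd Q d \<mu>"
          using fd_open_subset_closed fd_vector_in_closed P by blast
        then have "\<xi> n \<omega> \<in> mass_le K \<Longrightarrow> \<xi> n \<omega> \<in> G" by (rule sub[rotated])
        then show "\<omega> \<in> {\<omega> \<in> space (M n). \<xi> n \<omega> \<in> G \<union> ?A}" using w(1) Y_in[OF w(1)] by auto
      qed
    qed
    also have "\<dots> \<le> pr G n + pr ?A n" using A openin_borel_of[OF G(1)] by (intro pr_Un)
    finally show ?thesis .
  qed
  then have "lower_rate (fd_pr P (fd_open P d \<mu>)) \<le> lower_rate (\<lambda>n. pr G n + pr ?A n)" by (rule lower_rate_mono)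
  also have "\<dots> \<le> max (lower_rate (pr G)) (upper_rate (pr ?A))" by (rule lower_rate_add)
  also have "\<dots> \<le> max (lower_rate (pr G)) (ereal (- m))" using K(2) by (intro max.mono) auto
  finally have "- (INF x\<in>fd_open P d \<mu>. IP P x) \<le> max (lower_rate (pr G)) (ereal (- m))"
    using fd_lower[OF adm openin_fd_open] by (rule order_trans[rotated])
  with adm d that show ?thesis by blast
qed

lemma vague_LDP: "good_rate_function vague_topology local_rate" "LDP vague_topology M \<xi> a local_rate"
proof -
  have tight: "\<exists>K. compactin vague_topology K \<and> closedin vague_topology K \<and> upper_rate (pr (topspace vague_topology - K)) \<le> ereal (- m)" for m
  proof -
    obtain K where "K > 0" "upper_rate (pr (topspace vague_topology - mass_le K)) \<le> ereal (- m)"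
      using exponential_tightness by blast
    then show ?thesis using compactin_mass_le closedin_mass_le by (intro exI[of _ "mass_le K"]) simp
  qed
  have compare: "\<exists>G'. openin vague_topology G' \<and> x \<in> G' \<and> upper_rate (pr G') \<le> max (lower_rate (pr G)) (ereal (- m))"
    if G: "openin vague_topology G" "x \<in> G" for x G m
  proof -
    obtain P d where P: "admissible_family P" "d > 0"
      "- (INF y\<in>fd_open P d x. IP P y) \<le> max (lower_rate (pr G)) (ereal (- m))"
      using lower_rate_near[OF G] by blast
    have x: "x \<in> Radon_Delta" using G openin_subset[OF G(1)] by auto
    \<comment> \<open>With half the tolerance the closed set lies inside the open one, so the upper
      rate of \<open>G'\<close> stays below the lower rate of the open event.\<close>
    obtain G' where G': "openin vague_topology G'" "x \<in> G'" "upper_rate (pr G') \<le> - (INF y\<in>fd_closed P (d/2) x. IP P y)"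
      using upper_rate_near[OF x P(1), of "d/2"] P(2) by auto
    have "(INF y\<in>fd_open P d x. IP P y) \<le> (INF y\<in>fd_closed P (d/2) x. IP P y)"
      using P(2) by (intro INF_superset_mono fd_closed_subset_open) auto
    then have "- (INF y\<in>fd_closed P (d/2) x. IP P y) \<le> - (INF y\<in>fd_open P d x. IP P y)" by simp
    with G'(3) P(3) have "upper_rate (pr G') \<le> max (lower_rate (pr G)) (ereal (- m))" by (meson order_trans)
    with G' show ?thesis by blast
  qed
  show "good_rate_function vague_topology local_rate" "LDP vague_topology M \<xi> a local_rate"
    using LDP_local_rate[OF tight compare] by blast+
qed

text \<open>For a zero of \<open>local_rate\<close>, every \<open>fd_closed\<close> set around it
  contains a zero of \<open>IP P\<close>, since goodness attains the infimum; so the unique zero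
  \<open>z\<close> is close to all zeros of \<open>local_rate\<close> at once. With a box
  \<open>r\<close> between \<open>p\<close> and \<open>q\<close>, the coordinate of \<open>z\<close>
  at \<open>r\<close> separates the mass at \<open>p\<close> under one of them from the mass at
  \<open>q\<close> under the other, and \<open>Radon_eqI\<close> applies.\<close>

lemma local_rate_unique_zero:
  assumes uniq: "\<And>P. admissible_family P \<Longrightarrow> \<exists>!x. x \<in> topspace (Rh_topology (length P)) \<and> IP P x = 0"
  shows "\<exists>!\<mu>. \<mu> \<in> Radon_Delta \<and> local_rate \<mu> = 0"
proof -
  have le: "box_mass \<mu> p \<le> box_mass \<nu> q"
    if mu: "\<mu> \<in> Radon_Delta" "local_rate \<mu> = 0" and nu: "\<nu> \<in> Radon_Delta" "local_rate \<nu> = 0" and pq: "nested p q" for \<mu> \<nu> p q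
  proof -
    obtain r where r: "nested p r" "nested r q" using nested_between[OF pq] by blast
    let ?P = "[p, r, q]"
    have adm: "admissible_family ?P" using r pq by (auto simp: admissible_family_def nested_def)
    obtain z where z: "\<And>x. x \<in> topspace (Rh_topology (length ?P)) \<Longrightarrow> IP ?P x = 0 \<Longrightarrow> x = z"
      using uniq[OF adm] by blast
    have zin: "z \<in> fd_closed ?P d \<eta>" if "\<eta> \<in> Radon_Delta" "local_rate \<eta> = 0" "d > 0" for \<eta> d
    proof -
      have "(INF x\<in>fd_closed ?P d \<eta>. IP ?P x) \<le> 0" using INF_fd_closed_le_local_rate[OF that(1) adm that(3)] that(2) by simp
      then obtain x where x: "x \<in> fd_closed ?P d \<eta>" "IP ?P x = 0"
        using good_rate_function_attains_zero[OF conjunct1[OF fdLDP[OF adm]] closedin_fd_closed] by blast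
      moreover have "x \<in> topspace (Rh_topology (length ?P))" using x(1) unfolding fd_closed_def by blast
      ultimately show ?thesis using z by metis
    qed
    show ?thesis
    proof (rule field_le_epsilon)
      fix e :: real assume e: "e > 0"
      have "box_mass \<mu> p - e / 2 \<le> z 1"
        using fd_closedD(2)[OF zin[OF mu, of "e / 2"], of 0 1] e r by simp
      moreover have "z 1 \<le> box_mass \<nu> q + e / 2"
        using fd_closedD(1)[OF zin[OF nu, of "e / 2"], of 1 2] e r by simp
      ultimately show "box_mass \<mu> p \<le> box_mass \<nu> q + e" by simp
    qed
  qed
  obtain \<mu> where "\<mu> \<in> Radon_Delta" "local_rate \<mu> = 0" using LDP_exists_zero[OF vague_LDP] by auto
  then show ?thesis using Radon_eqI le by (intro ex1I[of _ \<mu>]) auto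
qed

text \<open>Box masses are affine under \<open>mix\<close>, so a convex combination of near-optimal
  vectors around \<open>\<mu>\<close> and \<open>\<nu>\<close> with tolerance \<open>d/2\<close>
  satisfies the open conditions around the mixture with tolerance \<open>d\<close>. There
  \<open>IP P\<close> is at least \<open>c\<close>, against its convexity.\<close>

lemma local_rate_convex:
  assumes conv: "\<And>P. admissible_family P \<Longrightarrow> convex_Rh (length P) (IP P)"
    and mu: "\<mu> \<in> Radon_Delta" "local_rate \<mu> = ereal i" and nu: "\<nu> \<in> Radon_Delta" "local_rate \<nu> = ereal j"
    and u: "0 \<le> u" "u \<le> 1"
  shows "local_rate (mix u \<mu> \<nu>) \<le> ereal (u * i + (1 - u) * j)"
proof (rule ccontr)
  let ?\<rho> = "mix u \<mu> \<nu>"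
  assume "\<not> ?thesis"
  then obtain c where c: "ereal (u * i + (1 - u) * j) < ereal c" "ereal c < local_rate ?\<rho>"
    using ereal_dense2 by (metis not_le)
  obtain G where G: "openin vague_topology G" "?\<rho> \<in> G" "upper_rate (pr G) < - ereal c"
    using less_local_rateD[OF c(2)] by blast
  obtain P d where P: "admissible_family P" "d > 0" "- (INF x\<in>fd_open P d ?\<rho>. IP P x) \<le> max (lower_rate (pr G)) (ereal (- c))"
    using lower_rate_near[OF G(1,2)] by blast
  have "max (lower_rate (pr G)) (ereal (- c)) \<le> ereal (- c)"
    using lower_le_upper_rate[of "pr G"] G(3) by auto
  with P(3) have "- (INF x\<in>fd_open P d ?\<rho>. IP P x) \<le> - ereal c" by (simp add: order_trans)
  then have ge: "ereal c \<le> (INF x\<in>fd_open P d ?\<rho>. IP P x)" by (simp only: ereal_minus_le_minus)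
  \<comment> \<open>Half of the gap: the near-optimal vectors may each miss by \<open>e\<close>, and
    the combined value still stays below \<open>c\<close>.\<close>
  define e where "e = (c - (u * i + (1 - u) * j)) / 2"
  have e: "e > 0" using c by (simp add: e_def)
  have approx: "\<exists>x\<in>fd_closed P (d/2) \<eta>. IP P x < ereal (k + e)" if "\<eta> \<in> Radon_Delta" "local_rate \<eta> = ereal k" for \<eta> k
  proof -
    have "(INF x\<in>fd_closed P (d/2) \<eta>. IP P x) \<le> ereal k"
      using INF_fd_closed_le_local_rate[OF that(1) P(1), of "d/2"] P(2) that(2) by simp
    also have "\<dots> < ereal (k + e)" using e by simp
    finally show ?thesis by (simp add: INF_less_iff)
  qed
  obtain x where x: "x \<in> fd_closed P (d/2) \<mu>" "IP P x < ereal (i + e)" using approx[OF mu] by blast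
  obtain y where y: "y \<in> fd_closed P (d/2) \<nu>" "IP P y < ereal (j + e)" using approx[OF nu] by blast
  have xy: "x \<in> topspace (Rh_topology (length P))" "y \<in> topspace (Rh_topology (length P))"
    using x y unfolding fd_closed_def by auto
  let ?z = "restrict (\<lambda>k. u * x k + (1 - u) * y k) {..<length P}"
  have "?z \<in> fd_open P d ?\<rho>"
    unfolding fd_open_def
  proof (intro CollectI conjI allI impI)
    show "?z \<in> topspace (Rh_topology (length P))" by simp
    fix k l assume kl: "k < length P" "l < length P" "nested (P ! k) (P ! l)"
    have lt: "fst (P ! k) < snd (P ! k)" "fst (P ! l) < snd (P ! l)" using kl(3) by (auto simp: nested_def)
    have X: "x k \<le> box_mass \<mu> (P ! l) + d/2" "box_mass \<mu> (P ! k) - d/2 \<le> x l"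
      and Y: "y k \<le> box_mass \<nu> (P ! l) + d/2" "box_mass \<nu> (P ! k) - d/2 \<le> y l"
      using fd_closedD[OF x(1) kl] fd_closedD[OF y(1) kl] by auto
    have "u * x k + (1 - u) * y k \<le> u * (box_mass \<mu> (P ! l) + d/2) + (1 - u) * (box_mass \<nu> (P ! l) + d/2)"
      using X Y u by (intro add_mono mult_left_mono) auto
    also have "\<dots> = (u * box_mass \<mu> (P ! l) + (1 - u) * box_mass \<nu> (P ! l)) + d/2"
      by (simp add: field_simps)
    also have "\<dots> = box_mass ?\<rho> (P ! l) + d/2"
      by (simp only: box_mass_mix[OF mu(1) nu(1) u lt(2)])
    also have "\<dots> < box_mass ?\<rho> (P ! l) + d" using P(2) by simp
    finally show "?z k < box_mass ?\<rho> (P ! l) + d" using kl by simp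
    have "box_mass ?\<rho> (P ! k) - d < box_mass ?\<rho> (P ! k) - d/2" using P(2) by simp
    also have "\<dots> = (u * box_mass \<mu> (P ! k) + (1 - u) * box_mass \<nu> (P ! k)) - d/2"
      by (simp only: box_mass_mix[OF mu(1) nu(1) u lt(1)])
    also have "\<dots> = u * (box_mass \<mu> (P ! k) - d/2) + (1 - u) * (box_mass \<nu> (P ! k) - d/2)"
      by (simp add: field_simps)
    also have "\<dots> \<le> u * x l + (1 - u) * y l"
      using X Y u by (intro add_mono mult_left_mono) auto
    finally show "box_mass ?\<rho> (P ! k) - d < ?z l" using kl by simp
  qed
  then have "ereal c \<le> IP P ?z" using ge by (meson INF_lower order_trans)
  also have "\<dots> \<le> ereal u * IP P x + ereal (1 - u) * IP P y"
    using conv[OF P(1)] xy u unfolding convex_Rh_def by blast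
  also have "\<dots> \<le> ereal u * ereal (i + e) + ereal (1 - u) * ereal (j + e)"
    using x(2) y(2) u by (intro add_mono ereal_mult_left_mono) auto
  also have "\<dots> = ereal (u * i + (1 - u) * j + e)" by (simp add: algebra_simps)
  finally have "c \<le> u * i + (1 - u) * j + e" by simp
  then show False using e unfolding e_def by (simp add: field_simps)
qed

text \<open>Since the integral is bounded by \<open>b\<close> times the total mass, the moments with
  parameter \<open>2 * b\<close> supply the hypothesis of \<open>Varadhan\<close>. The limit is
  finite: above by the moment bound, below by the value at a zero of the rate.\<close>

lemma Varadhan_integral:
  assumes f: "f \<in> Cc_Delta"
  obtains \<phi> where "(\<lambda>n. ereal (1 / a n) * lnEnn (\<integral>\<^sup>+\<omega>. ennreal (exp (a n * (\<integral>x. f x \<partial>(\<xi> n \<omega>)))) \<partial>M n)) \<longlonglongrightarrow> ereal \<phi>"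
    "(SUP \<mu>\<in>Radon_Delta. ereal (\<integral>x. f x \<partial>\<mu>) - local_rate \<mu>) = ereal \<phi>"
proof -
  obtain b where b: "0 < b" "\<And>\<xi>. \<xi> \<in> Radon_Delta \<Longrightarrow> emeasure \<xi> Delta \<noteq> \<infinity> \<Longrightarrow> \<bar>\<integral>x. f x \<partial>\<xi>\<bar> \<le> b * measure \<xi> Delta"
    using Cc_integral_bound[OF f] by blast
  obtain C where C: "\<And>n. exp_total_mass (M n) (\<xi> n) (a n * (2 * b)) \<le> ennreal (exp (a n * C))"
    using exp_total_mass_bound[of "2 * b"] b(1) by auto
  have mom: "(\<integral>\<^sup>+\<omega>. ennreal (exp (a n * (2 * \<bar>\<integral>x. f x \<partial>(\<xi> n \<omega>)\<bar>))) \<partial>M n) \<le> ennreal (exp (a n * C))" for n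
  proof -
    have "(\<integral>\<^sup>+\<omega>. ennreal (exp (a n * (2 * \<bar>\<integral>x. f x \<partial>(\<xi> n \<omega>)\<bar>))) \<partial>M n) \<le> exp_total_mass (M n) (\<xi> n) (a n * (2 * b))"
      unfolding exp_total_mass_def
    proof (rule nn_integral_mono)
      fix \<omega> assume \<omega>: "\<omega> \<in> space (M n)"
      show "ennreal (exp (a n * (2 * \<bar>\<integral>x. f x \<partial>(\<xi> n \<omega>)\<bar>))) \<le> (if emeasure (\<xi> n \<omega>) Delta = \<infinity> then \<infinity>
        else ennreal (exp (a n * (2 * b) * measure (\<xi> n \<omega>) Delta)))"
      proof (cases "emeasure (\<xi> n \<omega>) Delta = \<infinity>")
        case False
        have "a n * (2 * \<bar>\<integral>x. f x \<partial>(\<xi> n \<omega>)\<bar>) \<le> a n * (2 * (b * measure (\<xi> n \<omega>) Delta))"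
          using b(2)[OF xi_Radon[OF \<omega>] False] a_pos[of n] by (intro mult_left_mono) auto
        then show ?thesis using False by (auto intro!: ennreal_leI simp: mult_ac)
      qed simp
    qed
    with C[of n] show ?thesis by (rule order_trans[rotated])
  qed
  note V = Varadhan[OF vague_LDP(2) continuous_map_vague_integral[OF f] mom, unfolded topspace_vague]
  let ?\<Lambda> = "SUP \<mu>\<in>Radon_Delta. ereal (\<integral>x. f x \<partial>\<mu>) - local_rate \<mu>"
  obtain \<mu> where mu: "\<mu> \<in> Radon_Delta" "local_rate \<mu> = 0" using LDP_exists_zero[OF vague_LDP] by auto
  have "ereal (\<integral>x. f x \<partial>\<mu>) - local_rate \<mu> \<le> ?\<Lambda>" using mu(1) by (rule SUP_upper)
  then have "ereal (\<integral>x. f x \<partial>\<mu>) \<le> ?\<Lambda>" using mu(2) by simp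
  with V(2) obtain \<phi> where "?\<Lambda> = ereal \<phi>" by (cases ?\<Lambda>) auto
  with V(1) that show ?thesis by simp
qed

text \<open>One inequality is immediate from the definition of \<open>\<phi>\<close> as a supremum.
  For the other, multipliers for finitely many integral constraints turn a local bound
  \<open>c\<close> near \<open>\<mu>\<close> into a global affine bound, whose linear part is
  integration against a test function.\<close>

lemma local_rate_duality:
  assumes conv: "\<And>P. admissible_family P \<Longrightarrow> convex_Rh (length P) (IP P)"
    and \<phi>: "\<And>f. f \<in> Cc_Delta \<Longrightarrow> (SUP \<mu>\<in>Radon_Delta. ereal (\<integral>x. f x \<partial>\<mu>) - local_rate \<mu>) = ereal (\<phi> f)"
    and mu: "\<mu> \<in> Radon_Delta"
  shows "local_rate \<mu> = (SUP f\<in>Cc_Delta. ereal ((\<integral>x. f x \<partial>\<mu>) - \<phi> f))"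
proof (rule antisym)
  have nonneg: "0 \<le> local_rate \<nu>" if "\<nu> \<in> Radon_Delta" for \<nu>
    using rate_function_local_rate that by (auto simp: rate_function_def)
  have young: "ereal (\<integral>x. f x \<partial>\<nu>) - local_rate \<nu> \<le> ereal (\<phi> f)" if "f \<in> Cc_Delta" "\<nu> \<in> Radon_Delta" for f \<nu>
    using \<phi>[OF that(1)] SUP_upper[OF that(2), of "\<lambda>\<nu>. ereal (\<integral>x. f x \<partial>\<nu>) - local_rate \<nu>"] by simp
  show "(SUP f\<in>Cc_Delta. ereal ((\<integral>x. f x \<partial>\<mu>) - \<phi> f)) \<le> local_rate \<mu>"
  proof (rule SUP_least)
    fix f assume "f \<in> Cc_Delta"
    from young[OF this mu] nonneg[OF mu] show "ereal ((\<integral>x. f x \<partial>\<mu>) - \<phi> f) \<le> local_rate \<mu>"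
      by (cases "local_rate \<mu>") auto
  qed
  show "local_rate \<mu> \<le> (SUP f\<in>Cc_Delta. ereal ((\<integral>x. f x \<partial>\<mu>) - \<phi> f))"
  proof (rule ccontr)
    assume "\<not> ?thesis"
    then have "(SUP f\<in>Cc_Delta. ereal ((\<integral>x. f x \<partial>\<mu>) - \<phi> f)) < local_rate \<mu>" by (simp only: not_le)
    from ereal_dense2[OF this] obtain c where
      c: "(SUP f\<in>Cc_Delta. ereal ((\<integral>x. f x \<partial>\<mu>) - \<phi> f)) < ereal c" "ereal c < local_rate \<mu>"
      by blast
    obtain G where G: "openin vague_topology G" "\<mu> \<in> G" "upper_rate (pr G) < - ereal c"
      using less_local_rateD[OF c(2)] by blast
    have Gc: "ereal c < local_rate \<nu>" if "\<nu> \<in> G" for \<nu>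
      using upper_rate_ge_local_rate[OF G(1) that] G(3) by (metis ereal_minus_less_minus order_le_less_trans)
    obtain \<F> \<delta> where \<F>: "finite \<F>" "\<F> \<subseteq> Cc_Delta" "\<delta> > 0"
      "\<And>\<nu>. \<nu> \<in> Radon_Delta \<Longrightarrow> (\<forall>f\<in>\<F>. \<bar>(\<integral>x. f x \<partial>\<nu>) - (\<integral>x. f x \<partial>\<mu>)\<bar> < \<delta>) \<Longrightarrow> \<nu> \<in> G"
      using vague_neighbourhood_base[OF G(1,2)] by metis
    obtain fs where fs: "set fs = \<F>" using finite_list[OF \<F>(1)] by blast
    have fsC: "fs ! k \<in> Cc_Delta" if "k < length fs" for k using \<F>(2) fs that by auto
    \<comment> \<open>Restricting to finite rate makes \<open>J\<close> real-valued, as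
      \<open>convex_multipliers\<close> demands; elsewhere the final bound is trivial.\<close>
    define S where "S = {\<nu> \<in> Radon_Delta. local_rate \<nu> < \<infinity>}"
    define J where "J \<nu> = real_of_ereal (local_rate \<nu>)" for \<nu>
    define L where "L k \<nu> = (\<integral>x. (fs ! k) x \<partial>\<nu>) - (\<integral>x. (fs ! k) x \<partial>\<mu>)" for k \<nu>
    have J: "local_rate \<nu> = ereal (J \<nu>)" if "\<nu> \<in> S" for \<nu>
      using that nonneg[of \<nu>] by (cases "local_rate \<nu>") (auto simp: S_def J_def)
    \<comment> \<open>The sign makes the multiplier term equal to the integral of
      \<open>F \<theta>\<close> under \<open>\<mu>\<close> minus that under \<open>\<nu>\<close>, as
      the Legendre transform requires.\<close>
    define F where "F \<theta> x = (\<Sum>k<length fs. - \<theta> k * (fs ! k) x)" for \<theta> :: "nat \<Rightarrow> real" and x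
    have F: "F \<theta> \<in> Cc_Delta" for \<theta>
      unfolding F_def[abs_def] by (intro Cc_sum Cc_cmult fsC)
    have intF: "(\<integral>x. F \<theta> x \<partial>\<nu>) = (\<Sum>k<length fs. - \<theta> k * (\<integral>x. (fs ! k) x \<partial>\<nu>))" if "\<nu> \<in> Radon_Delta" for \<theta> \<nu>
    proof -
      have "integrable \<nu> (\<lambda>x. - \<theta> k * (fs ! k) x)" if "k < length fs" for k
        using Cc_integrable[OF \<open>\<nu> \<in> Radon_Delta\<close> fsC[OF that]] by simp
      then show ?thesis unfolding F_def by (subst Bochner_Integration.integral_sum) auto
    qed
    have sumL: "(\<Sum>k<length fs. \<theta> k * L k \<nu>) = (\<integral>x. F \<theta> x \<partial>\<mu>) - (\<integral>x. F \<theta> x \<partial>\<nu>)" if "\<nu> \<in> Radon_Delta" for \<theta> \<nu>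
      unfolding intF[OF that] intF[OF mu] L_def
      by (simp add: sum_subtractf[symmetric] sum_negf[symmetric] algebra_simps)
    have "\<exists>\<theta>. \<forall>\<nu>\<in>S. c \<le> J \<nu> + (\<Sum>k<length fs. \<theta> k * L k \<nu>)"
    proof (rule convex_multipliers)
      fix \<eta> \<nu> and u :: real assume S: "\<eta> \<in> S" "\<nu> \<in> S" and u: "0 \<le> u" "u \<le> 1"
      then have R: "\<eta> \<in> Radon_Delta" "\<nu> \<in> Radon_Delta" by (auto simp: S_def)
      have le: "local_rate (mix u \<eta> \<nu>) \<le> ereal (u * J \<eta> + (1 - u) * J \<nu>)"
        by (rule local_rate_convex[OF conv R(1) J[OF S(1)] R(2) J[OF S(2)] u])
      have mS: "mix u \<eta> \<nu> \<in> S" using le mix_Radon[OF R u] by (auto simp: S_def)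
      moreover have "J (mix u \<eta> \<nu>) \<le> u * J \<eta> + (1 - u) * J \<nu>" using le J[OF mS] by simp
      moreover have "L k (mix u \<eta> \<nu>) = u * L k \<eta> + (1 - u) * L k \<nu>" if "k < length fs" for k
        unfolding L_def integral_mix[OF R u fsC[OF that]] by (simp add: algebra_simps)
      ultimately show "\<exists>z\<in>S. (\<forall>k<length fs. L k z = u * L k \<eta> + (1 - u) * L k \<nu>) \<and> J z \<le> u * J \<eta> + (1 - u) * J \<nu>" by blast
    next
      show "\<delta> > 0" by (rule \<F>)
      fix \<nu> assume nu: "\<nu> \<in> S" "\<forall>k<length fs. \<bar>L k \<nu>\<bar> < \<delta>"
      then have "\<nu> \<in> G" using fs by (intro \<F>(4)) (auto simp: S_def L_def in_set_conv_nth)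
      from Gc[OF this] show "c \<le> J \<nu>" using J[OF nu(1)] by simp
    next
      fix \<theta> :: "nat \<Rightarrow> real"
      \<comment> \<open>The lower bound needed for every \<open>\<theta>\<close> is the finiteness
        of \<open>\<phi>\<close> at \<open>F \<theta>\<close>.\<close>
      have "(\<integral>x. F \<theta> x \<partial>\<mu>) - \<phi> (F \<theta>) \<le> J \<nu> + (\<Sum>k<length fs. \<theta> k * L k \<nu>)" if "\<nu> \<in> S" for \<nu>
        using young[OF F[of \<theta>], of \<nu>] J[OF that] sumL[of \<nu> \<theta>] that by (auto simp: S_def)
      then show "\<exists>b. \<forall>\<nu>\<in>S. b \<le> J \<nu> + (\<Sum>k<length fs. \<theta> k * L k \<nu>)" by blast
    qed
    then obtain \<theta> where \<theta>: "\<And>\<nu>. \<nu> \<in> S \<Longrightarrow> c \<le> J \<nu> + (\<Sum>k<length fs. \<theta> k * L k \<nu>)" by blast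
    have "ereal (\<phi> (F \<theta>)) \<le> ereal ((\<integral>x. F \<theta> x \<partial>\<mu>) - c)"
      unfolding \<phi>[OF F, symmetric]
    proof (rule SUP_least)
      fix \<nu> assume nu: "\<nu> \<in> Radon_Delta"
      show "ereal (\<integral>x. F \<theta> x \<partial>\<nu>) - local_rate \<nu> \<le> ereal ((\<integral>x. F \<theta> x \<partial>\<mu>) - c)"
      proof (cases "\<nu> \<in> S")
        case True
        then show ?thesis using \<theta>[OF True] sumL[OF nu, of \<theta>] J[OF True] by simp
      next
        case False
        then have "local_rate \<nu> = \<infinity>" using nu by (simp add: S_def)
        then show ?thesis by simp
      qed
    qed
    then have "ereal c \<le> ereal ((\<integral>x. F \<theta> x \<partial>\<mu>) - \<phi> (F \<theta>))" by simp
    also have "\<dots> \<le> (SUP f\<in>Cc_Delta. ereal ((\<integral>x. f x \<partial>\<mu>) - \<phi> f))" by (rule SUP_upper[OF F])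
    finally show False using c(1) by simp
  qed
qed

end

theorem mainTheorem12:
  fixes a :: "nat \<Rightarrow> real"
    and M :: "nat \<Rightarrow> 'w measure"
    and \<xi> :: "nat \<Rightarrow> 'w \<Rightarrow> (ereal \<times> ereal) measure"
    and IP :: "(real \<times> real) list \<Rightarrow> (nat \<Rightarrow> real) \<Rightarrow> ereal"
  assumes a_pos: "\<And>n. a n > 0"
    and a_lim: "filterlim a at_top sequentially"
    and prob: "\<And>n. prob_space (M n)"
    and meas: "\<And>n. \<xi> n \<in> M n \<rightarrow>\<^sub>M borel_of vague_topology"
    and expmom: "\<And>lam::real. lam > 0 \<Longrightarrow>
        \<exists>C::real. \<forall>n. ereal (1 / a n) * lnEnn (exp_total_mass (M n) (\<xi> n) (a n * lam)) \<le> ereal C"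
    and fdLDP: "\<And>P. admissible_family P \<Longrightarrow>
        good_rate_function (Rh_topology (length P)) (IP P) \<and>
        LDP (Rh_topology (length P)) M (\<lambda>n \<omega>. fd_vector P (\<xi> n \<omega>)) a (IP P)"
  shows "\<exists>I :: (ereal \<times> ereal) measure \<Rightarrow> ereal.
     good_rate_function vague_topology I \<and> LDP vague_topology M \<xi> a I \<and>
     ((\<exists>K::real. K > 0 \<and> (\<forall>n. \<forall>\<omega>\<in>space (M n). emeasure (\<xi> n \<omega>) Delta \<le> ennreal K)) \<and>
      (\<forall>P. admissible_family P \<longrightarrow> (\<exists>!x. x \<in> topspace (Rh_topology (length P)) \<and> IP P x = 0))
      \<longrightarrow> (\<exists>!\<mu>. \<mu> \<in> Radon_Delta \<and> I \<mu> = 0)) \<and>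
     ((\<forall>P. admissible_family P \<longrightarrow> convex_Rh (length P) (IP P))
      \<longrightarrow> (\<exists>\<phi> :: (ereal \<times> ereal \<Rightarrow> real) \<Rightarrow> real.
            (\<forall>f\<in>Cc_Delta.
               (\<lambda>n. ereal (1 / a n) *
                  lnEnn (\<integral>\<^sup>+\<omega>. ennreal (exp (a n * (\<integral>x. f x \<partial>(\<xi> n \<omega>)))) \<partial>M n))
               \<longlonglongrightarrow> ereal (\<phi> f)) \<and>
            (\<forall>\<mu>\<in>Radon_Delta. I \<mu> = (SUP f\<in>Cc_Delta. ereal ((\<integral>x. f x \<partial>\<mu>) - \<phi> f)))))"
proof -
  have "random_process a vague_topology M \<xi>"
    by (intro random_process.intro speed.intro random_process_axioms.intro a_pos a_lim prob meas)
  then interpret box_LDP a M \<xi> IP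
    by (intro box_LDP.intro box_LDP_axioms.intro expmom fdLDP)
  have "\<forall>f\<in>Cc_Delta. \<exists>c. (\<lambda>n. ereal (1 / a n) * lnEnn (\<integral>\<^sup>+\<omega>. ennreal (exp (a n * (\<integral>x. f x \<partial>(\<xi> n \<omega>)))) \<partial>M n))
        \<longlonglongrightarrow> ereal c \<and> (SUP \<mu>\<in>Radon_Delta. ereal (\<integral>x. f x \<partial>\<mu>) - local_rate \<mu>) = ereal c"
    (is "\<forall>f\<in>_. \<exists>c. ?\<phi> f c")
  proof
    fix f assume "f \<in> Cc_Delta"
    from Varadhan_integral[OF this] show "\<exists>c. ?\<phi> f c" by blast
  qed
  \<comment> \<open>A single choice serves both roles of \<open>\<phi>\<close>: limit of the scaled
    log-moments and conjugate of \<open>local_rate\<close>.\<close>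
  from bchoice[OF this] obtain \<phi> where \<phi>: "\<And>f. f \<in> Cc_Delta \<Longrightarrow>
      (\<lambda>n. ereal (1 / a n) * lnEnn (\<integral>\<^sup>+\<omega>. ennreal (exp (a n * (\<integral>x. f x \<partial>(\<xi> n \<omega>)))) \<partial>M n)) \<longlonglongrightarrow> ereal (\<phi> f)"
    "\<And>f. f \<in> Cc_Delta \<Longrightarrow> (SUP \<mu>\<in>Radon_Delta. ereal (\<integral>x. f x \<partial>\<mu>) - local_rate \<mu>) = ereal (\<phi> f)"
    by blast
  show ?thesis
  proof (intro exI[of _ local_rate] conjI impI vague_LDP)
    assume "(\<exists>K::real. K > 0 \<and> (\<forall>n. \<forall>\<omega>\<in>space (M n). emeasure (\<xi> n \<omega>) Delta \<le> ennreal K)) \<and>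
      (\<forall>P. admissible_family P \<longrightarrow> (\<exists>!x. x \<in> topspace (Rh_topology (length P)) \<and> IP P x = 0))"
    then show "\<exists>!\<mu>. \<mu> \<in> Radon_Delta \<and> local_rate \<mu> = 0" by (intro local_rate_unique_zero) blast
  next
    assume conv: "\<forall>P. admissible_family P \<longrightarrow> convex_Rh (length P) (IP P)"
    have "local_rate \<mu> = (SUP f\<in>Cc_Delta. ereal ((\<integral>x. f x \<partial>\<mu>) - \<phi> f))" if "\<mu> \<in> Radon_Delta" for \<mu>
      using conv by (intro local_rate_duality[OF _ \<phi>(2) that]) auto
    with \<phi>(1) show "\<exists>\<phi>. (\<forall>f\<in>Cc_Delta.
               (\<lambda>n. ereal (1 / a n) *
                  lnEnn (\<integral>\<^sup>+\<omega>. ennreal (exp (a n * (\<integral>x. f x \<partial>(\<xi> n \<omega>)))) \<partial>M n))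
               \<longlonglongrightarrow> ereal (\<phi> f)) \<and>
            (\<forall>\<mu>\<in>Radon_Delta. local_rate \<mu> = (SUP f\<in>Cc_Delta. ereal ((\<integral>x. f x \<partial>\<mu>) - \<phi> f)))"
      by blast
  qed
qed

end
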